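(* Let $N=2n$ be a positive even integer and let $k$ be a positive integer. For every $u\in\mathbb{C}$ one has $D_k(u)=D'_k(u)$ in $U(\mathfrak{sp}(J_0))$, where $$D_k(u)=\sum_{1\le\alpha_1\le\cdots\le\alpha_k\le N}\frac{1}{\alpha!}\operatorname{per}\Bigl(\widetilde F_\alpha+u\mathbf{1}_\alpha-\mathbf{1}_\alpha\operatorname{diag}\bigl(\tfrac k2-1,\tfrac k2-2,\ldots,-\tfrac k2\bigr)\Bigr)$$ and $$D'_k(u)=\operatorname{Per}_k\bigl(F+u\mathbf{1}\,;\,\tfrac k2-1,\tfrac k2-2,\ldots,-\tfrac k2+1,0\bigr).$$
   Context: Let $N=2n$ be a positive even integer. Put $i'=N+1-i$, and $\varepsilon(i)=-1$ for $1\le i\le n$, $\varepsilon(i)=+1$ for $n+1\le i\le N$. Let $J_0$ be the $N\times N$ alternating matrix with $(i,j)$ entry $\varepsilon(j)\delta_{i,j'}$, and $\mathfrak{sp}(J_0)=\{Z\in\mathfrak{gl}_N(\mathbb{C}) : {}^tZJ_0+J_0Z=0\}$. With $E_{ij}$ the standard basis (matrix units) of $\mathfrak{gl}_N(\mathbb{C})$, put $F_{ij}=E_{ij}-\varepsilon(i)\varepsilon(j)E_{j'i'}\in\mathfrak{sp}(J_0)$ (equivalently $F_{ij}=E_{ij}-J_0^{-1}E_{ji}J_0$), and let $F=(F_{ij})_{1\le i,j\le N}$, regarded as an $N\times N$ matrix with entries in $U(\mathfrak{sp}(J_0))$. Put $\widetilde F=F-\operatorname{diag}(0,\ldots,0,1,\ldots,1)$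 with $n$ zeros and $n$ ones. $\mathbf{1}$ is the $N\times N$ unit matrix. For an $N\times N$ matrix $Z=(Z_{ij})$ and $\alpha=(\alpha_1,\ldots,\alpha_k)$ non-decreasing with values in $\{1,\ldots,N\}$, $Z_\alpha=(Z_{\alpha_i\alpha_j})_{1\le i,j\le k}$ (a $k\times k$ matrix; indices may be repeated, so e.g. $\mathbf 1_\alpha=(\delta_{\alpha_i\alpha_j})$), and $\alpha!=m_1!\cdots m_N!$ where $m_i$ is the multiplicity of $i$ in $\alpha$. For a $k\times k$ matrix $Z$ over a possibly non-commutative algebra, the column-permanent is $\operatorname{per}Z=\sum_{\sigma\in\mathfrak{S}_k}Z_{\sigma(1)1}Z_{\sigma(2)2}\cdots Z_{\sigma(k)k}$. For an $N\times N$ matrix $Z$ over a possibly non-commutative $\mathbb{C}$-algebra and $a_1,\ldots,a_k\in\mathbb{C}$, the symmetrized permanent is $$\operatorname{Per}_k(Z;a_1,\ldots,a_k)=\frac1{k!}\sum_{1\le\alpha_1\le\cdots\le\alpha_k\le N}\frac1{\alpha!}\sum_{\sigma,\sigma'\in\mathfrak{S}_k}Z_{\alpha_{\sigma(1)}\alpha_{\sigma'(1)}}(a_1)\cdots Z_{\alpha_{\sigma(k)}\alpha_{\sigma'(k)}}(a_k),$$ with $Z_{ij}(a)=Z_{ij}+\delta_{ij}a$. In $D'_k(u)$ the $k$ parameters are the $k-1$ numbers $\tfrac k2-1,\tfrac k2-2,\ldots,-\tfrac k2+1$ (decreasing by steps of $1$) followed by $0$; for $k=1$ the only parameter is $0$.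 *)

theory Defs
  imports
    Complex_Main
    "HOL-Library.Cardinality"
    "HOL-Library.Poly_Mapping"
    "HOL-Combinatorics.Permutations"
    "Jordan_Normal_Form.Matrix"
begin

section \<open>Complex vector spaces, unital associative algebras and Lie algebras\<close>

class complex_vector = ab_group_add +
  fixes scaleC :: "complex \<Rightarrow> 'a \<Rightarrow> 'a"  (infixr "*\<^sub>C" 75)
  assumes scaleC_add_right: "a *\<^sub>C (x + y) = a *\<^sub>C x + a *\<^sub>C y"
    and scaleC_add_left: "(a + b) *\<^sub>C x = a *\<^sub>C x + b *\<^sub>C x"
    and scaleC_scaleC: "a *\<^sub>C b *\<^sub>C x = (a * b) *\<^sub>C x"
    and scaleC_one: "1 *\<^sub>C x = x"

class complex_algebra_1 = complex_vector + ring_1 +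
  assumes mult_scaleC_left: "(a *\<^sub>C x) * y = a *\<^sub>C (x * y)"
    and mult_scaleC_right: "x * (a *\<^sub>C y) = a *\<^sub>C (x * y)"

class complex_lie_algebra = complex_vector +
  fixes lie_bracket :: "'a \<Rightarrow> 'a \<Rightarrow> 'a"
  assumes lie_bracket_add_left: "lie_bracket (x + y) z = lie_bracket x z + lie_bracket y z"
    and lie_bracket_add_right: "lie_bracket x (y + z) = lie_bracket x y + lie_bracket x z"
    and lie_bracket_scaleC_left: "lie_bracket (a *\<^sub>C x) y = a *\<^sub>C lie_bracket x y"
    and lie_bracket_scaleC_right: "lie_bracket x (a *\<^sub>C y) = a *\<^sub>C lie_bracket x y"
    and lie_bracket_self: "lie_bracket x x = 0"
    and lie_bracket_jacobi:
      "lie_bracket x (lie_bracket y z) + lie_bracket y (lie_bracket z x)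
        + lie_bracket z (lie_bracket x y) = 0"


section \<open>The universal enveloping algebra\<close>

text \<open>Finitely supported functions on the free monoid over \<open>'a\<close>, with the convolution product, form
  the free unital associative algebra on the set \<open>'a\<close>.\<close>

datatype 'a free_monoid = Word (letters: "'a list")

instantiation free_monoid :: (type) monoid_add
begin

definition "0 = Word []"
definition "v + w = Word (letters v @ letters w)"

instance
  by standard (simp_all add: zero_free_monoid_def plus_free_monoid_def)

end

lemma free_monoid_add_eq_0_iff: "0 = v + w \<longleftrightarrow> v = 0 \<and> w = (0 :: 'a free_monoid)"
  by (cases v; cases w) (auto simp: zero_free_monoid_def plus_free_monoid_def)

type_synonym 'a free_algebra = "'a free_monoid \<Rightarrow>\<^sub>0 complex"

definition free_gen :: "'a \<Rightarrow> 'a free_algebra" where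
  "free_gen x = Poly_Mapping.single (Word [x]) 1"

definition free_const :: "complex \<Rightarrow> 'a free_algebra" where
  "free_const c = Poly_Mapping.single 0 c"

text \<open>The two-sided ideal generated by the relations expressing that the generators depend linearly
  on the elements of the Lie algebra (which turns the free algebra on the underlying set into the
  tensor algebra) and that commutators of generators are Lie brackets.\<close>

inductive_set uea_ideal :: "'a::complex_lie_algebra free_algebra set" where
  rel_add: "free_gen (x + y) - free_gen x - free_gen y \<in> uea_ideal"
| rel_scale: "free_gen (c *\<^sub>C x) - free_const c * free_gen x \<in> uea_ideal"
| rel_bracket:
    "free_gen x * free_gen y - free_gen y * free_gen x - free_gen (lie_bracket x y) \<in> uea_ideal"
| zero: "0 \<in> uea_ideal"
| add: "p \<in> uea_ideal \<Longrightarrow> q \<in> uea_ideal \<Longrightarrow> p + q \<in> uea_ideal"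
| mult: "p \<in> uea_ideal \<Longrightarrow> a * p * b \<in> uea_ideal"

lemma uea_ideal_mult_left: "p \<in> uea_ideal \<Longrightarrow> a * p \<in> uea_ideal"
  using uea_ideal.mult[of p a 1] by simp

lemma uea_ideal_mult_right: "p \<in> uea_ideal \<Longrightarrow> p * a \<in> uea_ideal"
  using uea_ideal.mult[of p 1 a] by simp

lemma uea_ideal_uminus: "p \<in> uea_ideal \<Longrightarrow> - p \<in> uea_ideal"
  using uea_ideal.mult[of p "-1" 1] by simp

lemma lookup_mult_0:
  fixes p q :: "'a free_algebra"
  shows "Poly_Mapping.lookup (p * q) 0 = Poly_Mapping.lookup p 0 * Poly_Mapping.lookup q 0"
proof -
  have "Sum_any (\<lambda>w. Poly_Mapping.lookup q w when 0 = v + w)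
      = (Poly_Mapping.lookup q 0 when v = 0)" for v :: "'a free_monoid"
  proof -
    have "Sum_any (\<lambda>w. Poly_Mapping.lookup q w when 0 = v + w)
        = Sum_any (\<lambda>w. (Poly_Mapping.lookup q w when v = 0) when w = 0)"
      by (rule Sum_any.cong) (auto simp: free_monoid_add_eq_0_iff when_def)
    then show ?thesis by simp
  qed
  then show ?thesis
    by (simp add: lookup_mult mult_when)
qed

lemma lookup_free_gen_0: "Poly_Mapping.lookup (free_gen x) 0 = 0"
  by (simp add: free_gen_def lookup_single zero_free_monoid_def)

lemma lookup_uea_ideal_0: "p \<in> uea_ideal \<Longrightarrow> Poly_Mapping.lookup p 0 = 0"
  by (induction rule: uea_ideal.induct)
    (auto simp: lookup_mult_0 lookup_add lookup_minus lookup_free_gen_0)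

lemma one_notin_uea_ideal: "1 \<notin> uea_ideal"
  using lookup_uea_ideal_0[of 1] by (auto simp: lookup_one)

lemma free_const_commute:
  fixes p :: "'a free_algebra"
  shows "free_const c * p = p * free_const c"
proof (rule poly_mapping_eqI)
  fix k :: "'a free_monoid"
  have "Sum_any (\<lambda>w. Poly_Mapping.lookup (free_const c) w when k = v + w) = (c when k = v)" for v
  proof -
    have "Sum_any (\<lambda>w. Poly_Mapping.lookup (free_const c) w when k = v + w)
        = Sum_any (\<lambda>w :: 'a free_monoid. (c when k = v) when w = 0)"
      by (rule Sum_any.cong) (simp add: free_const_def lookup_single when_def)
    then show ?thesis by simp
  qed
  then have "Poly_Mapping.lookup (p * free_const c) k = Poly_Mapping.lookup p k * c"
    by (simp add: lookup_mult mult_when)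
  moreover have "Poly_Mapping.lookup (free_const c * p) k = c * Poly_Mapping.lookup p k"
    by (simp add: free_const_def lookup_mult lookup_single when_mult)
  ultimately show
    "Poly_Mapping.lookup (free_const c * p) k = Poly_Mapping.lookup (p * free_const c) k"
    by simp
qed

definition uea_rel :: "'a::complex_lie_algebra free_algebra \<Rightarrow> 'a free_algebra \<Rightarrow> bool" where
  "uea_rel p q \<longleftrightarrow> p - q \<in> uea_ideal"

quotient_type (overloaded) 'a uea = "'a::complex_lie_algebra free_algebra" / uea_rel
proof (rule equivpI)
  show "reflp uea_rel"
    by (simp add: reflp_def uea_rel_def uea_ideal.zero)
  show "symp uea_rel"
    by (metis minus_diff_eq symp_def uea_ideal_uminus uea_rel_def)
  show "transp uea_rel"
    by (auto simp: transp_def uea_rel_def dest: uea_ideal.add)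
qed

instantiation uea :: (complex_lie_algebra) complex_algebra_1
begin

lift_definition zero_uea :: "'a uea" is 0 .

lift_definition one_uea :: "'a uea" is 1 .

lift_definition plus_uea :: "'a uea \<Rightarrow> 'a uea \<Rightarrow> 'a uea" is "(+)"
  unfolding uea_rel_def by (metis add_diff_add uea_ideal.add)

lift_definition uminus_uea :: "'a uea \<Rightarrow> 'a uea" is uminus
  unfolding uea_rel_def using uea_ideal_uminus by fastforce

lift_definition minus_uea :: "'a uea \<Rightarrow> 'a uea \<Rightarrow> 'a uea" is "(-)"
proof -
  fix p p' q q' :: "'a free_algebra"
  assume "uea_rel p p'" "uea_rel q q'"
  then have "(p - p') + - (q - q') \<in> uea_ideal"
    unfolding uea_rel_def by (intro uea_ideal.add uea_ideal_uminus)
  then show "uea_rel (p - q) (p' - q')"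
    unfolding uea_rel_def by (simp add: algebra_simps)
qed

lift_definition times_uea :: "'a uea \<Rightarrow> 'a uea \<Rightarrow> 'a uea" is "(*)"
proof -
  fix p p' q q' :: "'a free_algebra"
  assume "uea_rel p p'" "uea_rel q q'"
  then have "(p - p') * q + p' * (q - q') \<in> uea_ideal"
    unfolding uea_rel_def by (intro uea_ideal.add uea_ideal_mult_left uea_ideal_mult_right)
  then show "uea_rel (p * q) (p' * q')"
    unfolding uea_rel_def by (simp add: algebra_simps)
qed

lift_definition scaleC_uea :: "complex \<Rightarrow> 'a uea \<Rightarrow> 'a uea" is "\<lambda>c p. free_const c * p"
  unfolding uea_rel_def by (metis right_diff_distrib uea_ideal_mult_left)

instance
proof
  fix x y z :: "'a uea" and a b :: complex
  have eqI: "p = q \<Longrightarrow> uea_rel p q" for p q :: "'a free_algebra"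
    by (simp add: uea_rel_def uea_ideal.zero)
  show "x + y + z = x + (y + z)" by transfer (rule eqI, simp add: algebra_simps)
  show "x + y = y + x" by transfer (rule eqI, simp add: algebra_simps)
  show "0 + x = x" by transfer (rule eqI, simp)
  show "- x + x = 0" by transfer (rule eqI, simp)
  show "x - y = x + - y" by transfer (rule eqI, simp)
  show "x * y * z = x * (y * z)" by transfer (rule eqI, simp add: mult.assoc)
  show "1 * x = x" by transfer (rule eqI, simp)
  show "x * 1 = x" by transfer (rule eqI, simp)
  show "(x + y) * z = x * z + y * z" by transfer (rule eqI, simp add: algebra_simps)
  show "x * (y + z) = x * y + x * z" by transfer (rule eqI, simp add: algebra_simps)
  show "(0 :: 'a uea) \<noteq> 1"
    by transfer (use one_notin_uea_ideal uea_ideal_uminus in \<open>fastforce simp: uea_rel_def\<close>)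
  show "a *\<^sub>C (x + y) = a *\<^sub>C x + a *\<^sub>C y"
    by transfer (rule eqI, simp add: algebra_simps)
  show "(a + b) *\<^sub>C x = a *\<^sub>C x + b *\<^sub>C x"
    by transfer (rule eqI, simp add: free_const_def single_add algebra_simps)
  show "a *\<^sub>C b *\<^sub>C x = (a * b) *\<^sub>C x"
    by transfer (rule eqI, simp add: free_const_def mult_single flip: mult.assoc)
  show "1 *\<^sub>C x = x"
    by transfer (rule eqI, simp add: free_const_def)
  show "(a *\<^sub>C x) * y = a *\<^sub>C (x * y)"
    by transfer (rule eqI, simp add: mult.assoc)
  show "x * (a *\<^sub>C y) = a *\<^sub>C (x * y)"
    by transfer (rule eqI, metis free_const_commute mult.assoc)
qed

end

lift_definition uea_of :: "'a::complex_lie_algebra \<Rightarrow> 'a uea" is free_gen .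

lemma uea_of_add: "uea_of (x + y) = uea_of x + uea_of y"
  by transfer (use uea_ideal.rel_add in \<open>auto simp: uea_rel_def diff_diff_eq\<close>)

lemma uea_of_scaleC: "uea_of (c *\<^sub>C x) = c *\<^sub>C uea_of x"
  by transfer (simp add: uea_rel_def uea_ideal.rel_scale)

lemma uea_of_lie_bracket: "uea_of (lie_bracket x y) = uea_of x * uea_of y - uea_of y * uea_of x"
proof transfer
  fix x y :: 'a
  show "uea_rel (free_gen (lie_bracket x y)) (free_gen x * free_gen y - free_gen y * free_gen x)"
    using uea_ideal_uminus[OF uea_ideal.rel_bracket[of x y]] by (simp add: uea_rel_def)
qed


section \<open>The symplectic Lie algebra\<close>

text \<open>Row and column indices run through \<open>{1..2 * n}\<close>, while matrices of type \<^typ>\<open>'a mat\<close>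
  are indexed from \<open>0\<close>; hence the shifts by one in the definitions of \<open>J0\<close> and \<open>mat_unit\<close>.\<close>

definition eps :: "nat \<Rightarrow> nat \<Rightarrow> complex" where
  "eps n i = (if i \<le> n then - 1 else 1)"

definition refl_index :: "nat \<Rightarrow> nat \<Rightarrow> nat" where
  "refl_index n i = 2 * n + 1 - i"

definition J0 :: "nat \<Rightarrow> complex mat" where
  "J0 n = mat (2 * n) (2 * n)
    (\<lambda>(a, b). if a + 1 = refl_index n (b + 1) then eps n (b + 1) else 0)"

definition mat_unit :: "nat \<Rightarrow> nat \<Rightarrow> nat \<Rightarrow> complex mat" where
  "mat_unit n i j = mat (2 * n) (2 * n) (\<lambda>(a, b). if a + 1 = i \<and> b + 1 = j then 1 else 0)"

definition sp_mats :: "nat \<Rightarrow> complex mat set" where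
  "sp_mats n = {Z \<in> carrier_mat (2 * n) (2 * n).
    transpose_mat Z * J0 n + J0 n * Z = 0\<^sub>m (2 * n) (2 * n)}"

lemma J0_carrier [simp]: "J0 n \<in> carrier_mat (2 * n) (2 * n)"
  by (simp add: J0_def)

lemma J0_dim [simp]: "dim_row (J0 n) = 2 * n" "dim_col (J0 n) = 2 * n"
  by (simp_all add: J0_def)

lemma mat_unit_carrier [simp]: "mat_unit n i j \<in> carrier_mat (2 * n) (2 * n)"
  by (simp add: mat_unit_def)

lemma sp_matsI:
  assumes "Z \<in> carrier_mat (2 * n) (2 * n)" and "transpose_mat Z * J0 n = - (J0 n * Z)"
  shows "Z \<in> sp_mats n"
  using assms mult_carrier_mat[OF J0_carrier assms(1)]
  by (simp add: sp_mats_def uminus_l_inv_mat[of _ "2 * n" "2 * n"])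

lemma sp_matsD:
  assumes "Z \<in> sp_mats n"
  shows "Z \<in> carrier_mat (2 * n) (2 * n)" and "transpose_mat Z * J0 n = - (J0 n * Z)"
proof -
  show Z: "Z \<in> carrier_mat (2 * n) (2 * n)"
    using assms by (simp add: sp_mats_def)
  have eq: "transpose_mat Z * J0 n + J0 n * Z = 0\<^sub>m (2 * n) (2 * n)"
    using assms by (simp add: sp_mats_def)
  show "transpose_mat Z * J0 n = - (J0 n * Z)"
  proof (rule eq_matI)
    fix a b
    assume "a < dim_row (- (J0 n * Z))" "b < dim_col (- (J0 n * Z))"
    then have ab: "a < 2 * n" "b < 2 * n"
      using Z by auto
    have "(transpose_mat Z * J0 n + J0 n * Z) $$ (a, b) = 0"
      unfolding eq using ab by simp
    then show "(transpose_mat Z * J0 n) $$ (a, b) = (- (J0 n * Z)) $$ (a, b)"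
      using ab Z by (auto simp: eq_neg_iff_add_eq_0 simp del: index_mult_mat(1))
  qed (use Z in auto)
qed

lemma sp_mats_zero: "0\<^sub>m (2 * n) (2 * n) \<in> sp_mats n"
  by (auto simp: sp_mats_def)

lemma sp_mats_smult:
  assumes "X \<in> sp_mats n"
  shows "c \<cdot>\<^sub>m X \<in> sp_mats n"
proof -
  note X = sp_matsD[OF assms]
  have "transpose_mat (c \<cdot>\<^sub>m X) = c \<cdot>\<^sub>m transpose_mat X"
    using X(1) by (intro eq_matI) auto
  then have "transpose_mat (c \<cdot>\<^sub>m X) * J0 n = c \<cdot>\<^sub>m (- (J0 n * X))"
    using X(1) by (simp add: mult_smult_assoc_mat[of _ "2 * n" "2 * n" _ "2 * n"] flip: X(2))
  also have "\<dots> = - (J0 n * (c \<cdot>\<^sub>m X))"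
    using X(1)
    by (subst mult_smult_distrib[of _ "2 * n" "2 * n" _ "2 * n"]) (auto intro!: eq_matI)
  finally show ?thesis
    using X(1) by (intro sp_matsI) auto
qed

lemma sp_mats_uminus:
  assumes "X \<in> sp_mats n"
  shows "- X \<in> sp_mats n"
proof -
  have "- X = (- 1) \<cdot>\<^sub>m X"
    by (intro eq_matI) auto
  then show ?thesis
    using sp_mats_smult[OF assms, of "- 1"] by simp
qed

lemma sp_mats_add:
  assumes "X \<in> sp_mats n" "Y \<in> sp_mats n"
  shows "X + Y \<in> sp_mats n"
proof -
  note X = sp_matsD[OF assms(1)] and Y = sp_matsD[OF assms(2)]
  have "transpose_mat (X + Y) * J0 n = - (J0 n * X) + - (J0 n * Y)"
    using X(1) Y(1)
    by (simp add: transpose_add[of _ "2 * n" "2 * n"]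
        add_mult_distrib_mat[of _ "2 * n" "2 * n" _ _ "2 * n"] flip: X(2) Y(2))
  also have "\<dots> = - (J0 n * (X + Y))"
    using X(1) Y(1)
    by (subst mult_add_distrib_mat[of _ "2 * n" "2 * n" _ "2 * n"])
      (auto intro!: eq_matI simp del: index_mult_mat(1))
  finally show ?thesis
    using X(1) Y(1) by (intro sp_matsI) auto
qed

lemma sp_mats_minus:
  assumes "X \<in> sp_mats n" "Y \<in> sp_mats n"
  shows "X - Y \<in> sp_mats n"
proof -
  have "X - Y = X + - Y"
    using sp_matsD(1)[OF assms(1)] sp_matsD(1)[OF assms(2)] by (intro eq_matI) auto
  then show ?thesis
    using sp_mats_add[OF assms(1) sp_mats_uminus[OF assms(2)]] by simp
qed

lemma sp_mats_transpose_mult: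
  assumes "X \<in> sp_mats n" "Y \<in> sp_mats n"
  shows "transpose_mat (X * Y) * J0 n = J0 n * (Y * X)"
proof -
  note X = sp_matsD[OF assms(1)] and Y = sp_matsD[OF assms(2)]
  have "transpose_mat (X * Y) * J0 n = transpose_mat Y * (transpose_mat X * J0 n)"
    using X(1) Y(1)
    by (simp add: transpose_mult[of _ "2 * n" "2 * n" _ "2 * n"]
        assoc_mult_mat[of _ "2 * n" "2 * n" _ "2 * n" _ "2 * n"])
  also have "\<dots> = - (transpose_mat Y * (J0 n * X))"
    using X Y(1) by auto
  also have "\<dots> = - ((transpose_mat Y * J0 n) * X)"
    using X(1) Y(1) by (simp add: assoc_mult_mat[of _ "2 * n" "2 * n" _ "2 * n" _ "2 * n"])
  also have "\<dots> = (J0 n * Y) * X"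
    using X(1) Y by auto
  finally show ?thesis
    using X(1) Y(1) by (simp add: assoc_mult_mat[of _ "2 * n" "2 * n" _ "2 * n" _ "2 * n"])
qed

lemma sp_mats_commutator:
  assumes "X \<in> sp_mats n" "Y \<in> sp_mats n"
  shows "X * Y - Y * X \<in> sp_mats n"
proof -
  note X = sp_matsD(1)[OF assms(1)] and Y = sp_matsD(1)[OF assms(2)]
  have XY: "X * Y \<in> carrier_mat (2 * n) (2 * n)" "Y * X \<in> carrier_mat (2 * n) (2 * n)"
    using X Y by auto
  have "transpose_mat (X * Y - Y * X) * J0 n = J0 n * (Y * X) - J0 n * (X * Y)"
    using XY assms
    by (simp add: transpose_minus[of _ "2 * n" "2 * n"]
        minus_mult_distrib_mat[of _ "2 * n" "2 * n" _ _ "2 * n"] sp_mats_transpose_mult)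
  also have "\<dots> = - (J0 n * (X * Y - Y * X))"
    using X Y
    by (subst mult_minus_distrib_mat[of _ "2 * n" "2 * n" _ "2 * n"])
      (auto intro!: eq_matI simp del: index_mult_mat(1))
  finally show ?thesis
    by (rule sp_matsI[OF minus_carrier_mat[OF XY(2)]])
qed

text \<open>The size \<open>n\<close> enters through the type argument, as its cardinality; nothing else about that
  type is used.\<close>

typedef (overloaded) ('n::finite) sp = "sp_mats CARD('n)"
  using sp_mats_zero by blast

setup_lifting type_definition_sp

instantiation sp :: (finite) complex_lie_algebra
begin

lift_definition zero_sp :: "'a sp" is "0\<^sub>m (2 * CARD('a)) (2 * CARD('a))"
  by (rule sp_mats_zero)

lift_definition plus_sp :: "'a sp \<Rightarrow> 'a sp \<Rightarrow> 'a sp" is "(+)"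
  by (rule sp_mats_add)

lift_definition uminus_sp :: "'a sp \<Rightarrow> 'a sp" is uminus
  by (rule sp_mats_uminus)

lift_definition minus_sp :: "'a sp \<Rightarrow> 'a sp \<Rightarrow> 'a sp" is "(-)"
  by (rule sp_mats_minus)

lift_definition scaleC_sp :: "complex \<Rightarrow> 'a sp \<Rightarrow> 'a sp" is "(\<cdot>\<^sub>m)"
  by (rule sp_mats_smult)

lift_definition lie_bracket_sp :: "'a sp \<Rightarrow> 'a sp \<Rightarrow> 'a sp" is "\<lambda>X Y. X * Y - Y * X"
  by (rule sp_mats_commutator)

instance
proof
  fix X Y Z :: "'a sp" and c d :: complex
  let ?N = "2 * CARD('a)"
  note [dest!] = sp_matsD(1)
  show "X + Y + Z = X + (Y + Z)" by transfer (auto intro!: eq_matI)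
  show "X + Y = Y + X" by transfer (auto intro!: eq_matI)
  show "0 + X = X" by transfer (auto intro!: eq_matI)
  show "- X + X = 0" by transfer (auto intro!: eq_matI)
  show "X - Y = X + - Y" by transfer (auto intro!: eq_matI)
  show "c *\<^sub>C (X + Y) = c *\<^sub>C X + c *\<^sub>C Y"
    by transfer (auto intro!: eq_matI simp: algebra_simps)
  show "(c + d) *\<^sub>C X = c *\<^sub>C X + d *\<^sub>C X"
    by transfer (auto intro!: eq_matI simp: algebra_simps)
  show "c *\<^sub>C d *\<^sub>C X = (c * d) *\<^sub>C X"
    by transfer (auto intro!: eq_matI)
  show "1 *\<^sub>C X = X"
    by transfer (auto intro!: eq_matI)
  show "lie_bracket (X + Y) Z = lie_bracket X Z + lie_bracket Y Z"
    by transfer (auto intro!: eq_matI simp del: index_mult_mat(1)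
        simp: add_mult_distrib_mat[of _ ?N ?N _ _ ?N] mult_add_distrib_mat[of _ ?N ?N _ ?N])
  show "lie_bracket X (Y + Z) = lie_bracket X Y + lie_bracket X Z"
    by transfer (auto intro!: eq_matI simp del: index_mult_mat(1)
        simp: add_mult_distrib_mat[of _ ?N ?N _ _ ?N] mult_add_distrib_mat[of _ ?N ?N _ ?N])
  show "lie_bracket (c *\<^sub>C X) Y = c *\<^sub>C lie_bracket X Y"
    by transfer (auto intro!: eq_matI simp del: index_mult_mat(1)
        simp: mult_smult_assoc_mat[of _ ?N ?N _ ?N] mult_smult_distrib[of _ ?N ?N _ ?N]
          algebra_simps)
  show "lie_bracket X (c *\<^sub>C Y) = c *\<^sub>C lie_bracket X Y"
    by transfer (auto intro!: eq_matI simp del: index_mult_mat(1)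
        simp: mult_smult_assoc_mat[of _ ?N ?N _ ?N] mult_smult_distrib[of _ ?N ?N _ ?N]
          algebra_simps)
  show "lie_bracket X X = 0"
    by transfer (auto intro!: eq_matI simp del: index_mult_mat(1))
  show "lie_bracket X (lie_bracket Y Z) + lie_bracket Y (lie_bracket Z X)
      + lie_bracket Z (lie_bracket X Y) = 0"
    by transfer (auto intro!: eq_matI simp del: index_mult_mat(1)
        simp: minus_mult_distrib_mat[of _ ?N ?N _ _ ?N] mult_minus_distrib_mat[of _ ?N ?N _ ?N]
          assoc_mult_mat[of _ ?N ?N _ ?N _ ?N])
qed

end

definition F_mat :: "nat \<Rightarrow> nat \<Rightarrow> nat \<Rightarrow> complex mat" where
  "F_mat n i j =
    mat_unit n i j - (eps n i * eps n j) \<cdot>\<^sub>m mat_unit n (refl_index n j) (refl_index n i)"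

lemma refl_index_eq_iff:
  assumes "c + d + 1 = 2 * n"
  shows "c + 1 = refl_index n i \<longleftrightarrow> i = d + 1"
  using assms unfolding refl_index_def by auto

lemma J0_index:
  assumes "a < 2 * n" and "b + b' + 1 = 2 * n"
  shows "J0 n $$ (a, b) = (if a = b' then eps n (b + 1) else 0)"
proof -
  have b: "b < 2 * n" using assms(2) by linarith
  have "a + 1 = refl_index n (b + 1) \<longleftrightarrow> a = b'"
    using assms(2) unfolding refl_index_def by auto
  then show ?thesis
    unfolding J0_def index_mat(1)[OF assms(1) b] prod.case by simp
qed

lemma F_mat_index:
  assumes "a < 2 * n" and "b < 2 * n" and "a + a' + 1 = 2 * n" and "b + b' + 1 = 2 * n"
  shows "F_mat n i j $$ (a, b)
    = of_bool (i = a + 1 \<and> j = b + 1) - eps n i * eps n j * of_bool (j = a' + 1 \<and> i = b' + 1)"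
proof -
  have unit: "mat_unit n k l $$ (a, b) = of_bool (a + 1 = k \<and> b + 1 = l)" for k l
    unfolding mat_unit_def index_mat(1)[OF assms(1,2)] prod.case of_bool_def by (rule refl)
  have "F_mat n i j $$ (a, b) = mat_unit n i j $$ (a, b)
      - eps n i * eps n j * mat_unit n (refl_index n j) (refl_index n i) $$ (a, b)"
    unfolding F_mat_def using assms(1,2)
    by (subst index_minus_mat(1)) (simp_all add: mat_unit_def)
  then show ?thesis
    unfolding unit refl_index_eq_iff[OF assms(3)] refl_index_eq_iff[OF assms(4)]
    by (simp add: eq_commute[of i] eq_commute[of j])
qed

lemma eps_refl:
  assumes "c + d + 1 = 2 * n"
  shows "eps n (d + 1) = - eps n (c + 1)"
  unfolding eps_def using assms by simp

lemma F_mat_reflect: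
  assumes a: "a + a' + 1 = 2 * n" and b: "b + b' + 1 = 2 * n"
  shows "F_mat n i j $$ (b', a) * eps n (b + 1) = - (eps n (a' + 1) * F_mat n i j $$ (a', b))"
proof -
  define P where "P \<longleftrightarrow> i = b' + 1 \<and> j = a + 1"
  define Q where "Q \<longleftrightarrow> j = b + 1 \<and> i = a' + 1"
  define x where "x = eps n (b + 1)"
  define y where "y = eps n (a' + 1)"
  have lt: "a < 2 * n" "a' < 2 * n" "b < 2 * n" "b' < 2 * n"
    using a b by linarith+
  have a': "a' + a + 1 = 2 * n" and b': "b' + b + 1 = 2 * n"
    using a b by linarith+
  have F1: "F_mat n i j $$ (b', a) = of_bool P - eps n i * eps n j * of_bool Q"
    unfolding F_mat_index[OF lt(4,1) b' a] P_def Q_def by (rule refl)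
  have F2: "F_mat n i j $$ (a', b) = of_bool Q - eps n i * eps n j * of_bool P"
    unfolding F_mat_index[OF lt(2,3) a' b] P_def Q_def
    by (simp only: conj_commute)
  have x: "x * x = 1" and y: "y * y = 1"
    by (simp_all add: x_def y_def eps_def)
  have 1: "of_bool P * x = y * (eps n i * eps n j * of_bool P)"
  proof (cases P)
    case True
    have "eps n i = - x" "eps n j = - y"
      using True eps_refl[OF b] eps_refl[OF a'] by (simp_all add: P_def x_def y_def)
    then have "y * (eps n i * eps n j) = x * (y * y)" by simp
    then show ?thesis using True y by simp
  qed simp
  have 2: "eps n i * eps n j * of_bool Q * x = y * of_bool Q"
  proof (cases Q)
    case True
    then have "eps n i = y" "eps n j = x" by (simp_all add: Q_def x_def y_def)
    then have "eps n i * eps n j * x = y * (x * x)" by simp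
    then show ?thesis using True x by simp
  qed simp
  show ?thesis
    unfolding F1 F2 x_def[symmetric] y_def[symmetric] left_diff_distrib right_diff_distrib 1 2
    by simp
qed

lemma F_mat_in_sp_mats: "F_mat n i j \<in> sp_mats n"
proof (rule sp_matsI)
  let ?F = "F_mat n i j"
  show F: "?F \<in> carrier_mat (2 * n) (2 * n)"
    unfolding F_mat_def by (intro minus_carrier_mat smult_carrier_mat mat_unit_carrier)
  show "transpose_mat ?F * J0 n = - (J0 n * ?F)"
  proof (rule eq_matI)
    fix a b
    assume "a < dim_row (- (J0 n * ?F))" "b < dim_col (- (J0 n * ?F))"
    then have a: "a < 2 * n" and b: "b < 2 * n"
      using F by auto
    obtain a' where a': "a + a' + 1 = 2 * n"
      using a by (metis Suc_eq_plus1 add_Suc_right less_natE)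
    obtain b' where b': "b + b' + 1 = 2 * n"
      using b by (metis Suc_eq_plus1 add_Suc_right less_natE)
    have "(transpose_mat ?F * J0 n) $$ (a, b) = (\<Sum>m\<in>{0..<2 * n}. ?F $$ (m, a) * J0 n $$ (m, b))"
      using F a b by (simp add: scalar_prod_def)
    also have "\<dots> = (\<Sum>m\<in>{0..<2 * n}. if m = b' then ?F $$ (m, a) * eps n (b + 1) else 0)"
      by (rule sum.cong) (simp_all add: J0_index[OF _ b'])
    also have "\<dots> = ?F $$ (b', a) * eps n (b + 1)"
      using b' by (subst sum.delta) auto
    also have "\<dots> = - (eps n (a' + 1) * ?F $$ (a', b))"
      by (rule F_mat_reflect[OF a' b'])
    also have "eps n (a' + 1) * ?F $$ (a', b)
        = (\<Sum>m\<in>{0..<2 * n}. if m = a' then eps n (m + 1) * ?F $$ (m, b) else 0)"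
      using a' by (subst sum.delta) auto
    also have "\<dots> = (\<Sum>m\<in>{0..<2 * n}. J0 n $$ (a, m) * ?F $$ (m, b))"
    proof (rule sum.cong)
      fix m assume "m \<in> {0..<2 * n}"
      then obtain m' where m': "m + m' + 1 = 2 * n"
        by (metis Suc_eq_plus1 add_Suc_right atLeastLessThan_iff less_natE)
      have "a = m' \<longleftrightarrow> m = a'"
        using a' m' by auto
      then show "(if m = a' then eps n (m + 1) * ?F $$ (m, b) else 0) = J0 n $$ (a, m) * ?F $$ (m, b)"
        unfolding J0_index[OF a m'] by simp
    qed simp
    also have "\<dots> = (J0 n * ?F) $$ (a, b)"
      using F a b by (simp add: scalar_prod_def)
    finally show "(transpose_mat ?F * J0 n) $$ (a, b) = (- (J0 n * ?F)) $$ (a, b)"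
      using F a b by simp
  qed (use F in auto)
qed

lift_definition F_sp :: "nat \<Rightarrow> nat \<Rightarrow> 'n::finite sp" is "F_mat CARD('n)"
  by (rule F_mat_in_sp_mats)

definition F_uea :: "nat \<Rightarrow> nat \<Rightarrow> 'n::finite sp uea" where
  "F_uea i j = uea_of (F_sp i j)"

definition F_tilde :: "nat \<Rightarrow> nat \<Rightarrow> 'n::finite sp uea" where
  "F_tilde i j = F_uea i j - (if i = j \<and> CARD('n) < i then 1 else 0)"


section \<open>Permanents\<close>

definition multi_indices :: "nat \<Rightarrow> nat \<Rightarrow> nat list set" where
  "multi_indices N k = {\<alpha>. length \<alpha> = k \<and> sorted \<alpha> \<and> set \<alpha> \<subseteq> {1..N}}"

lemma finite_multi_indices: "finite (multi_indices N k)"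
  unfolding multi_indices_def
  by (rule finite_subset[OF _ finite_lists_length_eq[of "{1..N}" k]]) auto

definition multi_fact :: "nat list \<Rightarrow> nat" where
  "multi_fact \<alpha> = (\<Prod>i\<in>set \<alpha>. fact (count_list \<alpha> i))"

text \<open>Positions \<open>1, \<dots>, k\<close> are numbered \<open>0, \<dots>, k - 1\<close> below: rows and columns of the
  \<open>k \<times> k\<close> matrices whose column-permanent is taken, entries of a multi-index, and parameters.\<close>

definition column_permanent :: "nat \<Rightarrow> (nat \<Rightarrow> nat \<Rightarrow> 'a::ring_1) \<Rightarrow> 'a" where
  "column_permanent k Z = (\<Sum>\<sigma> | \<sigma> permutes {..<k}. prod_list (map (\<lambda>p. Z (\<sigma> p) p) [0..<k]))"

definition shift_entry ::
  "(nat \<Rightarrow> nat \<Rightarrow> 'a::complex_algebra_1) \<Rightarrow> complex \<Rightarrow> nat \<Rightarrow> nat \<Rightarrow> 'a" where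
  "shift_entry Z a i j = Z i j + (if i = j then a *\<^sub>C 1 else 0)"

definition symmetrized_permanent ::
  "nat \<Rightarrow> (nat \<Rightarrow> nat \<Rightarrow> 'a::complex_algebra_1) \<Rightarrow> complex list \<Rightarrow> 'a" where
  "symmetrized_permanent N Z as = (let k = length as in
    (1 / fact k) *\<^sub>C
      (\<Sum>\<alpha>\<in>multi_indices N k. (1 / of_nat (multi_fact \<alpha>)) *\<^sub>C
        (\<Sum>\<sigma> | \<sigma> permutes {..<k}. \<Sum>\<sigma>' | \<sigma>' permutes {..<k}.
          prod_list (map (\<lambda>p. shift_entry Z (as ! p) (\<alpha> ! \<sigma> p) (\<alpha> ! \<sigma>' p)) [0..<k]))))"

text \<open>With positions counted from \<open>0\<close>, the diagonal matrix with entries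
  \<open>k/2 - 1, k/2 - 2, \<dots>, - k/2\<close> has \<open>k/2 - 1 - q\<close> in position \<open>q\<close>. Right multiplication
  by a diagonal matrix scales columns, so the column position \<open>q\<close> occurs below.\<close>

definition D_column :: "nat \<Rightarrow> complex \<Rightarrow> 'n::finite sp uea" where
  "D_column k u =
    (\<Sum>\<alpha>\<in>multi_indices (2 * CARD('n)) k. (1 / of_nat (multi_fact \<alpha>)) *\<^sub>C
      column_permanent k (\<lambda>p q.
        F_tilde (\<alpha> ! p) (\<alpha> ! q)
          + (if \<alpha> ! p = \<alpha> ! q then u *\<^sub>C 1 else 0)
          - (if \<alpha> ! p = \<alpha> ! q then (of_nat k / 2 - 1 - of_nat q) *\<^sub>C 1 else 0)))"

definition D_symmetrized :: "nat \<Rightarrow> complex \<Rightarrow> 'n::finite sp uea" where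
  "D_symmetrized k u =
    symmetrized_permanent (2 * CARD('n)) (shift_entry F_uea u)
      (map (\<lambda>q. of_nat k / 2 - 1 - of_nat q) [0..<k - 1] @ [0])"

end

(*
Let e_1..e_N and f_1..f_N be variables commuting with everything, pair the monomials e^M and f^N to
M! if M = N and to 0 otherwise, and put eta_j(z) = sum_i e_i (F_ij + (c + z) delta_ij) with
c = u + 1 - k/2. Let A(z) and B(z) be the sums of f_j eta_j(z) over j <= n and over j > n, and let
Xi(z) = A(z) + B(z). Up to the factor 1/k!, D_k(u) is the pairing of

  L = sum_p (k choose p) A(0) ... A(p-1) B(p-1) ... B(k-2),

because eta_i(z) eta_j(z+1) is symmetric in i and j when both lie in the same half, and D'_k(u) is the
pairing of Xi(0) ... Xi(k-2) Xi(k/2-1). The commutators of the F_ij give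
B(z) A(z+1) = A(z) B(z+1) + Y with Y = R Theta, where R = sum_(i <= n) f_i f_i' and
Theta = sum_(i <= n) (e_i' eta_i - e_i eta_i') satisfies X(z) Theta = Theta X(z+2) for X = A, B.
Hence L = W_k - k t W_(k-1), where t = sum_(i > n) e_i f_i and W_k is the Hermite-like sum

  W_k = sum_j (-1)^j (number of j-matchings of k points) Xi(0) ... Xi(k-2j-1) Y^j.

Multiplication by e_i is adjoint to the derivation d/df_i. Applying this to the factors e_i of Theta and of
sum_(i <= n) e_i f_i - sum_(i > n) e_i f_i relates the pairings of the terms for j and j + 1, so that the
sum telescopes to its term for j = 0.
*)
theory Submission
  imports Defs "HOL-Library.Product_Plus" "HOL-Combinatorics.Multiset_Permutations" "HOL-Combinatorics.List_Permutation"
begin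

text \<open>The obstacle is the cross term. D_k multiplies sorted words, so its A-factors stay left
  of its B-factors, while the factors Xi on the symmetrized side commute; moving one past the other
  costs a Y. The correction - k t comes from the n ones in F tilde, which lower the argument of
  every B by one. On the other side the parameter 0 gives Xi(k/2 - 1) = Xi(k - 1) - (k/2)(s + t),
  with s = sum_(i <= n) e_i f_i. So t has to be traded for (s + t)/2 at the expense of the Y-terms.
  The trade is made after pairing, with 2t = (s + t) - (s - t). Multiplication by s + t becomes a
  degree count in the f_i (Euler operator plus 2n). Multiplication by s - t becomes a derivation
  that counts the f-degrees of the two halves with opposite signs. It kills Y, because each term of
  R has one f from each half, and it turns Xi into A - B. Adjointness applied to a factor Theta of
  Y^(j+1) produces the same A - B terms. Eliminating them identifies the (s - t)-part of term j with
  term j + 1.\<close>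

lemma of_nat_left_commute: "x * (of_nat m * y) = of_nat m * (x * (y :: 'a :: semiring_1))"
  by (metis mult.assoc mult_of_nat_commute)

lemma of_int_left_commute: "x * (of_int m * y) = of_int m * (x * (y :: 'a :: ring_1))"
  by (metis mult.assoc mult_of_int_commute)

section \<open>Rising products of shifted elements\<close>

text \<open>Integer shifts are enough: u and k/2 enter through the base element, and the one
  argument k/2 - 1 that may fail to be an integer is reduced to an integer in
  \<open>pairing_symmetric_product\<close>.\<close>

definition shifted :: "'p::ring_1 \<Rightarrow> 'p \<Rightarrow> int \<Rightarrow> 'p" where
  "shifted X c x = X + of_int x * c"

primrec rising :: "(int \<Rightarrow> 'p::ring_1) \<Rightarrow> int \<Rightarrow> nat \<Rightarrow> 'p" where
  "rising X x 0 = 1"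
| "rising X x (Suc m) = X x * rising X (x + 1) m"

lemma rising_Suc_right: "rising X x (Suc m) = rising X x m * X (x + int m)"
proof (induction m arbitrary: x)
  case (Suc m)
  have "rising X x (Suc (Suc m)) = X x * rising X (x + 1) (Suc m)" by simp
  also have "\<dots> = X x * (rising X (x + 1) m * X (x + 1 + int m))" by (simp only: Suc.IH)
  also have "\<dots> = rising X x (Suc m) * X (x + int (Suc m))"
    by (simp add: mult.assoc add_ac)
  finally show ?case .
qed simp

lemma rising_commute:
  assumes "\<And>x. X x * c = c * X x"
  shows "rising X x m * c = c * rising X x m"
  by (induction m arbitrary: x) (simp_all add: assms mult.assoc, metis assms mult.assoc)

lemma rising_twist:
  assumes "\<And>x. X x * G = G * X (x + 2)"
  shows "rising X x m * G = G * rising X (x + 2) m"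
proof (induction m arbitrary: x)
  case (Suc m)
  have "rising X x (Suc m) * G = X x * (G * rising X (x + 1 + 2) m)"
    by (simp add: mult.assoc Suc.IH)
  also have "\<dots> = G * (X (x + 2) * rising X (x + 1 + 2) m)"
    by (metis assms mult.assoc)
  finally show ?case by (simp add: add_ac)
qed simp

text \<open>Each exchange of U with a factor leaves a G and uses up two consecutive arguments.
  Pulling G to the right end lowers all later arguments by 2, which closes this gap, so the m
  correction terms are all equal.\<close>

lemma rising_swap:
  assumes UX: "\<And>x. U x * X (x + 1) = X x * U (x + 1) + G"
    and XG: "\<And>x. X x * G = G * X (x + 2)"
  shows "U x * rising X (x + 1) m = rising X x m * U (x + int m) + of_nat m * (rising X x (m - 1) * G)"
proof (induction m arbitrary: x)
  case (Suc m)
  have "U x * rising X (x + 1) (Suc m) = (X x * U (x + 1) + G) * rising X (x + 1 + 1) m"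
    by (simp add: UX flip: mult.assoc)
  also have "\<dots> = X x * (U (x + 1) * rising X (x + 1 + 1) m) + G * rising X (x + 2) m"
    by (simp add: algebra_simps)
  also have "\<dots> = X x * (rising X (x + 1) m * U (x + 1 + int m) + of_nat m * (rising X (x + 1) (m - 1) * G))
      + rising X x m * G"
    by (simp only: Suc.IH rising_twist[of X G, OF XG])
  also have "\<dots> = rising X x (Suc m) * U (x + int (Suc m)) + (of_nat m * (rising X x m * G) + rising X x m * G)"
  proof -
    have "X x * (of_nat m * (rising X (x + 1) (m - 1) * G)) = of_nat m * (rising X x m * G)"
      by (cases m) (simp_all del: of_nat_Suc add: mult.assoc of_nat_left_commute)
    then show ?thesis by (simp add: algebra_simps)
  qed
  finally show ?case by (simp add: algebra_simps)
qed simp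

section \<open>Central elements and exchange rules for shifted elements\<close>

definition central :: "'p::ring_1 \<Rightarrow> bool" where
  "central c \<longleftrightarrow> (\<forall>z. c * z = z * c)"

lemma centralD: "central c \<Longrightarrow> z * c = c * z"
  by (simp add: central_def)

lemma central_left_commute: "central c \<Longrightarrow> z * (c * w) = c * (z * w)"
  by (metis central_def mult.assoc)

lemma central_mult: "central c \<Longrightarrow> central d \<Longrightarrow> central (c * d)"
  by (metis central_def mult.assoc)

lemma central_add: "central c \<Longrightarrow> central d \<Longrightarrow> central (c + d)"
  by (simp add: central_def algebra_simps)

lemma central_diff: "central c \<Longrightarrow> central d \<Longrightarrow> central (c - d)"
  by (simp add: central_def algebra_simps)

lemma central_sum: "(\<And>i. i \<in> S \<Longrightarrow> central (g i)) \<Longrightarrow> central (sum g S)"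
  by (induction S rule: infinite_finite_induct) (simp_all add: central_add, simp_all add: central_def)

lemma central_power: "central c \<Longrightarrow> central (c ^ m)"
  by (induction m) (simp_all add: central_mult, simp add: central_def)

text \<open>In a product of shifted elements, a commutator of this form is absorbed by shifting the right
  factor by one.\<close>

lemma shifted_swap:
  assumes c: "central c" and d: "central d" and XV: "X * V - V * X = c * V - d * X + G"
  shows "shifted X c z * shifted V d (z + 1) = shifted V d z * shifted X c (z + 1) + G"
proof -
  have XV': "X * V = V * X + c * V - d * X + G"
    using XV by (simp add: algebra_simps)
  note [simp] = centralD[OF c, of X] centralD[OF c, of V] centralD[OF c, of d] centralD[OF d, of X]
    centralD[OF d, of V] of_int_left_commute[of X] of_int_left_commute[of V] of_int_left_commute[of c]
    of_int_left_commute[of d]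
  show ?thesis
    by (simp add: shifted_def distrib_left distrib_right XV' mult.assoc)
qed

lemma shifted_twist:
  assumes c: "central c" and XG: "X * G = G * X + 2 * (c * G)"
  shows "shifted X c z * G = G * shifted X c (z + 2)"
  by (simp add: shifted_def distrib_left distrib_right XG mult.assoc centralD[OF c, of G]
      of_int_left_commute[of G] mult_2 mult_2_right)

lemma shifted_commute:
  assumes cX: "c * X = X * c"
  shows "shifted X c x * shifted X c y = shifted X c y * shifted X c x"
proof -
  have 1: "of_int a * c * X = X * (of_int a * c)" for a
    by (metis cX mult.assoc mult_of_int_commute)
  have 2: "of_int a * c * (of_int b * c) = of_int b * c * (of_int a * c)" for a b
    by (metis mult.assoc mult_of_int_commute)
  show ?thesis
    unfolding shifted_def by (simp add: distrib_left distrib_right 1 2[of x y])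
qed

text \<open>The two products share m commuting factors; the remaining ones, at x + m and x - 1,
  differ by (m + 1) * c. This is the discrete form of the derivative of a power.\<close>

lemma rising_shifted_diff:
  assumes cX: "c * X = X * c"
  shows "rising (shifted X c) x (Suc m) - rising (shifted X c) (x - 1) (Suc m)
    = of_nat (Suc m) * (c * rising (shifted X c) x m)"
proof -
  let ?r = "rising (shifted X c)"
  have rc: "?r y m * shifted X c z = shifted X c z * ?r y m" for y z
    by (rule rising_commute) (rule shifted_commute[OF cX])
  have "?r x (Suc m) - ?r (x - 1) (Suc m) = (shifted X c (x + int m) - shifted X c (x - 1)) * ?r x m"
    by (simp only: rising_Suc_right[of _ x] rc) (simp add: algebra_simps)
  also have "shifted X c (x + int m) - shifted X c (x - 1) = of_nat (Suc m) * c"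
    by (simp add: shifted_def algebra_simps)
  finally show ?thesis by (simp add: mult.assoc)
qed

section \<open>Derivations\<close>

definition derivation :: "('p::ring_1 \<Rightarrow> 'p) \<Rightarrow> bool" where
  "derivation d \<longleftrightarrow> (\<forall>x y. d (x + y) = d x + d y) \<and> (\<forall>x y. d (x * y) = d x * y + x * d y)"

lemma
  assumes "derivation d"
  shows derivation_add: "d (x + y) = d x + d y"
    and derivation_mult: "d (x * y) = d x * y + x * d y"
  using assms by (auto simp: derivation_def)

lemma derivation_zero: "derivation d \<Longrightarrow> d 0 = 0"
  using derivation_add[of d 0 0] by simp

lemma derivation_one: "derivation d \<Longrightarrow> d 1 = 0"
  using derivation_mult[of d 1 1] by simp

lemma derivation_minus: "derivation d \<Longrightarrow> d (- x) = - d x"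
  by (metis derivation_add derivation_zero minus_unique ab_left_minus add.commute)

lemma derivation_diff: "derivation d \<Longrightarrow> d (x - y) = d x - d y"
  by (metis derivation_add derivation_minus diff_conv_add_uminus)

lemma derivation_sum: "derivation d \<Longrightarrow> d (sum g S) = (\<Sum>i\<in>S. d (g i))"
  by (induction S rule: infinite_finite_induct) (simp_all add: derivation_zero derivation_add)

lemma derivation_of_nat: "derivation d \<Longrightarrow> d (of_nat m) = 0"
  by (induction m) (simp_all add: derivation_zero derivation_add derivation_one)

lemma derivation_of_int: "derivation d \<Longrightarrow> d (of_int m) = 0"
  by (cases m) (simp_all add: derivation_of_nat derivation_minus derivation_diff derivation_one)

lemma derivation_power_central:
  assumes d: "derivation d" and central: "\<And>z. r * z = z * r"
  shows "d (r ^ m) = of_nat m * (r ^ (m - 1) * d r)"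
proof (induction m)
  case (Suc m)
  have "d (r ^ Suc m) = d r * r ^ m + r * (of_nat m * (r ^ (m - 1) * d r))"
    by (simp add: derivation_mult[OF d] Suc.IH)
  also have "d r * r ^ m = r ^ m * d r"
    by (metis central power_commuting_commutes)
  also have "r * (of_nat m * (r ^ (m - 1) * d r)) = of_nat m * (r ^ m * d r)"
  proof (cases m)
    case (Suc l)
    then show ?thesis
      by (simp del: of_nat_Suc add: mult.assoc of_nat_left_commute)
  qed simp
  finally show ?case by (simp add: algebra_simps)
qed (simp add: derivation_one[OF d])

lemma derivation_power_zero:
  assumes d: "derivation d" and "d r = 0"
  shows "d (r ^ m) = 0"
  by (induction m) (simp_all add: derivation_one[OF d] derivation_mult[OF d] assms(2))

text \<open>Each of the \<open>m\<close> terms of the Leibniz rule is moved to the front; the commutators add up to the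
  binomial coefficient.\<close>

lemma derivation_rising:
  assumes d: "derivation d" and dX: "\<And>x. d (X x) = U x"
    and UX: "\<And>x. U x * X (x + 1) = X x * U (x + 1) + G"
    and XG: "\<And>x. X x * G = G * X (x + 2)"
  shows "d (rising X x m) = of_nat m * (U x * rising X (x + 1) (m - 1))
    - of_nat (m choose 2) * (rising X x (m - 2) * G)"
proof (induction m arbitrary: x)
  case (Suc m)
  let ?r = "rising X"
  have XU: "X x * U (x + 1) = U x * X (x + 1) - G"
    by (simp add: UX)
  have 1: "X x * (of_nat m * (U (x + 1) * ?r (x + 1 + 1) (m - 1)))
      = of_nat m * (U x * ?r (x + 1) m) - of_nat m * (?r x (m - 1) * G)"
  proof (cases m)
    case (Suc l)
    have "X x * (of_nat m * (U (x + 1) * ?r (x + 1 + 1) l))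
        = of_nat m * ((X x * U (x + 1)) * ?r (x + 1 + 1) l)"
      by (metis mult.assoc mult_of_nat_commute)
    also have "\<dots> = of_nat m * (U x * ?r (x + 1) (Suc l)) - of_nat m * (G * ?r (x + 2) l)"
      unfolding XU by (simp add: algebra_simps)
    finally show ?thesis
      using Suc by (simp add: rising_twist[of X G, OF XG])
  qed simp
  have 2: "X x * (of_nat (m choose 2) * (?r (x + 1) (m - 2) * G)) = of_nat (m choose 2) * (?r x (m - 1) * G)"
  proof (cases "m < 2")
    case False
    then obtain l where "m = Suc (Suc l)" by (metis add_2_eq_Suc le_Suc_ex not_less)
    then show ?thesis
      by (simp add: mult.assoc) (metis mult.assoc mult_of_nat_commute)
  qed (simp add: binomial_eq_0)
  have "d (?r x (Suc m)) = U x * ?r (x + 1) m + X x * d (?r (x + 1) m)"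
    by (simp add: derivation_mult[OF d] dX)
  also have "\<dots> = U x * ?r (x + 1) m + of_nat m * (U x * ?r (x + 1) m)
      - of_nat m * (?r x (m - 1) * G) - of_nat (m choose 2) * (?r x (m - 1) * G)"
    unfolding Suc.IH right_diff_distrib 1 2 by simp
  also have "\<dots> = of_nat (Suc m) * (U x * ?r (x + 1) m) - of_nat (m + (m choose 2)) * (?r x (m - 1) * G)"
    by (simp add: algebra_simps)
  also have "m + (m choose 2) = (Suc m choose 2)"
    by (simp add: numeral_2_eq_2)
  finally show ?case by simp
qed (simp add: derivation_one[OF d] binomial_eq_0)

section \<open>Ordered expansion of rising products of a sum\<close>

lemma binomial_split:
  fixes F :: "nat \<Rightarrow> 'a::semiring_1"
  shows "(\<Sum>p\<le>Suc k. of_nat (Suc k choose p) * F p)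
    = (\<Sum>p\<le>k. of_nat (k choose p) * F (Suc p)) + (\<Sum>p\<le>k. of_nat (k choose p) * F p)"
proof -
  have "(\<Sum>p\<le>Suc k. of_nat (Suc k choose p) * F p)
      = F 0 + (\<Sum>p\<le>k. of_nat (Suc k choose Suc p) * F (Suc p))"
    by (subst sum.atMost_Suc_shift) simp
  also have "\<dots> = (\<Sum>p\<le>k. of_nat (k choose p) * F (Suc p))
      + (F 0 + (\<Sum>p\<le>k. of_nat (k choose Suc p) * F (Suc p)))"
    by (simp add: sum.distrib algebra_simps)
  also have "F 0 + (\<Sum>p\<le>k. of_nat (k choose Suc p) * F (Suc p)) = (\<Sum>p\<le>Suc k. of_nat (k choose p) * F p)"
    by (subst sum.atMost_Suc_shift) simp
  also have "\<dots> = (\<Sum>p\<le>k. of_nat (k choose p) * F p)"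
    by (simp add: binomial_eq_0)
  finally show ?thesis .
qed

text \<open>The value at j is (2j - 1)!!, the number of perfect matchings of 2j points.\<close>

primrec double_fact :: "nat \<Rightarrow> nat" where
  "double_fact 0 = 1"
| "double_fact (Suc j) = (2 * j + 1) * double_fact j"

text \<open>The number of ways to choose \<open>j\<close> disjoint unordered pairs among \<open>k\<close> points.\<close>

definition matchings :: "nat \<Rightarrow> nat \<Rightarrow> nat" where
  "matchings k j = (k choose (2 * j)) * double_fact j"

text \<open>The last of the k + 1 points is either left out or paired with one of the other
  k.\<close>

lemma matchings_rec: "matchings (Suc k) (Suc j) = matchings k (Suc j) + k * matchings (k - 1) j"
proof (cases k)
  case (Suc l)
  have "(2 * j + 1) * (Suc l choose Suc (2 * j)) = Suc l * (l choose (2 * j))"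
    using Suc_times_binomial[of "2 * j" l] by simp
  then have "(Suc l choose Suc (2 * j)) * ((2 * j + 1) * double_fact j)
      = Suc l * (l choose (2 * j)) * double_fact j"
    by (metis mult.assoc mult.commute)
  then show ?thesis
    unfolding Suc matchings_def by (simp add: algebra_simps)
qed (simp add: matchings_def)

text \<open>Both sides count matchings of k points together with a marked unmatched point.\<close>

lemma matchings_absorb: "k * matchings (k - 1) j = (k - 2 * j) * matchings k j"
proof (cases k)
  case (Suc l)
  show ?thesis
    using binomial_absorb_comp[of k "2 * j"] by (simp add: matchings_def)
qed (simp add: matchings_def)

text \<open>Both sides count matchings with j + 1 pairs, one of them marked and oriented: choose its
  first end, then j pairs among the other points, then its second end among the points left
  over.\<close>

lemma matchings_absorb_Suc:
  "k * (k - 1 - 2 * j) * matchings (k - 1) j = 2 * Suc j * matchings k (Suc j)"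
proof (cases k)
  case (Suc l)
  have e: "2 * Suc j = 2 * j + 2" by simp
  have 1: "Suc l * (l choose (2 * j)) = (2 * j + 1) * (Suc l choose Suc (2 * j))"
    using Suc_times_binomial[of "2 * j" l] by simp
  have 2: "(Suc l - Suc (2 * j)) * (Suc l choose Suc (2 * j)) = (2 * j + 2) * (Suc l choose (2 * j + 2))"
    using binomial_absorb_comp[of "Suc l" "Suc (2 * j)"] Suc_times_binomial[of "Suc (2 * j)" l] by simp
  have "Suc l * (l - 2 * j) * ((l choose (2 * j)) * double_fact j)
      = (l - 2 * j) * (Suc l * (l choose (2 * j))) * double_fact j"
    by (simp only: ac_simps)
  also have "\<dots> = (2 * j + 1) * ((Suc l - Suc (2 * j)) * (Suc l choose Suc (2 * j))) * double_fact j"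
    unfolding 1 by (simp add: ac_simps del: One_nat_def)
  also have "\<dots> = 2 * Suc j * ((Suc l choose (2 * Suc j)) * double_fact (Suc j))"
    unfolding 2 e double_fact.simps by (simp only: ac_simps)
  finally show ?thesis
    unfolding Suc matchings_def by simp
qed (simp add: matchings_def)

lemma matchings_eq_0: "k < 2 * j \<Longrightarrow> matchings k j = 0"
  by (simp add: matchings_def binomial_eq_0)

section \<open>Ordered products of two elements with a twisted commutator\<close>

lemma twist_power:
  assumes "\<And>z. f z * G = G * f (z + 2 :: int)"
  shows "f z * G ^ m = G ^ m * (f (z + 2 * int m) :: 'p::ring_1)"
proof (induction m arbitrary: z)
  case (Suc m)
  have "f z * G ^ Suc m = G * (f (z + 2) * G ^ m)"
    by (simp add: assms flip: mult.assoc)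
  then show ?case by (simp add: Suc.IH mult.assoc algebra_simps)
qed simp

text \<open>Y measures the failure of the exchange rule that holds inside one half. By the last two
  assumptions it has weight 2: moving Y to the left past a shifted factor raises the argument of
  that factor by 2.\<close>

locale twisted_pair =
  fixes A B Y s t :: "'p::ring_1"
  assumes s_central: "central s" and t_central: "central t"
    and AB: "A * B - B * A = s * B - t * A - Y"
    and AY: "A * Y = Y * A + 2 * (s * Y)"
    and BY: "B * Y = Y * B + 2 * (t * Y)"
begin

abbreviation "rA \<equiv> rising (shifted A s)"
abbreviation "rB \<equiv> rising (shifted B t)"

definition "Xi = shifted (A + B) (s + t)"
abbreviation "rX \<equiv> rising Xi"

lemma Xi_eq: "Xi x = shifted A s x + shifted B t x"
  by (simp add: Xi_def shifted_def algebra_simps)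

lemma A_Y: "shifted A s x * Y = Y * shifted A s (x + 2)"
  and B_Y: "shifted B t x * Y = Y * shifted B t (x + 2)"
  using s_central t_central AY BY by (simp_all add: shifted_twist)

lemma Xi_Y: "Xi x * Y = Y * Xi (x + 2)"
  by (simp add: Xi_eq A_Y B_Y algebra_simps)

lemma B_A: "shifted B t x * shifted A s (x + 1) = shifted A s x * shifted B t (x + 1) + Y"
  by (rule shifted_swap[OF t_central s_central]) (use AB in \<open>simp add: algebra_simps\<close>)

lemma A_A: "shifted A s x * shifted A s y = shifted A s y * shifted A s x"
  and B_B: "shifted B t x * shifted B t y = shifted B t y * shifted B t x"
  and Xi_Xi: "Xi x * Xi y = Xi y * Xi x"
  unfolding Xi_def by (rule shifted_commute, simp add: centralD[OF s_central] centralD[OF t_central] distrib_left distrib_right)+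

lemma Xi_A: "Xi x * shifted A s (x + 1) = shifted A s x * Xi (x + 1) + Y"
  using B_A[of x] A_A[of "x+1" x] by (simp add: Xi_eq algebra_simps)

text \<open>For Y = 0 this is the binomial expansion of \<open>rX x k\<close>. Here the arguments of
  the B-factors continue those of the A-factors without overlap; the overlapping form that D_k
  requires is obtained in \<open>ordered_sum_diff\<close>.\<close>

definition ordered_sum :: "nat \<Rightarrow> int \<Rightarrow> 'p" where
  "ordered_sum k x = (\<Sum>p\<le>k. of_nat (k choose p) * (rA x p * rB (x + int p) (k - p)))"

text \<open>A recurrence of Hermite type. Moving Xi past p A-factors costs p copies of Y
  (\<open>rising_swap\<close>), and p * (k choose p) = k * (k - 1 choose p - 1) reassembles these
  terms into \<open>ordered_sum (k - 1) x\<close>.\<close>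

lemma ordered_sum_rec:
  "ordered_sum (Suc k) x = Xi x * ordered_sum k (x + 1) - of_nat k * (ordered_sum (k - 1) x * Y)"
proof -
  define F where "F p = rA x p * rB (x + int p) (Suc k - p)" for p
  have 1: "Xi x * (rA (x + 1) p * rB (x + 1 + int p) (k - p))
      = F (Suc p) + F p + of_nat p * (rA x (p - 1) * rB (x + int p - 1) (k - p) * Y)" if "p \<le> k" for p
  proof -
    have e: "Xi x * rA (x + 1) p = rA x p * Xi (x + int p) + of_nat p * (rA x (p - 1) * Y)"
      by (rule rising_swap) (fact Xi_A, fact A_Y)
    have "Xi x * (rA (x + 1) p * rB (x + 1 + int p) (k - p))
        = (rA x p * shifted A s (x + int p)) * rB (x + 1 + int p) (k - p)
          + rA x p * (shifted B t (x + int p) * rB (x + 1 + int p) (k - p))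
          + of_nat p * (rA x (p - 1) * (Y * rB (x + 1 + int p) (k - p)))"
      unfolding mult.assoc[symmetric, of "Xi x"] e Xi_eq[of "x + int p"]
      by (simp add: distrib_left distrib_right mult.assoc)
    also have "rA x p * shifted A s (x + int p) = rA x (Suc p)"
      by (rule rising_Suc_right[symmetric])
    also have "rA x (Suc p) * rB (x + 1 + int p) (k - p) = F (Suc p)"
      by (simp add: F_def add_ac)
    also have "rA x p * (shifted B t (x + int p) * rB (x + 1 + int p) (k - p)) = F p"
      using that by (simp add: F_def Suc_diff_le add_ac)
    \<comment> \<open>The twist by 2 turns the start x + 1 + p into x + (p - 1), the one that
      belongs to index p - 1 in \<open>ordered_sum (k - 1) x\<close>.\<close>
    also have "Y * rB (x + 1 + int p) (k - p) = rB (x + int p - 1) (k - p) * Y"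
    proof -
      have "rB (x + int p - 1) (k - p) * Y = Y * rB (x + int p - 1 + 2) (k - p)"
        by (rule rising_twist) (fact B_Y)
      then show ?thesis by (simp add: algebra_simps)
    qed
    finally show ?thesis by (simp add: mult.assoc)
  qed
  have "Xi x * ordered_sum k (x + 1)
      = (\<Sum>p\<le>k. of_nat (k choose p) * (Xi x * (rA (x + 1) p * rB (x + 1 + int p) (k - p))))"
    by (simp add: ordered_sum_def sum_distrib_left of_nat_left_commute)
  also have "\<dots> = (\<Sum>p\<le>k. of_nat (k choose p) * F (Suc p)) + (\<Sum>p\<le>k. of_nat (k choose p) * F p)
      + (\<Sum>p\<le>k. of_nat (p * (k choose p)) * (rA x (p - 1) * rB (x + int p - 1) (k - p) * Y))"
    unfolding sum.distrib[symmetric]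
    by (rule sum.cong)
      (simp_all only: atMost_iff 1 distrib_left mult.commute[of _ "k choose _"] of_nat_mult mult.assoc)
  also have "(\<Sum>p\<le>k. of_nat (k choose p) * F (Suc p)) + (\<Sum>p\<le>k. of_nat (k choose p) * F p)
      = ordered_sum (Suc k) x"
    by (subst binomial_split[symmetric]) (simp only: ordered_sum_def F_def)
  also have "(\<Sum>p\<le>k. of_nat (p * (k choose p)) * (rA x (p - 1) * rB (x + int p - 1) (k - p) * Y))
      = of_nat k * (ordered_sum (k - 1) x * Y)"
  proof (cases k)
    case (Suc l)
    have e: "x + int (Suc i) - 1 = x + int i" for i by simp
    show ?thesis
      unfolding Suc
      by (subst sum.atMost_Suc_shift)
        (simp only: binomial_absorption, simp add: e ordered_sum_def sum_distrib_left sum_distrib_right mult.assoc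
          del: of_nat_Suc mult_Suc)
  qed simp
  finally show ?thesis by simp
qed

text \<open>Both sides satisfy the recurrence \<open>ordered_sum_rec\<close>; for the coefficients
  it is \<open>matchings_rec\<close>. Where the subtraction k - 2 * j is truncated, the coefficient
  is 0.\<close>

lemma ordered_sum_expand:
  "ordered_sum k x = (\<Sum>j\<le>k. (- 1) ^ j * (of_nat (matchings k j) * (rX x (k - 2 * j) * Y ^ j)))"
proof (induction k arbitrary: x rule: less_induct)
  case (less k)
  show ?case
  proof (cases k)
    case 0
    then show ?thesis by (simp add: ordered_sum_def matchings_def)
  next
    case (Suc l)
    define G where "G j = rX x (Suc l - 2 * j) * Y ^ j" for j
    have "Xi x * ordered_sum l (x + 1)
        = (\<Sum>j\<le>l. (- 1) ^ j * (of_nat (matchings l j) * G j))"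
    proof -
      have "Xi x * ((- 1) ^ j * (of_nat (matchings l j) * (rX (x + 1) (l - 2 * j) * Y ^ j)))
          = (- 1) ^ j * (of_nat (matchings l j) * G j)" for j
      proof (cases "l < 2 * j")
        case False
        have "Xi x * ((- 1) ^ j * z) = (- 1) ^ j * (Xi x * z)" for z
          by (cases "even j") auto
        then show ?thesis
          using False by (simp add: G_def of_nat_left_commute Suc_diff_le mult.assoc)
      qed (simp add: matchings_eq_0)
      then show ?thesis
        using Suc by (simp add: less.IH sum_distrib_left)
    qed
    also have "\<dots> = (\<Sum>j\<le>Suc l. (- 1) ^ j * (of_nat (matchings l j) * G j))"
      by (simp add: matchings_eq_0)
    also have "\<dots> = G 0 - (\<Sum>j\<le>l. (- 1) ^ j * (of_nat (matchings l (Suc j)) * G (Suc j)))"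
      by (subst sum.atMost_Suc_shift) (simp add: matchings_def sum_negf)
    finally have 1: "Xi x * ordered_sum l (x + 1)
        = G 0 - (\<Sum>j\<le>l. (- 1) ^ j * (of_nat (matchings l (Suc j)) * G (Suc j)))" .
    have 2: "of_nat l * (ordered_sum (l - 1) x * Y)
        = (\<Sum>j\<le>l. (- 1) ^ j * (of_nat (l * matchings (l - 1) j) * G (Suc j)))"
    proof (cases l)
      case (Suc m)
      have "of_nat l * ((- 1) ^ j * (of_nat (matchings m j) * (rX x (m - 2 * j) * Y ^ j)) * Y)
          = (- 1) ^ j * (of_nat (l * matchings (l - 1) j) * G (Suc j))" for j
        using Suc
        by (cases "even j") (simp_all add: G_def mult.assoc power_commutes del: of_nat_Suc mult_Suc)
      moreover have "matchings m (Suc m) = 0"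
        by (rule matchings_eq_0) simp
      ultimately show ?thesis
        using Suc \<open>k = Suc l\<close> by (simp add: less.IH sum_distrib_left sum_distrib_right)
    qed simp
    have "ordered_sum k x = G 0 - (\<Sum>j\<le>l. (- 1) ^ j * (of_nat (matchings (Suc l) (Suc j)) * G (Suc j)))"
      unfolding Suc ordered_sum_rec 1 2 matchings_rec by (simp add: sum.distrib algebra_simps)
    also have "\<dots> = (\<Sum>j\<le>Suc l. (- 1) ^ j * (of_nat (matchings (Suc l) j) * G j))"
      by (subst sum.atMost_Suc_shift) (simp add: matchings_def sum_negf)
    finally show ?thesis by (simp add: G_def Suc)
  qed
qed

end

section \<open>The pairing and the commutation relations\<close>

text \<open>The size \<open>2 * n\<close> index set is split into a half \<open>I\<close> and its mirror image: \<open>x i\<close>, \<open>p i\<close>, \<open>a i\<close> play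
  the role of \<open>e\<^sub>i\<close>, \<open>f\<^sub>i\<close>, \<open>\<eta>\<^sub>i\<close>, and \<open>y i\<close>, \<open>q i\<close>, \<open>b i\<close> that of their counterparts with index
  \<open>i'\<close>; \<open>dp\<close>, \<open>dq\<close> are the derivations with respect to \<open>p\<close>, \<open>q\<close>, and \<open>bra\<close> is the pairing.\<close>

locale symplectic_calculus =
  fixes I :: "'i set" and x y p q a b :: "'i \<Rightarrow> 'p::ring_1" and dp dq :: "'i \<Rightarrow> 'p \<Rightarrow> 'p"
    and bra :: "'p \<Rightarrow> 'u::complex_algebra_1"
  assumes finite_I: "finite I"
    and central_x: "central (x i)" and central_y: "central (y i)"
    and central_p: "central (p i)" and central_q: "central (q i)"
    and aa: "i \<in> I \<Longrightarrow> j \<in> I \<Longrightarrow> a i * a j - a j * a i = x i * a j - x j * a i"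
    and bb: "i \<in> I \<Longrightarrow> j \<in> I \<Longrightarrow> b i * b j - b j * b i = y i * b j - y j * b i"
    and ab: "i \<in> I \<Longrightarrow> j \<in> I \<Longrightarrow> a i * b j - b j * a i = x i * b j - y j * a i
      - (if i = j then \<Sum>l\<in>I. y l * a l - x l * b l else 0)"
    and derivation_dp: "derivation (dp i)" and derivation_dq: "derivation (dq i)"
    and dp: "i \<in> I \<Longrightarrow> j \<in> I \<Longrightarrow> dp i (p j) = (if j = i then 1 else 0)" "i \<in> I \<Longrightarrow> j \<in> I \<Longrightarrow> dp i (q j) = 0"
      "i \<in> I \<Longrightarrow> j \<in> I \<Longrightarrow> dp i (x j) = 0" "i \<in> I \<Longrightarrow> j \<in> I \<Longrightarrow> dp i (y j) = 0"
      "i \<in> I \<Longrightarrow> j \<in> I \<Longrightarrow> dp i (a j) = 0" "i \<in> I \<Longrightarrow> j \<in> I \<Longrightarrow> dp i (b j) = 0"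
    and dq: "i \<in> I \<Longrightarrow> j \<in> I \<Longrightarrow> dq i (q j) = (if j = i then 1 else 0)" "i \<in> I \<Longrightarrow> j \<in> I \<Longrightarrow> dq i (p j) = 0"
      "i \<in> I \<Longrightarrow> j \<in> I \<Longrightarrow> dq i (x j) = 0" "i \<in> I \<Longrightarrow> j \<in> I \<Longrightarrow> dq i (y j) = 0"
      "i \<in> I \<Longrightarrow> j \<in> I \<Longrightarrow> dq i (a j) = 0" "i \<in> I \<Longrightarrow> j \<in> I \<Longrightarrow> dq i (b j) = 0"
    and bra_add: "bra (z + w) = bra z + bra w"
    and bra_x: "i \<in> I \<Longrightarrow> bra (x i * z) = bra (dp i z)"
    and bra_y: "i \<in> I \<Longrightarrow> bra (y i * z) = bra (dq i z)"
begin

text \<open>\<open>Theta\<close> is the sum in the Kronecker term of assumption \<open>ab\<close>,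
  the only coupling of an index with its mirror image; \<open>s\<close> and \<open>t\<close> are the
  two halves of the sum of all e_i f_i.\<close>

definition "Theta = (\<Sum>i\<in>I. y i * a i - x i * b i)"
definition "A = (\<Sum>i\<in>I. p i * a i)"
definition "B = (\<Sum>i\<in>I. q i * b i)"
definition "s = (\<Sum>i\<in>I. x i * p i)"
definition "t = (\<Sum>i\<in>I. y i * q i)"
definition "R = (\<Sum>i\<in>I. p i * q i)"

lemma central_s: "central s" and central_t: "central t" and central_R: "central R"
  unfolding s_def t_def R_def
  by (intro central_sum central_mult central_x central_y central_p central_q)+

lemmas x_left = central_left_commute[OF central_x]
lemmas y_left = central_left_commute[OF central_y]
lemmas p_left = central_left_commute[OF central_p]
lemmas q_left = central_left_commute[OF central_q]

text \<open>The coefficient 2 has two sources: the bilinear parts of \<open>aa\<close> and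
  \<open>ab\<close> contribute one x j * Theta after cancellation, and the Kronecker term of
  \<open>ab\<close> contributes the other.\<close>

lemma a_Theta: assumes j: "j \<in> I" shows "a j * Theta = Theta * a j + 2 * (x j * Theta)"
proof -
  have "Theta * a j - a j * Theta
      = (\<Sum>i\<in>I. y i * (a i * a j - a j * a i) + x i * (a j * b i - b i * a j))"
    by (simp add: Theta_def sum_distrib_left sum_distrib_right algebra_simps sum_subtractf sum.distrib
        y_left[of "a j"] x_left[of "a j"])
  also have "\<dots> = (\<Sum>i\<in>I. y i * (x i * a j - x j * a i)
      + x i * (x j * b i - y i * a j - (if j = i then Theta else 0)))"
    using j by (intro sum.cong) (simp_all add: aa ab flip: Theta_def)
  also have "\<dots> = (\<Sum>i\<in>I. - (x j * (y i * a i - x i * b i)) - (if j = i then x i * Theta else 0))"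
    by (intro sum.cong) (simp_all add: algebra_simps y_left[of "x _"] x_left[of "x _"])
  also have "\<dots> = - (x j * Theta) - x j * Theta"
    using j finite_I by (simp add: sum_subtractf sum_negf flip: sum_distrib_left) (simp add: Theta_def sum_subtractf)
  finally show ?thesis by (simp add: algebra_simps mult_2)
qed

lemma b_Theta: assumes j: "j \<in> I" shows "b j * Theta = Theta * b j + 2 * (y j * Theta)"
proof -
  have "Theta * b j - b j * Theta
      = (\<Sum>i\<in>I. y i * (a i * b j - b j * a i) - x i * (b i * b j - b j * b i))"
    by (simp add: Theta_def sum_distrib_left sum_distrib_right algebra_simps sum_subtractf sum.distrib
        y_left[of "b j"] x_left[of "b j"])
  also have "\<dots> = (\<Sum>i\<in>I. y i * (x i * b j - y j * a i - (if i = j then Theta else 0))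
      - x i * (y i * b j - y j * b i))"
    using j by (intro sum.cong) (simp_all add: bb ab flip: Theta_def)
  also have "\<dots> = (\<Sum>i\<in>I. - (y j * (y i * a i - x i * b i)) - (if i = j then y i * Theta else 0))"
    by (intro sum.cong) (simp_all add: algebra_simps y_left[of "x _"] y_left[of "y _"])
  also have "\<dots> = - (y j * Theta) - y j * Theta"
    using j finite_I by (simp add: sum_subtractf sum_negf flip: sum_distrib_left) (simp add: Theta_def sum_subtractf)
  finally show ?thesis by (simp add: algebra_simps mult_2)
qed

lemma A_a: assumes j: "j \<in> I" shows "A * a j - a j * A = s * a j - x j * A"
proof -
  have "A * a j - a j * A = (\<Sum>i\<in>I. p i * (a i * a j - a j * a i))"
    by (simp add: A_def sum_distrib_left sum_distrib_right algebra_simps sum_subtractf p_left[of "a j"])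
  also have "\<dots> = (\<Sum>i\<in>I. x i * p i * a j - x j * (p i * a i))"
    using j by (intro sum.cong) (simp_all add: aa algebra_simps p_left[of "x _"])
  finally show ?thesis
    by (simp add: A_def s_def sum_distrib_left sum_distrib_right sum_subtractf)
qed

lemma B_b: assumes j: "j \<in> I" shows "B * b j - b j * B = t * b j - y j * B"
proof -
  have "B * b j - b j * B = (\<Sum>i\<in>I. q i * (b i * b j - b j * b i))"
    by (simp add: B_def sum_distrib_left sum_distrib_right algebra_simps sum_subtractf q_left[of "b j"])
  also have "\<dots> = (\<Sum>i\<in>I. y i * q i * b j - y j * (q i * b i))"
    using j by (intro sum.cong) (simp_all add: bb algebra_simps q_left[of "y _"])
  finally show ?thesis
    by (simp add: B_def t_def sum_distrib_left sum_distrib_right sum_subtractf)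
qed

lemma A_b: assumes j: "j \<in> I" shows "A * b j - b j * A = s * b j - y j * A - p j * Theta"
proof -
  have "A * b j - b j * A = (\<Sum>i\<in>I. p i * (a i * b j - b j * a i))"
    by (simp add: A_def sum_distrib_left sum_distrib_right algebra_simps sum_subtractf p_left[of "b j"])
  also have "\<dots> = (\<Sum>i\<in>I. x i * p i * b j - y j * (p i * a i) - (if i = j then p i * Theta else 0))"
    using j by (intro sum.cong) (simp_all add: ab algebra_simps p_left[of "x _"] p_left[of "y _"] flip: Theta_def)
  finally show ?thesis
    using j finite_I by (simp add: A_def s_def sum_distrib_left sum_distrib_right sum_subtractf)
qed

lemma B_a: assumes j: "j \<in> I" shows "B * a j - a j * B = t * a j - x j * B + q j * Theta"
proof -
  have "B * a j - a j * B = (\<Sum>i\<in>I. - (q i * (a j * b i - b i * a j)))"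
    by (simp add: B_def sum_distrib_left sum_distrib_right algebra_simps sum_subtractf q_left[of "a j"])
  also have "\<dots> = (\<Sum>i\<in>I. y i * q i * a j - x j * (q i * b i) + (if j = i then q i * Theta else 0))"
    using j by (intro sum.cong) (simp_all add: ab algebra_simps q_left[of "x _"] q_left[of "y _"] flip: Theta_def)
  finally show ?thesis
    using j finite_I by (simp add: B_def t_def sum_distrib_left sum_distrib_right sum_subtractf sum.distrib)
qed

lemma A_Theta: "A * Theta = Theta * A + 2 * (s * Theta)"
  by (simp add: A_def s_def sum_distrib_left sum_distrib_right a_Theta algebra_simps sum.distrib
      p_left[of Theta] p_left[of "x _"] mult_2)

lemma B_Theta: "B * Theta = Theta * B + 2 * (t * Theta)"
  by (simp add: B_def t_def sum_distrib_left sum_distrib_right b_Theta algebra_simps sum.distrib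
      q_left[of Theta] q_left[of "y _"] mult_2)

text \<open>Each commutator of A with b j leaves p j * Theta from the Kronecker term of
  \<open>ab\<close>. Weighted by q j and summed, these give R * Theta in the role of Y.\<close>

sublocale twisted_pair A B "R * Theta" s t
proof
  show "A * B - B * A = s * B - t * A - R * Theta"
  proof -
    have "A * B - B * A = (\<Sum>j\<in>I. q j * (A * b j - b j * A))"
      by (simp add: B_def sum_distrib_left sum_distrib_right algebra_simps sum_subtractf q_left[of A])
    also have "\<dots> = (\<Sum>j\<in>I. s * (q j * b j) - y j * q j * A - p j * q j * Theta)"
      by (intro sum.cong) (simp_all add: A_b algebra_simps q_left[of s] q_left[of "y _"] q_left[of "p _"])
    finally show ?thesis
      by (simp add: B_def t_def R_def sum_distrib_left sum_distrib_right sum_subtractf)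
  qed
  show "A * (R * Theta) = R * Theta * A + 2 * (s * (R * Theta))"
    by (simp add: central_left_commute[OF central_R, of A] A_Theta central_left_commute[OF central_R, of s]
        distrib_left mult_2 mult.assoc)
  show "B * (R * Theta) = R * Theta * B + 2 * (t * (R * Theta))"
    by (simp add: central_left_commute[OF central_R, of B] B_Theta central_left_commute[OF central_R, of t]
        distrib_left mult_2 mult.assoc)
qed (fact central_s central_t)+

section \<open>Derivatives of rising products\<close>

definition "a_at j z = shifted (a j) (x j) z"
definition "b_at j z = shifted (b j) (y j) z"

lemma central_st: "central (s + t)"
  by (intro central_add central_s central_t)

text \<open>\<open>a_at j\<close> is the derivative of \<open>Xi\<close> by p j (see
  \<open>dp_Xi\<close>), and this exchange rule is what \<open>derivation_rising\<close> asks for.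
  The sign is opposite to that in \<open>b_at_Xi\<close> because Theta changes sign when the two
  halves are exchanged.\<close>

lemma a_at_Xi: assumes "j \<in> I" shows "a_at j z * Xi (z + 1) = Xi z * a_at j (z + 1) + - (q j * Theta)"
proof -
  have "Xi z * a_at j (z + 1) = a_at j z * Xi (z + 1) + q j * Theta"
    unfolding a_at_def Xi_def using A_a[OF assms] B_a[OF assms]
    by (intro shifted_swap central_st central_x) (simp add: algebra_simps)
  then show ?thesis by simp
qed

lemma b_at_Xi: assumes "j \<in> I" shows "b_at j z * Xi (z + 1) = Xi z * b_at j (z + 1) + p j * Theta"
proof -
  have "Xi z * b_at j (z + 1) = b_at j z * Xi (z + 1) + - (p j * Theta)"
  proof -
    have "(A + B) * b j - b j * (A + B) = (A * b j - b j * A) + (B * b j - b j * B)"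
      by (simp add: algebra_simps)
    also have "\<dots> = (s + t) * b j - y j * (A + B) + - (p j * Theta)"
      unfolding A_b[OF assms] B_b[OF assms] by (simp add: algebra_simps)
    finally show ?thesis
      unfolding b_at_def Xi_def by (intro shifted_swap central_st central_y)
  qed
  then show ?thesis by simp
qed

lemma Xi_Theta: "Xi z * Theta = Theta * Xi (z + 2)"
  unfolding Xi_def by (rule shifted_twist[OF central_st]) (simp add: algebra_simps A_Theta B_Theta)

lemma Xi_c_Theta: "central c \<Longrightarrow> Xi z * (c * Theta) = c * Theta * Xi (z + 2)"
  by (simp add: central_left_commute[of c "Xi z"] Xi_Theta mult.assoc)

lemma Xi_alt: "Xi z = (\<Sum>l\<in>I. p l * a_at l z + q l * b_at l z)"
  unfolding Xi_def shifted_def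
  by (simp add: shifted_def a_at_def b_at_def A_def B_def s_def t_def sum_distrib_left algebra_simps
      sum.distrib p_left[of "x _"] q_left[of "y _"] of_int_left_commute[of "p _"] of_int_left_commute[of "q _"]
      centralD[OF central_x, of "p _"] centralD[OF central_y, of "q _"])

lemma dp_Xi: assumes "j \<in> I" shows "dp j (Xi z) = a_at j z"
  using assms finite_I unfolding Xi_alt
  by (simp add: a_at_def b_at_def shifted_def derivation_sum[OF derivation_dp] derivation_add[OF derivation_dp]
      derivation_mult[OF derivation_dp] derivation_of_int[OF derivation_dp] dp sum.distrib
      if_distrib[of "\<lambda>u. u * _"] cong: if_cong)

lemma dq_Xi: assumes "j \<in> I" shows "dq j (Xi z) = b_at j z"
  using assms finite_I unfolding Xi_alt
  by (simp add: a_at_def b_at_def shifted_def derivation_sum[OF derivation_dq] derivation_add[OF derivation_dq]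
      derivation_mult[OF derivation_dq] derivation_of_int[OF derivation_dq] dq sum.distrib
      if_distrib[of "\<lambda>u. u * _"] cong: if_cong)

lemma dp_rX: assumes "j \<in> I"
  shows "dp j (rX z m) = of_nat m * (a_at j z * rX (z + 1) (m - 1))
    + of_nat (m choose 2) * (rX z (m - 2) * (q j * Theta))"
proof -
  have "dp j (rX z m) = of_nat m * (a_at j z * rX (z + 1) (m - 1))
    - of_nat (m choose 2) * (rX z (m - 2) * - (q j * Theta))"
    using assms
    by (intro derivation_rising derivation_dp dp_Xi a_at_Xi) (simp_all add: Xi_c_Theta central_q)
  then show ?thesis by simp
qed

lemma dq_rX: assumes "j \<in> I"
  shows "dq j (rX z m) = of_nat m * (b_at j z * rX (z + 1) (m - 1))
    - of_nat (m choose 2) * (rX z (m - 2) * (p j * Theta))"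
  using assms
  by (intro derivation_rising derivation_dq dq_Xi b_at_Xi) (simp_all add: Xi_c_Theta central_p)

lemma dp_Theta: "j \<in> I \<Longrightarrow> dp j Theta = 0" and dq_Theta: "j \<in> I \<Longrightarrow> dq j Theta = 0"
  by (simp_all add: Theta_def derivation_sum derivation_diff derivation_mult derivation_dp derivation_dq dp dq)

lemma dp_R: "j \<in> I \<Longrightarrow> dp j R = q j" and dq_R: "j \<in> I \<Longrightarrow> dq j R = p j"
  using finite_I
  by (simp_all add: R_def derivation_sum derivation_mult derivation_dp derivation_dq dp dq
      if_distrib[of "\<lambda>u. u * _"] if_distrib[of "\<lambda>u. _ * u"] cong: if_cong)

lemma a_at_b_at: "j \<in> I \<Longrightarrow> a_at j z * b_at j (z + 1) = b_at j z * a_at j (z + 1) + - Theta"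
  unfolding a_at_def b_at_def
  by (intro shifted_swap central_x central_y) (simp add: ab Theta_def)

text \<open>The shifts contribute y l * x l - x l * y l = 0. Theta can therefore be written with
  factors at any common argument, a freedom that \<open>bra_Y\<close> exploits.\<close>

lemma Theta_alt: "Theta = (\<Sum>l\<in>I. y l * a_at l z - x l * b_at l z)"
  by (simp add: Theta_def a_at_def b_at_def shifted_def distrib_left of_int_left_commute[of "x _"]
      of_int_left_commute[of "y _"] centralD[OF central_x, of "y _"])

lemma a_at_Theta: "j \<in> I \<Longrightarrow> a_at j z * Theta = Theta * a_at j (z + 2)"
  and b_at_Theta: "j \<in> I \<Longrightarrow> b_at j z * Theta = Theta * b_at j (z + 2)"
  unfolding a_at_def b_at_def
  by (simp_all add: shifted_twist central_x central_y a_Theta b_Theta)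

lemma Y_power: "(R * Theta) ^ m = R ^ m * Theta ^ m"
proof (induction m)
  case (Suc m)
  have "(R * Theta) ^ Suc m = R * (Theta * (R ^ m * Theta ^ m))"
    by (simp add: Suc.IH mult.assoc)
  then show ?case
    by (simp add: central_left_commute[OF central_power[OF central_R], of Theta] mult.assoc)
qed simp

end

section \<open>Adjoint relations under the pairing and the telescoping sum\<close>

lemma of_nat_mult_eq_scaleC: "of_nat m * z = of_nat m *\<^sub>C (z :: 'a :: complex_algebra_1)"
proof (induction m)
  case 0
  show ?case
    using scaleC_add_left[of 0 0 z] by simp
next
  case (Suc m)
  then show ?case
    by (simp add: distrib_right scaleC_add_left scaleC_one)
qed

text \<open>Complex scalars act, so there is no torsion. This permits doubled identities in place of
  halves.\<close>

lemma of_nat_mult_cancel: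
  fixes z w :: "'a :: complex_algebra_1"
  assumes "of_nat m * z = of_nat m * w" and "m \<noteq> 0"
  shows "z = w"
proof -
  have "(1 / of_nat m) *\<^sub>C of_nat m *\<^sub>C z = (1 / of_nat m) *\<^sub>C of_nat m *\<^sub>C w"
    using assms(1) by (simp add: of_nat_mult_eq_scaleC)
  then show ?thesis
    using assms(2) by (simp add: scaleC_scaleC scaleC_one)
qed

lemma two_times_choose_two: "2 * (m choose 2) = m * (m - 1)"
proof -
  have "even (m * (m - 1))" by (cases m) auto
  then show ?thesis by (simp add: choose_two)
qed

lemma alternating_telescope:
  fixes v :: "nat \<Rightarrow> 'a :: ring_1"
  shows "(\<Sum>j\<le>k. (- 1) ^ j * (v j + v (Suc j))) = v 0 + (- 1) ^ k * v (Suc k)"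
  by (induction k) (simp_all add: algebra_simps)

context symplectic_calculus
begin

text \<open>The image of \<open>Xi z\<close> under the derivation \<open>H\<close> below, which
  weights the two halves with opposite signs.\<close>

definition "D z = shifted A s z - shifted B t z"

lemma D_alt: "D z = (\<Sum>l\<in>I. p l * a_at l z - q l * b_at l z)"
  by (simp add: D_def shifted_def a_at_def b_at_def A_def B_def s_def t_def sum_distrib_left algebra_simps
      sum.distrib sum_subtractf p_left[of "x _"] q_left[of "y _"] of_int_left_commute[of "p _"]
      of_int_left_commute[of "q _"] centralD[OF central_x, of "p _"] centralD[OF central_y, of "q _"])

lemma D_Xi: "D z * Xi (z + 1) = Xi z * D (z + 1) + - (2 * (R * Theta))"
proof -
  have "Xi z * D (z + 1) = D z * Xi (z + 1) + 2 * (R * Theta)"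
    using B_A[of z] A_A[of "z + 1" z] B_B[of "z + 1" z]
    by (simp add: D_def Xi_eq algebra_simps mult_2)
  then show ?thesis by simp
qed

lemma bra_zero: "bra 0 = 0"
  using bra_add[of 0 0] by simp

lemma bra_minus: "bra (- z) = - bra z"
  by (metis bra_add bra_zero minus_unique add.right_inverse)

lemma bra_diff: "bra (z - w) = bra z - bra w"
  by (metis bra_add bra_minus diff_conv_add_uminus)

lemma bra_sum: "bra (sum g S) = (\<Sum>i\<in>S. bra (g i))"
  by (induction S rule: infinite_finite_induct) (simp_all add: bra_zero bra_add)

lemma bra_of_nat: "bra (of_nat m * z) = of_nat m * bra z"
  by (induction m) (simp_all add: bra_zero bra_add distrib_right)

text \<open>One Theta of Y^(j+1) is written through the x l and y l, which become derivatives under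
  \<open>bra\<close>. Falling on R^(j+1) they yield the factor j + 1 and, summed over l, the element
  D; falling on the rising product they yield S, which again contains a Theta.\<close>

lemma bra_Y:
  "bra ((R * Theta) ^ Suc j * rX z m) = of_nat (Suc j) * bra ((R * Theta) ^ j * (D (z - 1) * rX z m))
    - of_nat (m * card I + (m choose 2)) * bra ((R * Theta) ^ Suc j * rX (z + 1) (m - 1))"
proof -
  \<comment> \<open>With this argument the factors \<open>a_at l c\<close> and
    \<open>b_at l c\<close> arrive at z - 1 after passing Theta^j, just before the start z of the
    rising product.\<close>
  define c where "c = z - 1 - 2 * int j"
  define Z where "Z = R ^ Suc j * (Theta ^ j * rX z m)"
  define W where "W = R ^ j * Theta ^ j"
  have cR: "v * (R ^ k * w) = R ^ k * (v * w)" for v w k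
    by (rule central_left_commute[OF central_power[OF central_R]])
  have a: "a_at l c * (Theta ^ j * w) = Theta ^ j * (a_at l (z - 1) * w)"
    and b: "b_at l c * (Theta ^ j * w) = Theta ^ j * (b_at l (z - 1) * w)" if "l \<in> I" for l w
    using twist_power[of "a_at l" Theta c j, OF a_at_Theta[OF that]]
      twist_power[of "b_at l" Theta c j, OF b_at_Theta[OF that]]
    by (simp_all add: c_def flip: mult.assoc)
  have dqZ: "dq l Z = of_nat (Suc j) * (p l * (W * rX z m)) + R ^ Suc j * (Theta ^ j * dq l (rX z m))"
    if "l \<in> I" for l
    by (simp add: Z_def W_def derivation_mult[OF derivation_dq] derivation_power_zero[OF derivation_dq dq_Theta[OF that]]
        derivation_power_central[OF derivation_dq centralD[OF central_R, symmetric]] dq_R[OF that]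
        p_left[of "R ^ _"] mult.assoc del: power_Suc of_nat_Suc)
  have dpZ: "dp l Z = of_nat (Suc j) * (q l * (W * rX z m)) + R ^ Suc j * (Theta ^ j * dp l (rX z m))"
    if "l \<in> I" for l
    by (simp add: Z_def W_def derivation_mult[OF derivation_dp] derivation_power_zero[OF derivation_dp dp_Theta[OF that]]
        derivation_power_central[OF derivation_dp centralD[OF central_R, symmetric]] dp_R[OF that]
        q_left[of "R ^ _"] mult.assoc del: power_Suc of_nat_Suc)
  have aZ: "a_at l c * dq l Z = of_nat (Suc j) * (W * (p l * a_at l (z - 1) * rX z m))
      + R ^ Suc j * (Theta ^ j * (a_at l (z - 1) * dq l (rX z m)))" if "l \<in> I" for l
    by (simp add: dqZ[OF that] W_def distrib_left cR a[OF that] mult.assoc p_left[of "a_at _ _"]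
        p_left[of "Theta ^ _"] of_nat_left_commute[of "a_at _ _"] del: power_Suc of_nat_Suc)
  have bZ: "b_at l c * dp l Z = of_nat (Suc j) * (W * (q l * b_at l (z - 1) * rX z m))
      + R ^ Suc j * (Theta ^ j * (b_at l (z - 1) * dp l (rX z m)))" if "l \<in> I" for l
    by (simp add: dpZ[OF that] W_def distrib_left cR b[OF that] mult.assoc q_left[of "b_at _ _"]
        q_left[of "Theta ^ _"] of_nat_left_commute[of "b_at _ _"] del: power_Suc of_nat_Suc)
  \<comment> \<open>The factors contain no p or q, so the derivatives that replace x l and y l fall
    on Z alone.\<close>
  have da: "dq l (a_at l c) = 0" and db: "dp l (b_at l c) = 0" if "l \<in> I" for l
    using that by (simp_all add: a_at_def b_at_def shifted_def derivation_add derivation_mult derivation_of_int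
        derivation_dp derivation_dq dp dq)
  define S where "S = (\<Sum>l\<in>I. a_at l (z - 1) * dq l (rX z m) - b_at l (z - 1) * dp l (rX z m))"
  \<comment> \<open>The terms with m contain the exchange defect - Theta once for every l. Those
    with m choose 2 add up to Xi (z - 1), which extends the rising product to the left.\<close>
  have S: "S = - (of_nat (m * card I + (m choose 2)) * (Theta * rX (z + 1) (m - 1)))"
  proof -
    have ab1: "a_at l (z - 1) * b_at l z = b_at l (z - 1) * a_at l z + - Theta" if "l \<in> I" for l
      using a_at_b_at[OF that, of "z - 1"] by simp
    have "S = (\<Sum>l\<in>I. of_nat m * ((a_at l (z - 1) * b_at l z - b_at l (z - 1) * a_at l z) * rX (z + 1) (m - 1))
        - of_nat (m choose 2) * ((p l * a_at l (z - 1) + q l * b_at l (z - 1)) * (rX z (m - 2) * Theta)))"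
      unfolding S_def
      by (rule sum.cong) (simp_all add: dq_rX dp_rX algebra_simps of_nat_left_commute[of "a_at _ _"]
          of_nat_left_commute[of "b_at _ _"] p_left[of "rising _ _ _"] q_left[of "rising _ _ _"]
          p_left[of "a_at _ _"] q_left[of "b_at _ _"])
    also have "\<dots> = (\<Sum>l\<in>I. of_nat m * - (Theta * rX (z + 1) (m - 1)))
        - of_nat (m choose 2) * (Xi (z - 1) * (rX z (m - 2) * Theta))"
      by (simp add: sum_subtractf ab1 Xi_alt sum_distrib_left sum_distrib_right)
    also have "of_nat (m choose 2) * (Xi (z - 1) * (rX z (m - 2) * Theta))
        = of_nat (m choose 2) * (Theta * rX (z + 1) (m - 1))"
    proof (cases "m < 2")
      case False
      then obtain k where "m = Suc (Suc k)" by (metis add_2_eq_Suc le_Suc_ex not_less)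
      moreover have "rX (z - 1) (Suc k) * Theta = Theta * rX (z - 1 + 2) (Suc k)"
        by (rule rising_twist) (rule Xi_Theta)
      ultimately show ?thesis by (simp add: mult.assoc add_ac)
    qed (simp add: binomial_eq_0)
    finally show ?thesis
      by (simp add: distrib_right sum_negf mult.assoc mult.commute[of m])
  qed
  have "(R * Theta) ^ Suc j * rX z m = Theta * Z"
    by (simp add: Y_power Z_def cR[of Theta] mult.assoc del: power_Suc)
      (simp add: mult.assoc)
  also have "\<dots> = (\<Sum>l\<in>I. y l * (a_at l c * Z) - x l * (b_at l c * Z))"
    by (subst Theta_alt[of c]) (simp add: sum_distrib_right left_diff_distrib mult.assoc)
  finally have "bra ((R * Theta) ^ Suc j * rX z m)
      = bra (\<Sum>l\<in>I. a_at l c * dq l Z - b_at l c * dp l Z)"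
    by (simp add: bra_sum bra_diff bra_x bra_y derivation_mult derivation_dp derivation_dq da db)
  also have "(\<Sum>l\<in>I. a_at l c * dq l Z - b_at l c * dp l Z)
      = of_nat (Suc j) * (W * (D (z - 1) * rX z m)) + R ^ Suc j * (Theta ^ j * S)"
    by (simp add: aZ bZ D_alt S_def sum_subtractf sum.distrib sum_distrib_left sum_distrib_right algebra_simps
        del: power_Suc of_nat_Suc)
  also have "R ^ Suc j * (Theta ^ j * S) = - (of_nat (m * card I + (m choose 2))
      * ((R * Theta) ^ Suc j * rX (z + 1) (m - 1)))"
    by (simp add: S Y_power of_nat_left_commute[of "Theta ^ j"] of_nat_left_commute[of "R ^ Suc j"]
        mult.assoc power_Suc2[of Theta] del: power_Suc of_nat_Suc of_nat_add of_nat_mult)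
  finally show ?thesis
    by (simp add: bra_add bra_minus bra_diff bra_of_nat W_def Y_power del: power_Suc of_nat_Suc of_nat_add of_nat_mult)
qed

lemma bra_x_p: "i \<in> I \<Longrightarrow> bra (x i * (p i * w)) = bra w + bra (p i * dp i w)"
  by (simp add: bra_x derivation_mult[OF derivation_dp] dp bra_add)

lemma bra_y_q: "i \<in> I \<Longrightarrow> bra (y i * (q i * w)) = bra w + bra (q i * dq i w)"
  by (simp add: bra_y derivation_mult[OF derivation_dq] dq bra_add)

text \<open>Number operators in the f-variables: \<open>H\<close> is the degree in the p's minus the
  degree in the q's, and \<open>Eu\<close> is the Euler operator for the total degree.\<close>

definition "H w = (\<Sum>l\<in>I. p l * dp l w - q l * dq l w)"
definition "Eu w = (\<Sum>l\<in>I. p l * dp l w + q l * dq l w)"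

lemma derivation_H: "derivation H" and derivation_Eu: "derivation Eu"
  unfolding derivation_def H_def Eu_def
  by (auto simp: derivation_add derivation_mult derivation_dp derivation_dq sum_distrib_left sum_distrib_right
      algebra_simps central_left_commute[OF central_p] central_left_commute[OF central_q]
      simp flip: sum.distrib intro!: sum.cong)

text \<open>Under the pairing x l * p l acts as 1 + p l * dp l, and y l * q l likewise. The ones of
  the two halves cancel here; in \<open>bra_s_plus_t\<close> they add up to 2 * card I.\<close>

lemma bra_s_minus_t: "bra ((s - t) * w) = bra (H w)"
proof -
  have "bra ((s - t) * w) = (\<Sum>l\<in>I. bra (x l * (p l * w)) - bra (y l * (q l * w)))"
    by (simp add: s_def t_def left_diff_distrib sum_distrib_right mult.assoc bra_diff bra_sum sum_subtractf)
  then show ?thesis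
    by (simp add: bra_x_p bra_y_q H_def bra_sum bra_diff)
qed

lemma bra_s_plus_t: "bra ((s + t) * w) = of_nat (2 * card I) * bra w + bra (Eu w)"
proof -
  have "bra ((s + t) * w) = (\<Sum>l\<in>I. bra (x l * (p l * w)) + bra (y l * (q l * w)))"
    by (simp add: s_def t_def distrib_right sum_distrib_right mult.assoc bra_add bra_sum sum.distrib)
  then show ?thesis
    by (simp add: bra_x_p bra_y_q Eu_def bra_sum bra_add sum.distrib algebra_simps mult_2)
qed

text \<open>Each term of R has one p and one q, whose weights cancel, and Theta has neither.\<close>

lemma H_Y: "H (R * Theta) = 0"
  by (simp add: derivation_mult[OF derivation_H])
    (simp add: H_def dp_Theta dq_Theta dp_R dq_R centralD[OF central_p, of "q _"])

lemma Eu_Y: "Eu (R * Theta) = 2 * (R * Theta)"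
proof -
  have "Eu R = (\<Sum>l\<in>I. p l * q l + p l * q l)"
    by (simp add: Eu_def dp_R dq_R centralD[OF central_p, of "q _"])
  then have "Eu R = 2 * R"
    by (simp add: R_def sum.distrib mult_2)
  moreover have "Eu Theta = 0"
    by (simp add: Eu_def dp_Theta dq_Theta)
  ultimately show ?thesis
    by (simp add: derivation_mult[OF derivation_Eu] mult.assoc)
qed

lemma H_Xi: "H (Xi z) = D z" and Eu_Xi: "Eu (Xi z) = Xi z"
  by (simp_all add: H_def Eu_def D_alt dp_Xi dq_Xi) (simp add: Xi_alt)

lemma Eu_Y_power: "Eu ((R * Theta) ^ j) = of_nat (2 * j) * (R * Theta) ^ j"
proof (induction j)
  case (Suc j)
  define Y where "Y = R * Theta"
  have Eu_Y': "Eu Y = 2 * Y"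
    by (simp add: Y_def Eu_Y)
  have "Eu (Y ^ Suc j) = 2 * (Y * Y ^ j) + of_nat (2 * j) * (Y * Y ^ j)"
    using Suc.IH
    by (simp add: derivation_mult[OF derivation_Eu] Eu_Y' mult.assoc of_nat_left_commute[of Y]
        flip: Y_def del: of_nat_mult)
  then show ?case
    unfolding Y_def[symmetric] by (simp add: distrib_right mult.assoc mult_2)
qed (simp add: derivation_one[OF derivation_Eu])

lemma Eu_rX: "Eu (rX z m) = of_nat m * rX z m"
proof (induction m arbitrary: z)
  case (Suc m)
  then show ?case
    by (simp add: derivation_mult[OF derivation_Eu] Eu_Xi of_nat_left_commute[of "Xi z"] algebra_simps)
qed (simp add: derivation_one[OF derivation_Eu])

text \<open>The product is homogeneous of degree 2 * j + m in the p's and q's, so the Euler operator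
  acts on it as a scalar.\<close>

lemma bra_tau:
  "bra ((s + t) * ((R * Theta) ^ j * rX z m)) = of_nat (2 * card I + 2 * j + m) * bra ((R * Theta) ^ j * rX z m)"
proof -
  have "Eu ((R * Theta) ^ j * rX z m) = of_nat (2 * j + m) * ((R * Theta) ^ j * rX z m)"
    by (simp add: derivation_mult[OF derivation_Eu] Eu_Y_power Eu_rX of_nat_left_commute[of "_ ^ _"]
        distrib_right mult.assoc del: of_nat_mult)
  then show ?thesis
    unfolding bra_s_plus_t by (simp add: bra_add bra_of_nat distrib_right add.assoc del: of_nat_mult)
qed

lemma H_rX: "H (rX z m) = of_nat m * (D z * rX (z + 1) (m - 1))
    + of_nat (m * (m - 1)) * (R * Theta * rX (z + 2) (m - 2))"
proof -
  have "H (rX z m) = of_nat m * (D z * rX (z + 1) (m - 1))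
      - of_nat (m choose 2) * (rX z (m - 2) * - (2 * (R * Theta)))"
  proof (rule derivation_rising[OF derivation_H H_Xi])
    fix z
    show "D z * Xi (z + 1) = Xi z * D (z + 1) + - (2 * (R * Theta))"
      by (rule D_Xi)
    have "Xi z * - (R * Theta + R * Theta) = - (R * Theta + R * Theta) * Xi (z + 2)"
      by (simp only: mult_minus_right mult_minus_left distrib_left distrib_right Xi_Y)
    then show "Xi z * - (2 * (R * Theta)) = - (2 * (R * Theta)) * Xi (z + 2)"
      by (simp only: mult_2)
  qed
  moreover have "rX z (m - 2) * (R * Theta) = R * Theta * rX (z + 2) (m - 2)"
    by (rule rising_twist) (rule Xi_Y)
  then have "rX z (m - 2) * - (2 * (R * Theta)) = - (2 * (R * Theta * rX (z + 2) (m - 2)))"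
    by (simp only: mult_2 distrib_left mult_minus_right)
  moreover have "of_nat (m choose 2) * - (2 * (R * Theta * rX (z + 2) (m - 2)))
      = - (of_nat (2 * (m choose 2)) * (R * Theta * rX (z + 2) (m - 2)))"
    by (simp only: mult_minus_right mult.commute[of 2 "m choose 2"] of_nat_mult of_nat_numeral mult.assoc)
  ultimately show ?thesis
    by (simp only: diff_minus_eq_add two_times_choose_two)
qed

lemma bra_delta:
  "bra ((s - t) * ((R * Theta) ^ j * rX z m)) = of_nat m * bra ((R * Theta) ^ j * (D z * rX (z + 1) (m - 1)))
    + of_nat (m * (m - 1)) * bra ((R * Theta) ^ Suc j * rX (z + 2) (m - 2))"
proof -
  have "H ((R * Theta) ^ j * rX z m) = of_nat m * ((R * Theta) ^ j * (D z * rX (z + 1) (m - 1)))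
      + of_nat (m * (m - 1)) * ((R * Theta) ^ Suc j * rX (z + 2) (m - 2))"
    by (simp add: derivation_mult[OF derivation_H] derivation_power_zero[OF derivation_H H_Y] H_rX distrib_left
        of_nat_left_commute[of "_ ^ _"] power_Suc2 del: of_nat_mult power_Suc)
      (simp add: mult.assoc del: of_nat_mult)
  then show ?thesis
    by (simp add: bra_s_minus_t bra_add bra_of_nat del: of_nat_mult power_Suc)
qed

text \<open>\<open>bra_delta\<close> and \<open>bra_Y\<close>, the latter at z + 1, contain the same
  term with D z. After its elimination the remaining multiples of the shorter product are expressed
  through s + t by \<open>bra_tau\<close>.\<close>

lemma bra_delta_Suc:
  "of_nat (2 * Suc j) * bra ((s - t) * ((R * Theta) ^ j * rX z (Suc m)))
    = of_nat (Suc m) * (2 * bra ((R * Theta) ^ Suc j * rX (z + 2) m)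
      - of_nat m * bra ((s + t) * ((R * Theta) ^ Suc j * rX (z + 2) (m - 1))))"
proof (cases m)
  case 0
  have "bra ((R * Theta) ^ Suc j) = of_nat (Suc j) * bra ((R * Theta) ^ j * D z)"
    using bra_Y[of j "z + 1" 0] by (simp add: binomial_eq_0 del: power_Suc of_nat_Suc)
  moreover have "bra ((s - t) * ((R * Theta) ^ j * Xi z)) = bra ((R * Theta) ^ j * D z)"
    using bra_delta[of j z 1] by simp
  ultimately have "of_nat (2 * Suc j) * bra ((s - t) * ((R * Theta) ^ j * Xi z)) = 2 * bra ((R * Theta) ^ Suc j)"
    by (simp only: of_nat_mult of_nat_numeral mult.assoc)
  moreover have "of_nat (Suc 0) = (1 :: 'u)"
    by simp
  ultimately show ?thesis
    unfolding 0 by (simp only: rising.simps mult_1_left mult_1_right of_nat_0 mult_zero_left diff_zero)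
next
  case (Suc l)
  define P where "P = bra ((R * Theta) ^ j * (D z * rX (z + 1) m))"
  define Q where "Q = bra ((R * Theta) ^ Suc j * rX (z + 2) m)"
  define S where "S = bra ((R * Theta) ^ Suc j * rX (z + 2) l)"
  define T where "T = bra ((s + t) * ((R * Theta) ^ Suc j * rX (z + 2) l))"
  have 1: "bra ((s - t) * ((R * Theta) ^ j * rX z (Suc m))) = of_nat (Suc m) * P + of_nat (Suc m * m) * S"
    using bra_delta[of j z "Suc m"] by (simp add: P_def S_def Suc)
  \<comment> \<open>\<open>bra_Y\<close> gives a product that starts at z + 1, whereas the claim has
    the start z + 2; the discrepancy is a multiple of s + t.\<close>
  have diff: "rX (z + 2) (Suc l) - rX (z + 1) (Suc l) = of_nat (Suc l) * ((s + t) * rX (z + 2) l)"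
    using rising_shifted_diff[OF centralD[OF central_st, symmetric], of "A + B" "z + 2" l]
    by (simp add: Xi_def[abs_def] algebra_simps)
  have "(R * Theta) ^ Suc j * rX (z + 2) m - (R * Theta) ^ Suc j * rX (z + 1) m
      = of_nat m * ((s + t) * ((R * Theta) ^ Suc j * rX (z + 2) l))"
    unfolding Suc right_diff_distrib[symmetric] diff
    by (simp only: of_nat_left_commute[of "(R * Theta) ^ Suc j"] central_left_commute[OF central_st, of "(R * Theta) ^ Suc j"])
  then have 2: "bra ((R * Theta) ^ Suc j * rX (z + 1) m) = Q - of_nat m * T"
  proof -
    assume e: "(R * Theta) ^ Suc j * rX (z + 2) m - (R * Theta) ^ Suc j * rX (z + 1) m
      = of_nat m * ((s + t) * ((R * Theta) ^ Suc j * rX (z + 2) l))"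
    have "Q - bra ((R * Theta) ^ Suc j * rX (z + 1) m) = of_nat m * T"
      using arg_cong[OF e, of bra] by (simp only: bra_diff bra_of_nat Q_def T_def)
    then show ?thesis by (simp only: algebra_simps)
  qed
  have 3: "Q - of_nat m * T = of_nat (Suc j) * P - of_nat (m * card I + (m choose 2)) * S"
    using bra_Y[of j "z + 1" m] unfolding 2 by (simp add: P_def S_def Suc add_ac del: power_Suc of_nat_Suc binomial_Suc_Suc)
  have T: "T = of_nat (2 * card I + 2 * Suc j + l) * S"
    unfolding T_def S_def by (rule bra_tau)
  \<comment> \<open>Here the constants of \<open>bra_Y\<close>, \<open>bra_delta\<close> and
    \<open>bra_tau\<close> fit together: doubling m choose 2 gives m * l, and m can be factored out
    to leave the scalar by which s + t acts.\<close>
  have 4: "of_nat (2 * (m * card I + (m choose 2)) + 2 * Suc j * m) * S = of_nat m * T"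
  proof -
    have "2 * (m choose 2) = m * l"
      using Suc by (simp add: two_times_choose_two)
    then have "2 * (m * card I + (m choose 2)) + 2 * Suc j * m = m * (2 * card I + 2 * Suc j + l)"
      by (simp add: algebra_simps)
    then show ?thesis
      unfolding T by (simp only: of_nat_mult mult.assoc)
  qed
  have "of_nat (2 * Suc j) * (P + of_nat m * S) = 2 * Q - of_nat m * T"
  proof -
    have "of_nat (2 * Suc j) * (P + of_nat m * S)
        = 2 * (of_nat (Suc j) * P) + of_nat (2 * Suc j * m) * S"
      by (simp only: distrib_left of_nat_mult of_nat_numeral mult.assoc)
    also have "of_nat (Suc j) * P = Q - of_nat m * T + of_nat (m * card I + (m choose 2)) * S"
      using 3 by simp
    also have "2 * \<dots> + of_nat (2 * Suc j * m) * S
        = 2 * (Q - of_nat m * T) + of_nat (2 * (m * card I + (m choose 2)) + 2 * Suc j * m) * S"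
      by (simp only: of_nat_add of_nat_mult[of 2] of_nat_numeral distrib_left distrib_right mult.assoc add.assoc)
    finally show ?thesis
      unfolding 4 by (simp add: algebra_simps mult_2)
  qed
  then have "of_nat (Suc m) * (of_nat (2 * Suc j) * (P + of_nat m * S)) = of_nat (Suc m) * (2 * Q - of_nat m * T)"
    by simp
  moreover have "of_nat (Suc m) * (of_nat (2 * Suc j) * (P + of_nat m * S))
      = of_nat (2 * Suc j) * (of_nat (Suc m) * P + of_nat (Suc m * m) * S)"
    by (simp only: of_nat_left_commute[of "of_nat (2 * Suc j)" "Suc m"] distrib_left of_nat_mult[of "Suc m" m] mult.assoc)
  moreover have "l = m - 1"
    using Suc by simp
  ultimately show ?thesis
    unfolding 1 Q_def T_def by (simp only:)
qed


lemma bra_sign: "bra ((- 1) ^ j * w) = (- 1) ^ j * bra w"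
  by (cases "even j") (simp_all add: bra_minus)

lemma ordered_sum_expand':
  "ordered_sum k z = (\<Sum>j\<le>k. (- 1) ^ j * (of_nat (matchings k j)
    * ((R * Theta) ^ j * rX (z + 2 * int j) (k - 2 * j))))"
  unfolding ordered_sum_expand
  using twist_power[of "\<lambda>z. rX z m" "R * Theta" z j for m j, OF rising_twist[of Xi, OF Xi_Y]]
  by simp

text \<open>The range up to k is that of \<open>ordered_sum k\<close>, so that the sums can be added
  termwise; terms beyond k - 1 vanish.\<close>

lemma bra_central_ordered_sum:
  assumes "central c"
  shows "bra (c * ordered_sum (k - 1) z) = (\<Sum>j\<le>k. (- 1) ^ j * (of_nat (matchings (k - 1) j)
    * bra (c * ((R * Theta) ^ j * rX (z + 2 * int j) (k - 1 - 2 * j)))))"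
proof -
  have "ordered_sum (k - 1) z = (\<Sum>j\<le>k. (- 1) ^ j * (of_nat (matchings (k - 1) j)
      * ((R * Theta) ^ j * rX (z + 2 * int j) (k - 1 - 2 * j))))"
    unfolding ordered_sum_expand'
    by (rule sum.mono_neutral_left) (auto simp: matchings_eq_0)
  moreover have "c * ((- 1) ^ j * w) = (- 1) ^ j * (c * w)" for j w
    by (cases "even j") simp_all
  ultimately show ?thesis
    by (simp add: sum_distrib_left bra_sum bra_sign bra_of_nat of_nat_left_commute[of c])
qed

text \<open>By 2 * t = (s + t) - (s - t) the correction splits in two: its parts with s + t join the
  terms of \<open>ordered_sum k\<close> with the same j and form v j, while its parts with s - t
  form v (j + 1).\<close>

theorem bra_ordered_sum:
  "2 * bra (ordered_sum k z - of_nat k * (t * ordered_sum (k - 1) z))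
    = 2 * bra (rX z k) - of_nat k * bra ((s + t) * rX z (k - 1))"
proof -
  define g where "g j = bra ((R * Theta) ^ j * rX (z + 2 * int j) (k - 2 * j))" for j
  define h where "h j = bra ((s + t) * ((R * Theta) ^ j * rX (z + 2 * int j) (k - 1 - 2 * j)))" for j
  define d where "d j = bra ((s - t) * ((R * Theta) ^ j * rX (z + 2 * int j) (k - 1 - 2 * j)))" for j
  define v where "v j = of_nat (matchings k j) * (2 * g j - of_nat (k - 2 * j) * h j)" for j
  have d: "of_nat (k * matchings (k - 1) j) * d j = v (Suc j)" for j
  proof (cases "2 * Suc j \<le> k")
    case True
    define m where "m = k - 2 * Suc j"
    have km: "k - 1 - 2 * j = Suc m" "k - 2 * Suc j = m" "k - 1 - 2 * Suc j = m - 1"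
      using True by (auto simp: m_def)
    have e: "of_nat (2 * Suc j) * d j = of_nat (Suc m) * (2 * g (Suc j) - of_nat m * h (Suc j))"
      unfolding d_def g_def h_def km using bra_delta_Suc[of j "z + 2 * int j" m]
      by (simp add: algebra_simps del: power_Suc)
    have "of_nat (k * matchings (k - 1) j) * (of_nat (2 * Suc j) * d j)
        = of_nat (k * matchings (k - 1) j * Suc m) * (2 * g (Suc j) - of_nat m * h (Suc j))"
      unfolding e of_nat_mult[of "k * matchings (k - 1) j" "Suc m"] by (simp only: mult.assoc)
    also have "k * matchings (k - 1) j * Suc m = 2 * Suc j * matchings k (Suc j)"
      using matchings_absorb_Suc[of k j] unfolding km by (simp only: ac_simps)
    finally have e': "of_nat (k * matchings (k - 1) j) * (of_nat (2 * Suc j) * d j)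
        = of_nat (2 * Suc j * matchings k (Suc j)) * (2 * g (Suc j) - of_nat m * h (Suc j))" .
    have "of_nat (2 * Suc j) * (of_nat (k * matchings (k - 1) j) * d j) = of_nat (2 * Suc j) * v (Suc j)"
      using e' unfolding v_def km of_nat_left_commute[of "of_nat (k * matchings (k - 1) j)" "2 * Suc j"]
        of_nat_mult[of "2 * Suc j" "matchings k (Suc j)"] by (simp only: mult.assoc)
    then show ?thesis
      by (rule of_nat_mult_cancel) simp
  next
    case False
    have "of_nat (matchings (k - 1) j) * d j = 0"
    proof (cases "k - 1 < 2 * j")
      case False
      \<comment> \<open>Only Y^j remains in this case, and s - t annihilates it under the
        pairing.\<close>
      then have "k - 1 - 2 * j = 0"
        using \<open>\<not> 2 * Suc j \<le> k\<close> by simp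
      then show ?thesis
        unfolding d_def bra_delta by simp
    qed (simp add: matchings_eq_0)
    moreover have "matchings k (Suc j) = 0"
      using False by (simp add: matchings_eq_0)
    ultimately show ?thesis
      by (simp add: v_def mult.assoc)
  qed
  have h: "of_nat (k * matchings (k - 1) j) * h j = of_nat (matchings k j) * (of_nat (k - 2 * j) * h j)" for j
    unfolding matchings_absorb by (simp only: mult.commute[of "k - 2 * j"] of_nat_mult mult.assoc)
  have "2 * bra (of_nat k * (t * ordered_sum (k - 1) z))
      = of_nat k * (bra ((s + t) * ordered_sum (k - 1) z) - bra ((s - t) * ordered_sum (k - 1) z))"
    by (simp add: bra_of_nat bra_add bra_diff distrib_right left_diff_distrib mult_2 distrib_left)
  also have "\<dots> = (\<Sum>j\<le>k. (- 1) ^ j * (of_nat (k * matchings (k - 1) j) * h j - of_nat (k * matchings (k - 1) j) * d j))"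
    unfolding bra_central_ordered_sum[OF central_st] bra_central_ordered_sum[OF central_diff[OF central_s central_t]]
      h_def[symmetric] d_def[symmetric]
    by (simp add: sum_distrib_left right_diff_distrib sum_subtractf mult.assoc of_nat_left_commute[of "(- 1) ^ _"])
  finally have 1: "2 * bra (of_nat k * (t * ordered_sum (k - 1) z))
      = (\<Sum>j\<le>k. (- 1) ^ j * (of_nat (k * matchings (k - 1) j) * h j - v (Suc j)))"
    by (simp only: d)
  have 2: "2 * bra (ordered_sum k z) = (\<Sum>j\<le>k. (- 1) ^ j * (of_nat (matchings k j) * (2 * g j)))"
  proof -
    have "2 * ((- 1) ^ j * (of_nat c * w)) = (- 1) ^ j * (of_nat c * (2 * w))" for j c and w :: 'u
      by (simp only: mult_2 distrib_left)
    then show ?thesis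
      by (simp only: ordered_sum_expand' bra_sum bra_sign bra_of_nat g_def sum_distrib_left)
  qed
  have "2 * bra (ordered_sum k z - of_nat k * (t * ordered_sum (k - 1) z)) = (\<Sum>j\<le>k. (- 1) ^ j * (v j + v (Suc j)))"
    unfolding bra_diff right_diff_distrib[of 2] 1 2 h
    by (simp add: v_def right_diff_distrib distrib_left sum_subtractf sum.distrib)
  \<comment> \<open>The other boundary term v (Suc k) vanishes, since k points do not contain k + 1
    disjoint pairs.\<close>
  also have "\<dots> = v 0"
    unfolding alternating_telescope by (simp add: v_def matchings_eq_0)
  finally show ?thesis
    by (simp add: v_def g_def h_def matchings_def)
qed

end

section \<open>Polynomials in two families of central variables\<close>

lemma poly_mapping_eq_sum_single:
  "(\<Sum>k\<in>Poly_Mapping.keys p. Poly_Mapping.single k (Poly_Mapping.lookup p k)) = p"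
proof (rule poly_mapping_eqI)
  fix k
  have "Poly_Mapping.lookup (\<Sum>l\<in>Poly_Mapping.keys p. Poly_Mapping.single l (Poly_Mapping.lookup p l)) k
      = (\<Sum>l\<in>Poly_Mapping.keys p. if l = k then Poly_Mapping.lookup p l else 0)"
    by (simp add: lookup_sum lookup_single when_def)
  then show "Poly_Mapping.lookup (\<Sum>l\<in>Poly_Mapping.keys p. Poly_Mapping.single l (Poly_Mapping.lookup p l)) k
      = Poly_Mapping.lookup p k"
    by (simp add: in_keys_iff)
qed

lemma additive_sum:
  assumes "\<And>x y. f (x + y) = f x + (f y :: 'b :: ab_group_add)"
  shows "f (sum g S) = (\<Sum>i\<in>S. f (g i :: 'a :: ab_group_add))"
proof -
  have "f 0 = 0"
    using assms[of 0 0] by simp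
  then show ?thesis
    by (induction S rule: infinite_finite_induct) (simp_all add: assms)
qed

lemma additive_eqI:
  fixes f g :: "('k \<Rightarrow>\<^sub>0 'a :: ab_group_add) \<Rightarrow> 'b :: ab_group_add"
  assumes "\<And>x y. f (x + y) = f x + f y" "\<And>x y. g (x + y) = g x + g y"
    and "\<And>k z. f (Poly_Mapping.single k z) = g (Poly_Mapping.single k z)"
  shows "f p = g p"
  by (subst (1 2) poly_mapping_eq_sum_single[of p, symmetric]) (simp add: additive_sum[of f] additive_sum[of g] assms)

definition linear_extension ::
  "('k \<Rightarrow> 'a :: ab_group_add \<Rightarrow> 'b :: ab_group_add) \<Rightarrow> ('k \<Rightarrow>\<^sub>0 'a) \<Rightarrow> 'b" where
  "linear_extension f p = (\<Sum>k\<in>Poly_Mapping.keys p. f k (Poly_Mapping.lookup p k))"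

lemma
  assumes add: "\<And>k y z. f k (y + z) = f k y + f k z"
  shows linear_extension_add: "linear_extension f (p + q) = linear_extension f p + linear_extension f q"
    and linear_extension_single: "linear_extension f (Poly_Mapping.single k z) = f k z"
proof -
  have zero: "f k 0 = 0" for k
    using add[of k 0 0] by simp
  have superset: "linear_extension f r = (\<Sum>k\<in>S. f k (Poly_Mapping.lookup r k))"
    if "finite S" "Poly_Mapping.keys r \<subseteq> S" for r S
    unfolding linear_extension_def using that by (intro sum.mono_neutral_left) (auto simp: in_keys_iff zero)
  let ?S = "Poly_Mapping.keys p \<union> Poly_Mapping.keys q"
  show "linear_extension f (p + q) = linear_extension f p + linear_extension f q"
    using Poly_Mapping.keys_add[of p q]
    by (simp add: superset[of ?S] lookup_add add sum.distrib)
  show "linear_extension f (Poly_Mapping.single k z) = f k z"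
    by (simp add: superset[of "{k}"])
qed

text \<open>The exponent \<open>(M, N)\<close> stands for the monomial \<open>e\<^sup>M f\<^sup>N\<close>.\<close>

type_synonym 'u ef_poly = "(nat multiset \<times> nat multiset) \<Rightarrow>\<^sub>0 'u"

definition var_e :: "nat \<Rightarrow> 'u::ring_1 ef_poly" where
  "var_e i = Poly_Mapping.single ({#i#}, {#}) 1"

definition var_f :: "nat \<Rightarrow> 'u::ring_1 ef_poly" where
  "var_f i = Poly_Mapping.single ({#}, {#i#}) 1"

definition const :: "'u::ring_1 \<Rightarrow> 'u ef_poly" where
  "const z = Poly_Mapping.single ({#}, {#}) z"

lemma const_eq: "const z = Poly_Mapping.single 0 z"
  by (simp add: const_def zero_prod_def)

lemma const_simps:
  "const (z + w) = const z + const w" "const (z - w) = const z - const w" "const (- z) = - const z"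
  "const (z * w) = const z * const w" "const 0 = 0" "const 1 = 1"
  by (simp_all add: const_eq single_add single_diff single_uminus mult_single)

lemma central_single: "central (Poly_Mapping.single k 1 :: 'u::ring_1 ef_poly)"
  unfolding central_def
proof
  fix z :: "'u ef_poly"
  show "Poly_Mapping.single k 1 * z = z * Poly_Mapping.single k 1"
    by (rule additive_eqI[of "\<lambda>z. Poly_Mapping.single k 1 * z" "\<lambda>z. z * Poly_Mapping.single k 1"])
      (simp_all add: algebra_simps mult_single)
qed

lemma central_var_e: "central (var_e i)" and central_var_f: "central (var_f i)"
  unfolding var_e_def var_f_def by (rule central_single)+

section \<open>The pairing and the derivatives by the f-variables\<close>

definition multiset_fact :: "'a multiset \<Rightarrow> nat" where
  "multiset_fact M = (\<Prod>i\<in>set_mset M. fact (count M i))"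

lemma multiset_fact_add_mset: "multiset_fact (add_mset i M) = Suc (count M i) * multiset_fact M"
proof -
  have sup: "multiset_fact N = (\<Prod>i\<in>S. fact (count N i))" if "finite S" "set_mset N \<subseteq> S" for N :: "'a multiset" and S
    unfolding multiset_fact_def using that by (intro prod.mono_neutral_left) (auto simp: not_in_iff)
  let ?S = "insert i (set_mset M)"
  have "multiset_fact (add_mset i M) = (\<Prod>j\<in>?S. fact (count (add_mset i M) j))"
    by (rule sup) auto
  also have "\<dots> = fact (Suc (count M i)) * (\<Prod>j\<in>?S - {i}. fact (count (add_mset i M) j))"
    by (subst prod.remove[of _ i]) auto
  also have "(\<Prod>j\<in>?S - {i}. fact (count (add_mset i M) j)) = (\<Prod>j\<in>?S - {i}. fact (count M j))"
    by (intro prod.cong) auto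
  also have "fact (Suc (count M i)) * \<dots> = Suc (count M i) * (\<Prod>j\<in>?S. fact (count M j))"
    by (subst (2) prod.remove[of _ i]) (auto simp: algebra_simps)
  also have "(\<Prod>j\<in>?S. fact (count M j)) = multiset_fact M"
    by (rule sup[symmetric]) auto
  finally show ?thesis .
qed

definition pairing :: "'u::ring_1 ef_poly \<Rightarrow> 'u" where
  "pairing = linear_extension (\<lambda>(M, N) z. if M = N then of_nat (multiset_fact M) * z else 0)"

text \<open>If i does not occur in N, then N - {#i#} is just N, but the coefficient count N i is 0,
  as it should be for a derivative.\<close>

definition diff_f :: "nat \<Rightarrow> 'u::ring_1 ef_poly \<Rightarrow> 'u ef_poly" where
  "diff_f i = linear_extension (\<lambda>(M, N) z. Poly_Mapping.single (M, N - {#i#}) (of_nat (count N i) * z))"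

lemma pairing_add: "pairing (z + w) = pairing z + pairing w"
  and pairing_single: "pairing (Poly_Mapping.single (M, N) c) = (if M = N then of_nat (multiset_fact M) * c else 0)"
  unfolding pairing_def by (simp_all add: linear_extension_add linear_extension_single algebra_simps split: prod.split)

lemma diff_f_add: "diff_f i (z + w) = diff_f i z + diff_f i w"
  and diff_f_single: "diff_f i (Poly_Mapping.single (M, N) c) = Poly_Mapping.single (M, N - {#i#}) (of_nat (count N i) * c)"
  unfolding diff_f_def
  by (simp_all add: linear_extension_add linear_extension_single algebra_simps single_add split: prod.split)

lemma diff_f_mult_single:
  "diff_f i (Poly_Mapping.single (M, N) c * Poly_Mapping.single (M', N') c')
    = diff_f i (Poly_Mapping.single (M, N) c) * Poly_Mapping.single (M', N') c'
      + Poly_Mapping.single (M, N) c * diff_f i (Poly_Mapping.single (M', N') c')"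
proof -
  have 1: "Poly_Mapping.single (M + M', N - {#i#} + N') (of_nat (count N i) * (c * c'))
      = Poly_Mapping.single (M + M', N + N' - {#i#}) (of_nat (count N i) * (c * c'))"
    by (cases "i \<in># N") (auto simp: not_in_iff)
  have 2: "Poly_Mapping.single (M + M', N + (N' - {#i#})) (of_nat (count N' i) * (c * c'))
      = Poly_Mapping.single (M + M', N + N' - {#i#}) (of_nat (count N' i) * (c * c'))"
    by (cases "i \<in># N'") (auto simp: not_in_iff)
  show ?thesis
    by (simp add: diff_f_single mult_single mult.assoc 1 2 of_nat_left_commute[of c] distrib_right flip: single_add)
qed

lemma derivation_diff_f: "derivation (diff_f i :: 'u::ring_1 ef_poly \<Rightarrow> _)"
proof -
  have "diff_f i (z * w) = diff_f i z * w + z * diff_f i w" for z w :: "'u ef_poly"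
  proof (rule additive_eqI[of "\<lambda>z. diff_f i (z * w)" "\<lambda>z. diff_f i z * w + z * diff_f i w"])
    fix k and c :: 'u
    show "diff_f i (Poly_Mapping.single k c * w)
        = diff_f i (Poly_Mapping.single k c) * w + Poly_Mapping.single k c * diff_f i w"
    proof (rule additive_eqI[of "\<lambda>w. diff_f i (Poly_Mapping.single k c * w)"
        "\<lambda>w. diff_f i (Poly_Mapping.single k c) * w + Poly_Mapping.single k c * diff_f i w"])
      fix l and d :: 'u
      show "diff_f i (Poly_Mapping.single k c * Poly_Mapping.single l d)
          = diff_f i (Poly_Mapping.single k c) * Poly_Mapping.single l d
            + Poly_Mapping.single k c * diff_f i (Poly_Mapping.single l d)"
        by (cases k; cases l) (simp only: diff_f_mult_single)
    qed (simp_all add: algebra_simps diff_f_add)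
  qed (simp_all add: algebra_simps diff_f_add)
  then show ?thesis
    by (simp add: derivation_def diff_f_add)
qed

lemma diff_f_var_e: "diff_f i (var_e j) = 0"
  and diff_f_var_f: "diff_f i (var_f j) = (if i = j then 1 else 0)"
  and diff_f_const: "diff_f i (const z) = 0"
  by (simp_all add: var_e_def var_f_def const_def diff_f_single const_simps(6)[unfolded const_def])

text \<open>On monomials both sides vanish unless N is M with one more i, and then N! = (count M i +
  1) * M!.\<close>

lemma pairing_var_e: "pairing (var_e i * z) = pairing (diff_f i z)"
proof (rule additive_eqI[of "\<lambda>z. pairing (var_e i * z)" "\<lambda>z. pairing (diff_f i z)"])
  fix k :: "nat multiset \<times> nat multiset" and c :: 'a
  obtain M N where k: "k = (M, N)" by (cases k)
  show "pairing (var_e i * Poly_Mapping.single k c) = pairing (diff_f i (Poly_Mapping.single k c))"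
  proof (cases "i \<in># N")
    case True
    then obtain N' where N: "N = add_mset i N'"
      by (meson multi_member_split)
    have "of_nat (Suc (count L i) * multiset_fact L) * c = of_nat (multiset_fact L) * (of_nat (Suc (count L i)) * c)"
      for L
      by (simp only: mult.commute[of "Suc (count L i)"] of_nat_mult mult.assoc)
    then show ?thesis
      by (simp add: k N var_e_def mult_single diff_f_single pairing_single multiset_fact_add_mset
          del: of_nat_Suc mult_Suc of_nat_mult)
  next
    case False
    then have "add_mset i M \<noteq> N" by auto
    then show ?thesis
      using False pairing_add[of 0 0] by (auto simp: k var_e_def mult_single diff_f_single pairing_single not_in_iff)
  qed
qed (simp_all add: pairing_add diff_f_add distrib_left)

section \<open>Words, rearrangements and permanents\<close>

definition words :: "nat set \<Rightarrow> nat \<Rightarrow> nat list set" where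
  "words S k = {w. set w \<subseteq> S \<and> length w = k}"

lemma finite_words: "finite S \<Longrightarrow> finite (words S k)"
  unfolding words_def by (rule finite_lists_length_eq)

lemma words_Suc: "words S (Suc k) = (\<lambda>(i, w). i # w) ` (S \<times> words S k)"
  by (auto simp: words_def length_Suc_conv image_iff)

lemma prod_list_upt_Suc:
  "prod_list (map f [0..<Suc k]) = f 0 * prod_list (map (\<lambda>r. f (Suc r)) [0..<k])"
  by (simp only: upt_conv_Cons zero_less_Suc list.map prod_list.Cons map_Suc_upt[symmetric] map_map o_def)

lemma prod_list_sum:
  fixes g :: "nat \<Rightarrow> nat \<Rightarrow> 'a::ring_1"
  shows "prod_list (map (\<lambda>r. \<Sum>i\<in>S. g r i) [0..<k]) = (\<Sum>w\<in>words S k. prod_list (map (\<lambda>r. g r (w ! r)) [0..<k]))"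
proof (induction k arbitrary: g)
  case 0
  show ?case by (simp add: words_def cong: conj_cong)
next
  case (Suc k)
  have "prod_list (map (\<lambda>r. \<Sum>i\<in>S. g r i) [0..<Suc k])
      = (\<Sum>i\<in>S. g 0 i) * (\<Sum>w\<in>words S k. prod_list (map (\<lambda>r. g (Suc r) (w ! r)) [0..<k]))"
    by (simp only: prod_list_upt_Suc Suc.IH)
  also have "\<dots> = (\<Sum>(i, w)\<in>S \<times> words S k. prod_list (map (\<lambda>r. g r ((i # w) ! r)) [0..<Suc k]))"
    by (simp add: sum_product sum.cartesian_product prod_list_upt_Suc del: upt_Suc)
  also have "\<dots> = (\<Sum>w\<in>words S (Suc k). prod_list (map (\<lambda>r. g r (w ! r)) [0..<Suc k]))"
    unfolding words_Suc by (subst sum.reindex) (auto simp: inj_on_def case_prod_unfold)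
  finally show ?case .
qed

lemma rising_conv_prod_list: "rising X z m = prod_list (map (\<lambda>r. X (z + int r)) [0..<m])"
  by (induction m) (simp_all add: rising_Suc_right del: rising.simps(2))

lemma prod_list_single:
  fixes z :: "nat \<Rightarrow> 'u::ring_1" and m :: "nat \<Rightarrow> 'k::comm_monoid_add"
  shows "prod_list (map (\<lambda>r. Poly_Mapping.single (m r) (z r)) [0..<k])
    = Poly_Mapping.single (\<Sum>r<k. m r) (prod_list (map z [0..<k]))"
  by (induction k) (simp_all add: mult_single)

lemma sum_singletons_nth: "(\<Sum>r<length w. {#w ! r#}) = mset w"
  by (induction w rule: rev_induct) (simp_all add: nth_append)

lemma sum_pair: "(\<Sum>r\<in>S. (f r, g r)) = (\<Sum>r\<in>S. f r, \<Sum>r\<in>S. g r)"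
  by (induction S rule: infinite_finite_induct) (simp_all add: zero_prod_def)

lemma multiset_fact_mset: "multiset_fact (mset \<alpha>) = multi_fact \<alpha>"
  by (simp add: multiset_fact_def multi_fact_def count_mset)

lemma card_permutations_of_multiset_mset:
  "card (permutations_of_multiset (mset \<alpha>)) * multi_fact \<alpha> = fact (length \<alpha>)"
  using card_permutations_of_multiset_aux[of "mset \<alpha>"]
  by (simp add: multiset_fact_mset[symmetric] multiset_fact_def)

text \<open>All fibres of \<open>\<sigma> \<mapsto> permute_list \<sigma> \<alpha>\<close> over the rearrangements of \<open>\<alpha>\<close> are translates of the
  stabilizer of \<open>\<alpha>\<close>, so they have \<open>\<alpha>!\<close> elements.\<close>

lemma card_permute_list_fibre:
  assumes v: "v \<in> permutations_of_multiset (mset \<alpha>)"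
  shows "card {\<sigma>. \<sigma> permutes {..<length \<alpha>} \<and> permute_list \<sigma> \<alpha> = v} = multi_fact \<alpha>"
proof -
  let ?S = "{\<sigma>. \<sigma> permutes {..<length \<alpha>}}"
  let ?fib = "\<lambda>v. {\<sigma>. \<sigma> permutes {..<length \<alpha>} \<and> permute_list \<sigma> \<alpha> = v}"
  have const: "card (?fib v) = card (?fib \<alpha>)" if v: "v \<in> permutations_of_multiset (mset \<alpha>)" for v
  proof -
    obtain \<tau> where \<tau>: "\<tau> permutes {..<length \<alpha>}" "permute_list \<tau> \<alpha> = v"
      using v by (metis mset_eq_permutation permutations_of_multisetD)
    have "bij_betw (\<lambda>\<sigma>. \<sigma> \<circ> \<tau>) (?fib \<alpha>) (?fib v)"
    proof (rule bij_betw_byWitness[where f' = "\<lambda>\<sigma>. \<sigma> \<circ> inv_into UNIV \<tau>"])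
      have inv: "inv_into UNIV \<tau> permutes {..<length \<alpha>}"
        by (rule permutes_inv) (rule \<tau>(1))
      have v': "permute_list (inv_into UNIV \<tau>) v = \<alpha>"
      proof -
        have "permute_list (\<tau> \<circ> inv_into UNIV \<tau>) \<alpha> = permute_list (inv_into UNIV \<tau>) (permute_list \<tau> \<alpha>)"
          by (rule permute_list_compose) (rule inv)
        then show ?thesis
          by (simp add: \<tau>(2) permutes_inv_o(1)[OF \<tau>(1)])
      qed
      show "\<forall>\<sigma>\<in>?fib \<alpha>. \<sigma> \<circ> \<tau> \<circ> inv_into UNIV \<tau> = \<sigma>" "\<forall>\<sigma>\<in>?fib v. \<sigma> \<circ> inv_into UNIV \<tau> \<circ> \<tau> = \<sigma>"
        by (simp_all add: o_assoc[symmetric] permutes_inv_o[OF \<tau>(1)])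
      show "(\<lambda>\<sigma>. \<sigma> \<circ> \<tau>) ` ?fib \<alpha> \<subseteq> ?fib v"
        using \<tau> by (auto simp: permute_list_compose permutes_compose)
      show "(\<lambda>\<sigma>. \<sigma> \<circ> inv_into UNIV \<tau>) ` ?fib v \<subseteq> ?fib \<alpha>"
        using inv v' by (auto simp: permute_list_compose permutes_compose)
    qed
    then show ?thesis
      by (rule bij_betw_same_card[symmetric])
  qed
  have "?S = (\<Union>v\<in>permutations_of_multiset (mset \<alpha>). ?fib v)"
    by (auto intro!: permutations_of_multisetI)
  then have "card ?S = (\<Sum>v\<in>permutations_of_multiset (mset \<alpha>). card (?fib v))"
    by (simp only:) (rule card_UN_disjoint, auto intro: finite_subset[OF _ finite_permutations])
  also have "\<dots> = card (permutations_of_multiset (mset \<alpha>)) * card (?fib \<alpha>)"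
    using const by simp
  also have "card ?S = card (permutations_of_multiset (mset \<alpha>)) * multi_fact \<alpha>"
    by (simp add: card_permutations card_permutations_of_multiset_mset)
  finally have "multi_fact \<alpha> = card (?fib \<alpha>)"
    by simp
  then show ?thesis
    using const[OF v] by simp
qed

lemma sum_permute_list:
  fixes g :: "nat list \<Rightarrow> 'a::ring_1"
  assumes "length \<alpha> = k"
  shows "(\<Sum>\<sigma> | \<sigma> permutes {..<k}. g (permute_list \<sigma> \<alpha>))
    = of_nat (multi_fact \<alpha>) * (\<Sum>v\<in>permutations_of_multiset (mset \<alpha>). g v)"
proof -
  have "(\<Sum>\<sigma> | \<sigma> permutes {..<k}. g (permute_list \<sigma> \<alpha>))
      = (\<Sum>v\<in>permutations_of_multiset (mset \<alpha>).
          \<Sum>\<sigma> | \<sigma> permutes {..<k} \<and> permute_list \<sigma> \<alpha> = v. g (permute_list \<sigma> \<alpha>))"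
    using assms
    by (subst sum.group[of "{\<sigma>. \<sigma> permutes {..<k}}", symmetric, where g = "\<lambda>\<sigma>. permute_list \<sigma> \<alpha>"
          and T = "permutations_of_multiset (mset \<alpha>)"])
      (auto intro!: permutations_of_multisetI finite_permutations)
  also have "\<dots> = (\<Sum>v\<in>permutations_of_multiset (mset \<alpha>). of_nat (multi_fact \<alpha>) * g v)"
    using card_permute_list_fibre[of _ \<alpha>] assms by (intro sum.cong) simp_all
  finally show ?thesis
    by (simp add: sum_distrib_left)
qed

lemma sum_permutes_entries:
  assumes "length \<alpha> = k"
  shows "(\<Sum>\<sigma> | \<sigma> permutes {..<k}. prod_list (map (\<lambda>r. Z r (\<alpha> ! \<sigma> r)) [0..<k]))
    = of_nat (multi_fact \<alpha>) * (\<Sum>v\<in>permutations_of_multiset (mset \<alpha>). prod_list (map (\<lambda>r. Z r (v ! r)) [0..<k]) :: 'a::ring_1)"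
proof -
  have "(\<Sum>\<sigma> | \<sigma> permutes {..<k}. prod_list (map (\<lambda>r. Z r (\<alpha> ! \<sigma> r)) [0..<k]))
      = (\<Sum>\<sigma> | \<sigma> permutes {..<k}. prod_list (map (\<lambda>r. Z r (permute_list \<sigma> \<alpha> ! r)) [0..<k]))"
    by (intro sum.cong arg_cong[of _ _ prod_list] map_cong) (simp_all add: permute_list_nth assms)
  then show ?thesis
    by (simp only: sum_permute_list[OF assms, of "\<lambda>v. prod_list (map (\<lambda>r. Z r (v ! r)) [0..<k])"])
qed

section \<open>Sums over sorted words and products invariant under rearrangement\<close>

definition sorted_words :: "nat set \<Rightarrow> nat \<Rightarrow> nat list set" where
  "sorted_words S k = {\<alpha> \<in> words S k. sorted \<alpha>}"

lemma finite_sorted_words: "finite S \<Longrightarrow> finite (sorted_words S k)"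
  unfolding sorted_words_def using finite_words by simp

lemma sum_words:
  assumes "finite S"
  shows "(\<Sum>w\<in>words S k. g w) = (\<Sum>\<alpha>\<in>sorted_words S k. \<Sum>w\<in>permutations_of_multiset (mset \<alpha>). g w)"
proof -
  have "{w \<in> words S k. sort w = \<alpha>} = permutations_of_multiset (mset \<alpha>)" if "\<alpha> \<in> sorted_words S k" for \<alpha>
  proof -
    have "w \<in> words S k \<and> sort w = \<alpha> \<longleftrightarrow> mset w = mset \<alpha>" for w
    proof
      assume "mset w = mset \<alpha>"
      then show "w \<in> words S k \<and> sort w = \<alpha>"
        using that mset_eq_setD[of w \<alpha>] mset_eq_length[of w \<alpha>] properties_for_sort[of \<alpha> w]
        by (simp add: sorted_words_def words_def)
    qed auto
    then show ?thesis
      by (auto intro!: permutations_of_multisetI dest: permutations_of_multisetD)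
  qed
  moreover have "(\<Sum>\<alpha>\<in>sorted_words S k. \<Sum>w | w \<in> words S k \<and> sort w = \<alpha>. g w) = (\<Sum>w\<in>words S k. g w)"
    using assms by (intro sum.group finite_words finite_sorted_words) (auto simp: sorted_words_def words_def)
  ultimately show ?thesis by simp
qed

lemma sum_words_invariant:
  fixes g :: "nat list \<Rightarrow> 'a::ring_1"
  assumes "finite S" and "\<And>v w. set v \<subseteq> S \<Longrightarrow> mset v = mset w \<Longrightarrow> g v = g w"
  shows "(\<Sum>w\<in>words S k. g w)
    = (\<Sum>\<alpha>\<in>sorted_words S k. of_nat (card (permutations_of_multiset (mset \<alpha>))) * g \<alpha>)"
proof -
  have "(\<Sum>w\<in>permutations_of_multiset (mset \<alpha>). g w) = of_nat (card (permutations_of_multiset (mset \<alpha>))) * g \<alpha>"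
    if "\<alpha> \<in> sorted_words S k" for \<alpha>
  proof -
    have "g w = g \<alpha>" if "w \<in> permutations_of_multiset (mset \<alpha>)" for w
      using assms(2)[of \<alpha> w] that \<open>\<alpha> \<in> sorted_words S k\<close>
      by (auto simp: sorted_words_def words_def dest: permutations_of_multisetD)
    then show ?thesis by simp
  qed
  then show ?thesis
    using assms(1) by (simp add: sum_words)
qed

text \<open>The shift belongs to the position and not to the letter, so neighbouring letters can be
  exchanged although the factors need not commute. Such exchanges bring any letter to the front, and
  induction settles the rest.\<close>

lemma prod_list_mset_invariant:
  fixes g :: "int \<Rightarrow> nat \<Rightarrow> 'a::ring_1"
  assumes swap: "\<And>z i j. i \<in> S \<Longrightarrow> j \<in> S \<Longrightarrow> g z i * g (z + 1) j = g z j * g (z + 1) i"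
    and "set v \<subseteq> S" and "mset v = mset w"
  shows "prod_list (map (\<lambda>r. g (z + int r) (v ! r)) [0..<length v])
    = prod_list (map (\<lambda>r. g (z + int r) (w ! r)) [0..<length w])"
proof -
  define P where "P z w = prod_list (map (\<lambda>r. g (z + int r) (w ! r)) [0..<length w])" for z and w :: "nat list"
  have P_Cons: "P z (i # w) = g z i * P (z + 1) w" for z i w
    by (simp add: P_def prod_list_upt_Suc add_ac del: upt_Suc)
  have front: "P z (w1 @ i # w2) = P z (i # w1 @ w2)" if "set (w1 @ i # w2) \<subseteq> S" for z i w1 w2
    using that
  proof (induction w1 arbitrary: z)
    case (Cons j w1)
    have "P z ((j # w1) @ i # w2) = g z j * (g (z + 1) i * P (z + 1 + 1) (w1 @ w2))"
      using Cons by (simp add: P_Cons)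
    also have "\<dots> = g z i * (g (z + 1) j * P (z + 1 + 1) (w1 @ w2))"
      using Cons.prems swap[of j i z] by (simp flip: mult.assoc)
    finally show ?case
      by (simp add: P_Cons)
  qed simp
  have "P z v = P z w" using assms(2,3)
  proof (induction v arbitrary: z w)
    case (Cons i v)
    then have "i \<in> set w"
      by (metis list.set_intros(1) mset_eq_setD)
    then obtain w1 w2 where w: "w = w1 @ i # w2"
      by (meson split_list)
    have "P z (i # v) = P z (i # w1 @ w2)"
      using Cons.IH[of "w1 @ w2" "z + 1"] Cons.prems by (simp add: P_Cons w)
    moreover have "set w \<subseteq> S"
      using Cons.prems by (metis mset_eq_setD)
    ultimately show ?case
      using front[of w1 i w2 z] w by simp
  qed simp
  then show ?thesis by (simp add: P_def)
qed

section \<open>Permanents as pairings\<close>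

definition eta :: "nat \<Rightarrow> (nat \<Rightarrow> nat \<Rightarrow> 'u::ring_1) \<Rightarrow> nat \<Rightarrow> 'u ef_poly" where
  "eta N Z j = (\<Sum>i\<in>{1..N}. var_e i * const (Z i j))"

definition word_prod :: "nat \<Rightarrow> (nat \<Rightarrow> nat \<Rightarrow> nat \<Rightarrow> 'u::ring_1) \<Rightarrow> nat list \<Rightarrow> 'u ef_poly" where
  "word_prod N Z w = prod_list (map (\<lambda>r. var_f (w ! r) * eta N (Z r) (w ! r)) [0..<length w])"

lemma sum_word_prod:
  "prod_list (map (\<lambda>r. \<Sum>j\<in>S. var_f j * eta N (Z r) j) [0..<k]) = (\<Sum>w\<in>words S k. word_prod N Z w)"
  by (simp add: prod_list_sum word_prod_def words_def)

lemma pairing_sum: "pairing (sum g S) = (\<Sum>i\<in>S. pairing (g i))"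
  by (rule additive_sum) (rule pairing_add)

text \<open>Choosing the summand v ! r of the r-th eta gives the exponents (mset v, mset w). The
  pairing keeps those v that rearrange w and contributes the factor w!.\<close>

lemma pairing_word_prod:
  fixes Z :: "nat \<Rightarrow> nat \<Rightarrow> nat \<Rightarrow> 'u::ring_1"
  assumes "set w \<subseteq> {1..N}" and "length w = k"
  shows "pairing (word_prod N Z w) = of_nat (multi_fact w)
    * (\<Sum>v\<in>permutations_of_multiset (mset w). prod_list (map (\<lambda>r. Z r (v ! r) (w ! r)) [0..<k]))"
proof -
  have "var_f j * eta N (Z r) j = (\<Sum>i\<in>{1..N}. Poly_Mapping.single ({#i#}, {#j#}) (Z r i j))" for r j
    by (simp add: eta_def var_f_def var_e_def const_def mult_single sum_distrib_left)
  then have "word_prod N Z w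
      = (\<Sum>v\<in>words {1..N} k. prod_list (map (\<lambda>r. Poly_Mapping.single ({#v ! r#}, {#w ! r#}) (Z r (v ! r) (w ! r))) [0..<k]))"
    using assms(2) by (simp add: word_prod_def prod_list_sum)
  also have "\<dots> = (\<Sum>v\<in>words {1..N} k. Poly_Mapping.single (mset v, mset w) (prod_list (map (\<lambda>r. Z r (v ! r) (w ! r)) [0..<k])))"
  proof (rule sum.cong)
    fix v assume "v \<in> words {1..N} k"
    then have "length v = k" by (simp add: words_def)
    then show "prod_list (map (\<lambda>r. Poly_Mapping.single ({#v ! r#}, {#w ! r#}) (Z r (v ! r) (w ! r))) [0..<k])
        = Poly_Mapping.single (mset v, mset w) (prod_list (map (\<lambda>r. Z r (v ! r) (w ! r)) [0..<k]))"
      using assms(2) sum_singletons_nth[of v] sum_singletons_nth[of w] by (simp add: prod_list_single sum_pair)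
  qed simp
  finally have "pairing (word_prod N Z w) = (\<Sum>v\<in>words {1..N} k.
      if mset v = mset w then of_nat (multi_fact w) * prod_list (map (\<lambda>r. Z r (v ! r) (w ! r)) [0..<k]) else 0)"
    by (simp add: pairing_sum pairing_single) (intro sum.cong, auto simp: multiset_fact_mset)
  also have "\<dots> = (\<Sum>v\<in>{v \<in> words {1..N} k. mset v = mset w}.
      of_nat (multi_fact w) * prod_list (map (\<lambda>r. Z r (v ! r) (w ! r)) [0..<k]))"
    by (rule sum.inter_filter[symmetric]) (simp add: finite_words)
  also have "{v \<in> words {1..N} k. mset v = mset w} = permutations_of_multiset (mset w)"
  proof -
    have "v \<in> words {1..N} k" if "mset v = mset w" for v
      using assms mset_eq_setD[OF that] mset_eq_length[OF that] by (simp add: words_def)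
    then show ?thesis
      unfolding permutations_of_multiset_def by auto
  qed
  finally show ?thesis
    by (simp add: sum_distrib_left)
qed

text \<open>Permutations reach every rearrangement of w exactly w! times, which is the factor
  supplied by the pairing.\<close>

lemma column_permanent_eq_pairing:
  assumes "set w \<subseteq> {1..N}" and "length w = k"
  shows "column_permanent k (\<lambda>i r. Z r (w ! i) (w ! r)) = pairing (word_prod N Z w)"
  unfolding column_permanent_def pairing_word_prod[OF assms]
  by (rule sum_permutes_entries[OF assms(2), of "\<lambda>r i. Z r i (w ! r)"])

lemma multi_indices_eq: "multi_indices N k = sorted_words {1..N} k"
  by (auto simp: multi_indices_def sorted_words_def words_def)

lemma multi_fact_nonzero: "multi_fact \<alpha> \<noteq> 0"
  by (simp add: multi_fact_def)

lemma scaleC_inverse_mult: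
  fixes z :: "'a::complex_algebra_1"
  assumes "m \<noteq> 0"
  shows "(1 / of_nat m) *\<^sub>C (of_nat m * z) = z"
  using assms by (simp add: of_nat_mult_eq_scaleC scaleC_scaleC scaleC_one)

text \<open>The two sums over permutations give \<alpha>! squared times sums over rearrangements.
  One \<alpha>! cancels the prefactor, the other is the factor in the pairing.\<close>

lemma symmetric_sum_eq_pairing:
  fixes Z :: "nat \<Rightarrow> nat \<Rightarrow> nat \<Rightarrow> 'u::complex_algebra_1"
  shows "(\<Sum>\<alpha>\<in>multi_indices N k. (1 / of_nat (multi_fact \<alpha>)) *\<^sub>C
      (\<Sum>\<sigma> | \<sigma> permutes {..<k}. \<Sum>\<sigma>' | \<sigma>' permutes {..<k}.
        prod_list (map (\<lambda>r. Z r (\<alpha> ! \<sigma> r) (\<alpha> ! \<sigma>' r)) [0..<k])))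
    = pairing (prod_list (map (\<lambda>r. \<Sum>j\<in>{1..N}. var_f j * eta N (Z r) j) [0..<k]))"
proof -
  have "(1 / of_nat (multi_fact \<alpha>)) *\<^sub>C
      (\<Sum>\<sigma> | \<sigma> permutes {..<k}. \<Sum>\<sigma>' | \<sigma>' permutes {..<k}.
        prod_list (map (\<lambda>r. Z r (\<alpha> ! \<sigma> r) (\<alpha> ! \<sigma>' r)) [0..<k]))
      = (\<Sum>w\<in>permutations_of_multiset (mset \<alpha>). pairing (word_prod N Z w))"
    if "\<alpha> \<in> sorted_words {1..N} k" for \<alpha>
  proof -
    have \<alpha>: "length \<alpha> = k" "set \<alpha> \<subseteq> {1..N}"
      using that by (auto simp: sorted_words_def words_def)
    let ?R = "permutations_of_multiset (mset \<alpha>)"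
    have "(\<Sum>\<sigma> | \<sigma> permutes {..<k}. \<Sum>\<sigma>' | \<sigma>' permutes {..<k}.
          prod_list (map (\<lambda>r. Z r (\<alpha> ! \<sigma> r) (\<alpha> ! \<sigma>' r)) [0..<k]))
        = (\<Sum>\<sigma>' | \<sigma>' permutes {..<k}. of_nat (multi_fact \<alpha>) *
          (\<Sum>v\<in>?R. prod_list (map (\<lambda>r. Z r (v ! r) (\<alpha> ! \<sigma>' r)) [0..<k])))"
      by (subst sum.swap) (intro sum.cong refl sum_permutes_entries[OF \<alpha>(1), of "\<lambda>r i. Z r i (\<alpha> ! _ r)"])
    also have "\<dots> = of_nat (multi_fact \<alpha>) * (\<Sum>v\<in>?R. \<Sum>\<sigma>' | \<sigma>' permutes {..<k}.
          prod_list (map (\<lambda>r. Z r (v ! r) (\<alpha> ! \<sigma>' r)) [0..<k]))"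
      by (subst sum.swap) (simp add: sum_distrib_left)
    also have "(\<Sum>v\<in>?R. \<Sum>\<sigma>' | \<sigma>' permutes {..<k}. prod_list (map (\<lambda>r. Z r (v ! r) (\<alpha> ! \<sigma>' r)) [0..<k]))
        = (\<Sum>v\<in>?R. of_nat (multi_fact \<alpha>) * (\<Sum>w\<in>?R. prod_list (map (\<lambda>r. Z r (v ! r) (w ! r)) [0..<k])))"
      by (intro sum.cong refl sum_permutes_entries[OF \<alpha>(1)])
    also have "\<dots> = (\<Sum>w\<in>?R. of_nat (multi_fact \<alpha>) * (\<Sum>v\<in>?R. prod_list (map (\<lambda>r. Z r (v ! r) (w ! r)) [0..<k])))"
      unfolding sum_distrib_left by (rule sum.swap)
    also have "\<dots> = (\<Sum>w\<in>?R. pairing (word_prod N Z w))"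
    proof (rule sum.cong)
      fix w assume "w \<in> ?R"
      then have w: "mset w = mset \<alpha>" by (rule permutations_of_multisetD)
      then have "set w \<subseteq> {1..N}" "length w = k" "multi_fact w = multi_fact \<alpha>"
        using \<alpha> mset_eq_setD[OF w] mset_eq_length[OF w] by (simp_all flip: multiset_fact_mset)
      then show "of_nat (multi_fact \<alpha>) * (\<Sum>v\<in>?R. prod_list (map (\<lambda>r. Z r (v ! r) (w ! r)) [0..<k]))
          = pairing (word_prod N Z w)"
        by (simp add: pairing_word_prod w)
    qed simp
    finally show ?thesis
      by (simp add: scaleC_inverse_mult multi_fact_nonzero)
  qed
  then show ?thesis
    by (simp add: sum_word_prod pairing_sum sum_words multi_indices_eq)
qed

section \<open>Generators of the symplectic Lie algebra\<close>

text \<open>The sign \<open>eps\<close> as an integer, so that \<open>of_int\<close> carries it both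
  into the algebra and into the polynomial ring.\<close>

definition sgi :: "nat \<Rightarrow> nat \<Rightarrow> int" where
  "sgi n i = (if i \<le> n then - 1 else 1)"

lemma refl_index_simps:
  assumes "i \<in> {1..2 * n}"
  shows "refl_index n i \<in> {1..2 * n}" "refl_index n (refl_index n i) = i" "sgi n (refl_index n i) = - sgi n i"
  using assms by (auto simp: refl_index_def sgi_def)

lemma sum_refl_index:
  "(\<Sum>i\<in>{1..2 * n}. f i) = (\<Sum>i\<in>{1..n}. f i + (f (refl_index n i) :: 'a::comm_monoid_add))"
proof -
  have "{1..2 * n} = {1..n} \<union> {n + 1..2 * n}" by auto
  then have "(\<Sum>i\<in>{1..2 * n}. f i) = (\<Sum>i\<in>{1..n}. f i) + (\<Sum>i\<in>{n + 1..2 * n}. f i)"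
    by (simp only:) (rule sum.union_disjoint, auto)
  also have "(\<Sum>i\<in>{n + 1..2 * n}. f i) = (\<Sum>i\<in>{1..n}. f (refl_index n i))"
    by (rule sum.reindex_bij_witness[of _ "refl_index n" "refl_index n"]) (auto simp: refl_index_def)
  finally show ?thesis by (simp add: sum.distrib)
qed

lemma const_of_int_mult: "const (of_int m * z) = of_int m * const z"
proof -
  have "const (of_nat l * z) = of_nat l * const z" for l
    by (induction l) (simp_all add: const_simps distrib_right)
  then show ?thesis
    by (cases m rule: int_cases2) (simp_all add: const_simps)
qed

lemma var_e_commute: "z * var_e i = var_e i * z"
  by (rule centralD) (rule central_var_e)

lemma var_e_left_commute: "z * (var_e i * w) = var_e i * (z * w)"
  by (rule central_left_commute) (rule central_var_e)

text \<open>The first two terms of the bracket are those of the matrix units; the last two come from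
  the reflected unit in F_ij.\<close>

locale sp_generators =
  fixes n :: nat and F :: "nat \<Rightarrow> nat \<Rightarrow> 'u::complex_algebra_1"
  assumes F_commutator: "i \<in> {1..2 * n} \<Longrightarrow> j \<in> {1..2 * n} \<Longrightarrow> k \<in> {1..2 * n} \<Longrightarrow> l \<in> {1..2 * n} \<Longrightarrow>
    F i j * F k l - F k l * F i j = (if k = j then F i l else 0) - (if i = l then F k j else 0)
      - (if k = refl_index n i then of_int (sgi n i * sgi n j) * F (refl_index n j) l else 0)
      + (if l = refl_index n j then of_int (sgi n i * sgi n j) * F k (refl_index n i) else 0)"
begin

abbreviation "r \<equiv> refl_index n"
abbreviation "etaF \<equiv> eta (2 * n) F"

text \<open>The e's commute, while i and its mirror image have opposite signs. This removes the term
  with k = r i from \<open>eta_commutator\<close>, and in \<open>etac_commutator\<close> it shows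
  that the scalar shift leaves Theta unchanged.\<close>

lemma sum_sgi_var_e: "(\<Sum>i\<in>{1..2 * n}. of_int (sgi n i) * (var_e i * (var_e (r i) * z))) = 0"
proof -
  have "of_int (sgi n i) * (var_e i * (var_e (r i) * z)) + of_int (sgi n (r i)) * (var_e (r i) * (var_e (r (r i)) * z)) = 0"
    if "i \<in> {1..n}" for i
    using refl_index_simps[of i n] that
    by (simp add: sgi_def var_e_left_commute[of "var_e (r i)" i])
  then show ?thesis
    by (simp only: sum_refl_index sum.neutral_const cong: sum.cong)
qed

lemma const_sgi: "const (of_int (sgi n i * sgi n j) * z :: 'u) = of_int (sgi n j) * (of_int (sgi n i) * const z)"
  unfolding const_of_int_mult by (simp add: mult.commute[of "sgi n i"] mult.assoc)

lemma eta_commutator: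
  assumes j: "j \<in> {1..2 * n}" and l: "l \<in> {1..2 * n}"
  shows "etaF j * etaF l - etaF l * etaF j = var_e j * etaF l - var_e l * etaF j
    + (if l = r j then of_int (sgi n j) * (\<Sum>i\<in>{1..2 * n}. of_int (sgi n i) * (var_e i * etaF (r i))) else 0)"
proof -
  let ?I = "{1..2 * n}"
  have "etaF j * etaF l - etaF l * etaF j
      = (\<Sum>i\<in>?I. \<Sum>k\<in>?I. var_e i * (var_e k * (const (F i j * F k l - F k l * F i j))))"
  proof -
    have "etaF l * etaF j = (\<Sum>i\<in>?I. \<Sum>k\<in>?I. var_e i * (var_e k * (const (F k l) * const (F i j))))"
      unfolding eta_def sum_product
      by (subst sum.swap) (simp add: mult.assoc var_e_left_commute[of "const _"] var_e_left_commute[of "var_e _"])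
    then show ?thesis
      by (simp add: eta_def sum_product const_simps mult.assoc var_e_left_commute[of "const _"]
          right_diff_distrib sum_subtractf)
  qed
  also have "\<dots> = (\<Sum>i\<in>?I. \<Sum>k\<in>?I. (if k = j then var_e i * (var_e k * const (F i l)) else 0)
      - (if i = l then var_e i * (var_e k * const (F k j)) else 0)
      - (if k = r i then of_int (sgi n j) * (of_int (sgi n i) * (var_e i * (var_e k * const (F (r j) l)))) else 0)
      + (if l = r j then of_int (sgi n j) * (of_int (sgi n i) * (var_e i * (var_e k * const (F k (r i))))) else 0))"
    using j l
    by (intro sum.cong refl)
      (simp only: F_commutator, simp add: const_simps(1,2,5) if_distrib[of const] if_distrib[of "(*) _"]
        distrib_left right_diff_distrib of_int_left_commute[of "var_e _"] const_sgi mult.assoc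
        del: of_int_mult cong: if_cong)
  also have "\<dots> = (\<Sum>i\<in>?I. var_e i * (var_e j * const (F i l))) - (\<Sum>k\<in>?I. var_e l * (var_e k * const (F k j)))
      - of_int (sgi n j) * (\<Sum>i\<in>?I. of_int (sgi n i) * (var_e i * (var_e (r i) * const (F (r j) l))))
      + (if l = r j then of_int (sgi n j) * (\<Sum>i\<in>?I. of_int (sgi n i) * (var_e i * etaF (r i))) else 0)"
  proof -
    have 1: "(\<Sum>i\<in>?I. \<Sum>k\<in>?I. if k = j then f i k else 0) = (\<Sum>i\<in>?I. f i j)" for f :: "nat \<Rightarrow> nat \<Rightarrow> 'u ef_poly"
      using j by simp
    have 2: "(\<Sum>i\<in>?I. \<Sum>k\<in>?I. if i = l then f i k else 0) = (\<Sum>k\<in>?I. f l k)" for f :: "nat \<Rightarrow> nat \<Rightarrow> 'u ef_poly"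
      using l by (subst sum.swap) simp
    have 3: "(\<Sum>i\<in>?I. \<Sum>k\<in>?I. if k = r i then f i k else 0) = (\<Sum>i\<in>?I. f i (r i))" for f :: "nat \<Rightarrow> nat \<Rightarrow> 'u ef_poly"
      by (intro sum.cong refl) (use refl_index_simps(1) in simp)
    show ?thesis
      unfolding sum.distrib sum_subtractf 1 2 3
      by (simp add: sum_distrib_left eta_def)
  qed
  also have "(\<Sum>i\<in>?I. var_e i * (var_e j * const (F i l))) = var_e j * etaF l"
    by (simp add: eta_def sum_distrib_left var_e_left_commute[of "var_e j"])
  also have "(\<Sum>k\<in>?I. var_e l * (var_e k * const (F k j))) = var_e l * etaF j"
    by (simp add: eta_def sum_distrib_left)
  finally show ?thesis
    unfolding sum_sgi_var_e by simp
qed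

context
  fixes c :: complex
begin

definition "shift_c = (const (c *\<^sub>C 1) :: 'u ef_poly)"
definition "etac j = eta (2 * n) (shift_entry F c) j"

lemma central_shift: "central shift_c"
  unfolding central_def
proof
  fix z :: "'u ef_poly"
  show "shift_c * z = z * shift_c"
    by (rule additive_eqI[of "\<lambda>z. shift_c * z" "\<lambda>z. z * shift_c"])
      (auto simp: algebra_simps shift_c_def const_eq mult_single mult_scaleC_left mult_scaleC_right)
qed

lemma etac_eq: "j \<in> {1..2 * n} \<Longrightarrow> etac j = etaF j + shift_c * var_e j"
  by (simp add: etac_def eta_def shift_entry_def const_simps distrib_left sum.distrib if_distrib[of const]
      if_distrib[of "(*) _"] shift_c_def[symmetric] var_e_commute[of shift_c] cong: if_cong)

lemma etac_commutator:
  assumes j: "j \<in> {1..2 * n}" and l: "l \<in> {1..2 * n}"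
  shows "etac j * etac l - etac l * etac j = var_e j * etac l - var_e l * etac j
    + (if l = r j then of_int (sgi n j) * (\<Sum>i\<in>{1..2 * n}. of_int (sgi n i) * (var_e i * etac (r i))) else 0)"
proof -
  have 1: "etac j * etac l - etac l * etac j = etaF j * etaF l - etaF l * etaF j"
    using j l
    by (simp add: etac_eq algebra_simps central_left_commute[OF central_shift, of "eta _ _ _"]
        central_left_commute[OF central_shift, of "var_e _"] var_e_left_commute[of "eta _ _ _"]
        var_e_commute[of "eta _ _ _"] var_e_commute[of "var_e j" l])
  have 2: "var_e j * etac l - var_e l * etac j = var_e j * etaF l - var_e l * etaF j"
    using j l by (simp add: etac_eq algebra_simps central_left_commute[OF central_shift, of "var_e _"]
        var_e_commute[of "var_e j" l])
  have 3: "(\<Sum>i\<in>{1..2 * n}. of_int (sgi n i) * (var_e i * etac (r i)))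
      = (\<Sum>i\<in>{1..2 * n}. of_int (sgi n i) * (var_e i * etaF (r i)))
        + (\<Sum>i\<in>{1..2 * n}. of_int (sgi n i) * (var_e i * (var_e (r i) * shift_c)))"
    unfolding sum.distrib[symmetric]
    by (rule sum.cong) (use refl_index_simps(1) in \<open>simp_all add: etac_eq distrib_left var_e_commute[of shift_c]\<close>)
  show ?thesis
    unfolding 1 2 3 sum_sgi_var_e add_0_right by (rule eta_commutator[OF j l])
qed

lemma sum_sgi_etac: "(\<Sum>i\<in>{1..2 * n}. of_int (sgi n i) * (var_e i * etac (r i)))
    = (\<Sum>i\<in>{1..n}. var_e (r i) * etac i - var_e i * etac (r i))"
  by (subst sum_refl_index) (intro sum.cong refl, auto simp: sgi_def refl_index_def)

lemma diff_f_etac: "diff_f i (etac j) = 0"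
  by (simp add: etac_def eta_def derivation_sum[OF derivation_diff_f] derivation_mult[OF derivation_diff_f]
      diff_f_var_e diff_f_const)

lemma symplectic_calculus:
  "symplectic_calculus {1..n} var_e (\<lambda>i. var_e (r i)) var_f (\<lambda>i. var_f (r i)) etac (\<lambda>i. etac (r i))
    diff_f (\<lambda>i. diff_f (r i)) (pairing :: _ \<Rightarrow> 'u)"
proof
  fix i j :: nat
  assume "i \<in> {1..n}" "j \<in> {1..n}"
  \<comment> \<open>Both indices lie in the lower half, so the extra term can occur only between i
    and r i, where sgi n i = - 1 gives the minus sign of \<open>ab\<close>.\<close>
  then have in_I: "i \<in> {1..2 * n}" "j \<in> {1..2 * n}" "r i \<in> {1..2 * n}" "r j \<in> {1..2 * n}"
    and ne: "j \<noteq> r i" "r j \<noteq> r (r i)" "r i \<noteq> j" "r j \<noteq> i" "r i = r j \<longleftrightarrow> i = j" "sgi n i = - 1"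
    by (auto simp: refl_index_def sgi_def)
  show "etac i * etac j - etac j * etac i = var_e i * etac j - var_e j * etac i"
    using etac_commutator[of i j] in_I ne by simp
  show "etac (r i) * etac (r j) - etac (r j) * etac (r i) = var_e (r i) * etac (r j) - var_e (r j) * etac (r i)"
    using etac_commutator[of "r i" "r j"] in_I ne by simp
  show "etac i * etac (r j) - etac (r j) * etac i = var_e i * etac (r j) - var_e (r j) * etac i
      - (if i = j then \<Sum>l\<in>{1..n}. var_e (r l) * etac l - var_e l * etac (r l) else 0)"
    using etac_commutator[of i "r j", unfolded sum_sgi_etac] in_I ne by auto
  show "diff_f i (var_f j) = (if j = i then 1 else 0)" "diff_f i (var_f (r j)) = 0"
    "diff_f (r i) (var_f (r j)) = (if j = i then 1 else 0)" "diff_f (r i) (var_f j) = 0"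
    using ne by (auto simp: diff_f_var_f)
qed (simp_all add: central_var_e central_var_f derivation_diff_f diff_f_var_e diff_f_etac pairing_add pairing_var_e)

end

end

section \<open>Brackets of the matrices F_ij\<close>

definition unit_coeff :: "nat \<Rightarrow> nat \<Rightarrow> complex" where
  "unit_coeff i a = of_bool (i = a + 1)"

lemma sum_unit_coeff:
  assumes "j \<in> {1..2 * n}"
  shows "(\<Sum>m\<in>{0..<2 * n}. unit_coeff j m * unit_coeff k m) = of_bool (j = k)"
proof -
  have "unit_coeff j m * unit_coeff k m = (if m = j - 1 then of_bool (j = k) else 0)" for m
    using assms by (auto simp: unit_coeff_def)
  then show ?thesis
    using assms by auto
qed

lemma F_mat_carrier: "F_mat n i j \<in> carrier_mat (2 * n) (2 * n)"
  using F_mat_in_sp_mats sp_matsD(1) by blast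

lemma F_mat_coeff:
  assumes "i \<in> {1..2 * n}" "j \<in> {1..2 * n}" "a < 2 * n" "b < 2 * n"
  shows "F_mat n i j $$ (a, b) = unit_coeff i a * unit_coeff j b
    - eps n i * eps n j * (unit_coeff (refl_index n j) a * unit_coeff (refl_index n i) b)"
proof -
  obtain a' b' where ab: "a + a' + 1 = 2 * n" "b + b' + 1 = 2 * n"
    using assms(3,4) by (metis Suc_eq_plus1 add_Suc_right less_natE)
  have "j = a' + 1 \<longleftrightarrow> refl_index n j = a + 1" "i = b' + 1 \<longleftrightarrow> refl_index n i = b + 1"
    using assms ab by (auto simp: refl_index_def)
  then show ?thesis
    unfolding F_mat_index[OF assms(3,4) ab] by (simp add: unit_coeff_def)
qed

lemma F_mat_mult_coeff:
  assumes I: "i \<in> {1..2 * n}" "j \<in> {1..2 * n}" "k \<in> {1..2 * n}" "l \<in> {1..2 * n}" and "a < 2 * n" "b < 2 * n"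
  shows "(F_mat n i j * F_mat n k l) $$ (a, b)
    = unit_coeff i a * unit_coeff l b * of_bool (j = k)
    - eps n k * eps n l * (unit_coeff i a * unit_coeff (refl_index n k) b * of_bool (j = refl_index n l))
    - eps n i * eps n j * (unit_coeff (refl_index n j) a * unit_coeff l b * of_bool (refl_index n i = k))
    + eps n i * eps n j * (eps n k * eps n l) * (unit_coeff (refl_index n j) a * unit_coeff (refl_index n k) b * of_bool (i = l))"
proof -
  let ?r = "refl_index n"
  have "(F_mat n i j * F_mat n k l) $$ (a, b) = (\<Sum>m\<in>{0..<2 * n}. F_mat n i j $$ (a, m) * F_mat n k l $$ (m, b))"
    using F_mat_carrier[of n i j] F_mat_carrier[of n k l] assms by (simp add: scalar_prod_def)
  also have "\<dots> = (\<Sum>m\<in>{0..<2 * n}. unit_coeff i a * unit_coeff l b * (unit_coeff j m * unit_coeff k m)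
      - eps n k * eps n l * (unit_coeff i a * unit_coeff (?r k) b * (unit_coeff j m * unit_coeff (?r l) m))
      - eps n i * eps n j * (unit_coeff (?r j) a * unit_coeff l b * (unit_coeff (?r i) m * unit_coeff k m))
      + eps n i * eps n j * (eps n k * eps n l)
        * (unit_coeff (?r j) a * unit_coeff (?r k) b * (unit_coeff (?r i) m * unit_coeff (?r l) m)))"
    using assms by (intro sum.cong) (simp_all add: F_mat_coeff algebra_simps)
  also have "\<dots> = unit_coeff i a * unit_coeff l b * (\<Sum>m\<in>{0..<2 * n}. unit_coeff j m * unit_coeff k m)
      - eps n k * eps n l * (unit_coeff i a * unit_coeff (?r k) b * (\<Sum>m\<in>{0..<2 * n}. unit_coeff j m * unit_coeff (?r l) m))
      - eps n i * eps n j * (unit_coeff (?r j) a * unit_coeff l b * (\<Sum>m\<in>{0..<2 * n}. unit_coeff (?r i) m * unit_coeff k m))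
      + eps n i * eps n j * (eps n k * eps n l)
        * (unit_coeff (?r j) a * unit_coeff (?r k) b * (\<Sum>m\<in>{0..<2 * n}. unit_coeff (?r i) m * unit_coeff (?r l) m))"
    by (simp only: sum.distrib sum_subtractf sum_distrib_left)
  also have "?r i = ?r l \<longleftrightarrow> i = l"
    using I by (auto simp: refl_index_def)
  ultimately show ?thesis
    using I refl_index_simps(1) by (simp only: sum_unit_coeff)
qed

lemma eps_refl_index: "i \<in> {1..2 * n} \<Longrightarrow> eps n (refl_index n i) = - eps n i"
  by (auto simp: eps_def refl_index_def)

lemma eps_square: "eps n i * eps n i = 1" "eps n i * (eps n i * z) = z"
  by (simp_all add: eps_def)

lemma F_mat_commutator:
  assumes I: "i \<in> {1..2 * n}" "j \<in> {1..2 * n}" "k \<in> {1..2 * n}" "l \<in> {1..2 * n}"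
  shows "F_mat n i j * F_mat n k l - F_mat n k l * F_mat n i j
    = of_bool (k = j) \<cdot>\<^sub>m F_mat n i l - of_bool (i = l) \<cdot>\<^sub>m F_mat n k j
      - (of_bool (k = refl_index n i) * (eps n i * eps n j)) \<cdot>\<^sub>m F_mat n (refl_index n j) l
      + (of_bool (l = refl_index n j) * (eps n i * eps n j)) \<cdot>\<^sub>m F_mat n k (refl_index n i)"
    (is "?L = ?R")
proof (rule eq_matI)
  let ?r = "refl_index n"
  have dim: "dim_row (F_mat n i j) = 2 * n" "dim_col (F_mat n i j) = 2 * n" for i j
    using F_mat_carrier[of n i j] by auto
  show "dim_row ?L = dim_row ?R" "dim_col ?L = dim_col ?R"
    by (simp_all add: dim)
  fix a b assume "a < dim_row ?R" "b < dim_col ?R"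
  then have ab: "a < 2 * n" "b < 2 * n"
    by (simp_all add: dim)
  note ri = refl_index_simps(1)[OF I(1)] and rj = refl_index_simps(1)[OF I(2)]
  have L: "?L $$ (a, b) = (F_mat n i j * F_mat n k l) $$ (a, b) - (F_mat n k l * F_mat n i j) $$ (a, b)"
    using ab by (subst index_minus_mat(1)) (simp_all add: dim)
  have R: "?R $$ (a, b) = of_bool (k = j) * F_mat n i l $$ (a, b) - of_bool (i = l) * F_mat n k j $$ (a, b)
      - of_bool (k = ?r i) * (eps n i * eps n j) * F_mat n (?r j) l $$ (a, b)
      + of_bool (l = ?r j) * (eps n i * eps n j) * F_mat n k (?r i) $$ (a, b)"
    using ab by (simp add: dim)
  \<comment> \<open>All Kronecker conditions are reduced to the four that occur in the claim, so
    that the final case split decides every entry.\<close>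
  have eqs: "j = k \<longleftrightarrow> k = j" "j = ?r l \<longleftrightarrow> l = ?r j" "?r i = k \<longleftrightarrow> k = ?r i" "l = i \<longleftrightarrow> i = l"
      "?r k = i \<longleftrightarrow> k = ?r i" "i = ?r k \<longleftrightarrow> k = ?r i" "?r l = j \<longleftrightarrow> l = ?r j"
    using I by (auto simp: refl_index_def)
  show "?L $$ (a, b) = ?R $$ (a, b)"
    unfolding L R F_mat_mult_coeff[OF I ab] F_mat_mult_coeff[OF I(3,4,1,2) ab] F_mat_coeff[OF I(1,4) ab]
      F_mat_coeff[OF I(3,2) ab] F_mat_coeff[OF rj I(4) ab] F_mat_coeff[OF I(3) ri ab] eqs
      refl_index_simps(2)[OF I(1)] refl_index_simps(2)[OF I(2)] eps_refl_index[OF I(1)] eps_refl_index[OF I(2)]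
    using refl_index_simps(2)[OF I(1)] refl_index_simps(2)[OF I(2)] eps_refl_index[OF I(1)] eps_refl_index[OF I(2)]
    by (cases "k = j"; cases "i = l"; cases "k = ?r i"; cases "l = ?r j")
      (simp_all add: eps_square algebra_simps del: atLeastAtMost_iff)
qed

lemma of_bool_scaleC: "of_bool P *\<^sub>C (z :: 'a::complex_algebra_1) = (if P then z else 0)"
  using of_nat_mult_eq_scaleC[of 0 z] by (simp add: scaleC_one)

lemma lie_bracket_F_sp:
  fixes i j k l :: nat
  defines "n \<equiv> CARD('n::finite)"
  assumes "i \<in> {1..2 * n}" "j \<in> {1..2 * n}" "k \<in> {1..2 * n}" "l \<in> {1..2 * n}"
  shows "lie_bracket (F_sp i j :: 'n sp) (F_sp k l) = of_bool (k = j) *\<^sub>C F_sp i l - of_bool (i = l) *\<^sub>C F_sp k j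
    - (of_bool (k = refl_index n i) * (eps n i * eps n j)) *\<^sub>C F_sp (refl_index n j) l
    + (of_bool (l = refl_index n j) * (eps n i * eps n j)) *\<^sub>C F_sp k (refl_index n i)"
  using assms(2-) unfolding n_def by transfer (rule F_mat_commutator)

lemma uea_of_diff: "uea_of (x - y) = uea_of x - uea_of y"
  using uea_of_add[of "x - y" y] by (simp add: algebra_simps)

lemma eps_mult_scaleC: "(eps n i * eps n j) *\<^sub>C (z :: 'a::complex_algebra_1) = of_int (sgi n i * sgi n j) * z"
proof -
  have "(- 1) *\<^sub>C z = - z"
    using scaleC_add_left[of 1 "- 1" z] of_nat_mult_eq_scaleC[of 0 z]
    by (simp add: scaleC_one add_eq_0_iff)
  then show ?thesis
    by (simp add: eps_def sgi_def scaleC_one)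
qed

lemma sp_generators_F_uea: "sp_generators CARD('n::finite) (F_uea :: nat \<Rightarrow> nat \<Rightarrow> 'n sp uea)"
proof
  fix i j k l :: nat
  let ?n = "CARD('n)"
  assume I: "i \<in> {1..2 * ?n}" "j \<in> {1..2 * ?n}" "k \<in> {1..2 * ?n}" "l \<in> {1..2 * ?n}"
  have "(F_uea i j * F_uea k l - F_uea k l * F_uea i j :: 'n sp uea) = uea_of (lie_bracket (F_sp i j) (F_sp k l))"
    by (simp add: F_uea_def uea_of_lie_bracket)
  also have "\<dots> = of_bool (k = j) *\<^sub>C F_uea i l - of_bool (i = l) *\<^sub>C F_uea k j
      - of_bool (k = refl_index ?n i) *\<^sub>C (eps ?n i * eps ?n j) *\<^sub>C F_uea (refl_index ?n j) l
      + of_bool (l = refl_index ?n j) *\<^sub>C (eps ?n i * eps ?n j) *\<^sub>C F_uea k (refl_index ?n i)"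
    unfolding lie_bracket_F_sp[OF I] by (simp add: uea_of_add uea_of_diff uea_of_scaleC F_uea_def scaleC_scaleC)
  finally show "(F_uea i j * F_uea k l - F_uea k l * F_uea i j :: 'n sp uea)
      = (if k = j then F_uea i l else 0) - (if i = l then F_uea k j else 0)
        - (if k = refl_index ?n i then of_int (sgi ?n i * sgi ?n j) * F_uea (refl_index ?n j) l else 0)
        + (if l = refl_index ?n j then of_int (sgi ?n i * sgi ?n j) * F_uea k (refl_index ?n i) else 0)"
    unfolding of_bool_scaleC eps_mult_scaleC .
qed

section \<open>Comparison of the two permanents\<close>

text \<open>Lowering the arguments of the k - p B-factors by one changes their product by (k - p) *
  t times a shorter one, and (k - p) * (k choose p) = k * (k - 1 choose p). The right-hand side is
  the form in which D_k arises, because F tilde subtracts 1 in the upper half.\<close>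

lemma (in twisted_pair) ordered_sum_diff:
  "ordered_sum k z - of_nat k * (t * ordered_sum (k - 1) z)
    = (\<Sum>p\<le>k. of_nat (k choose p) * (rA z p * rB (z + int p - 1) (k - p)))"
proof (cases k)
  case 0
  then show ?thesis by (simp add: ordered_sum_def)
next
  case (Suc l)
  have diff: "of_nat (k choose p) * (rA z p * rB (z + int p) (k - p)) - of_nat (k choose p) * (rA z p * rB (z + int p - 1) (k - p))
      = of_nat k * (t * (of_nat (l choose p) * (rA z p * rB (z + int p) (l - p))))" if "p \<le> l" for p
  proof -
    have c: "(k choose p) * (k - p) = k * (l choose p)"
      using binomial_absorb_comp[of k p] Suc by (simp add: mult.commute)
    have "k - p = Suc (l - p)"
      using that Suc by simp
    then have e: "rB (z + int p) (k - p) - rB (z + int p - 1) (k - p) = of_nat (k - p) * (t * rB (z + int p) (l - p))"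
      using rising_shifted_diff[OF centralD[OF t_central, symmetric], of B "z + int p" "l - p"] by (simp only:)
    have "of_nat (k choose p) * (rA z p * rB (z + int p) (k - p)) - of_nat (k choose p) * (rA z p * rB (z + int p - 1) (k - p))
        = of_nat (k choose p) * (rA z p * (rB (z + int p) (k - p) - rB (z + int p - 1) (k - p)))"
      by (simp only: right_diff_distrib)
    also have "\<dots> = of_nat (k choose p) * (of_nat (k - p) * (t * (rA z p * rB (z + int p) (l - p))))"
      unfolding e of_nat_left_commute[of "rA z p"] central_left_commute[OF t_central, of "rA z p"] ..
    also have "\<dots> = of_nat ((k choose p) * (k - p)) * (t * (rA z p * rB (z + int p) (l - p)))"
      by (simp only: of_nat_mult mult.assoc)
    also have "\<dots> = of_nat k * (t * (of_nat (l choose p) * (rA z p * rB (z + int p) (l - p))))"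
      unfolding c by (simp only: of_nat_mult mult.assoc of_nat_left_commute[of t])
    finally show ?thesis .
  qed
  have "ordered_sum k z - (\<Sum>p\<le>k. of_nat (k choose p) * (rA z p * rB (z + int p - 1) (k - p)))
      = (\<Sum>p\<le>l. of_nat (k choose p) * (rA z p * rB (z + int p) (k - p))
          - of_nat (k choose p) * (rA z p * rB (z + int p - 1) (k - p)))"
    unfolding Suc ordered_sum_def sum_subtractf[symmetric] by simp
  also have "\<dots> = (\<Sum>p\<le>l. of_nat k * (t * (of_nat (l choose p) * (rA z p * rB (z + int p) (l - p)))))"
    by (rule sum.cong) (simp_all only: atMost_iff diff)
  also have "\<dots> = of_nat k * (t * ordered_sum (k - 1) z)"
    using Suc by (simp add: ordered_sum_def sum_distrib_left)
  finally show ?thesis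
    by (simp add: algebra_simps)
qed

text \<open>Expanding the rising product gives a sum over all words, and words with the same letters
  contribute equally.\<close>

lemma sum_sorted_words_prod:
  fixes g :: "int \<Rightarrow> nat \<Rightarrow> 'a::ring_1"
  assumes "finite S"
    and "\<And>z i j. i \<in> S \<Longrightarrow> j \<in> S \<Longrightarrow> g z i * g (z + 1) j = g z j * g (z + 1) i"
  shows "(\<Sum>\<alpha>\<in>sorted_words S m. of_nat (card (permutations_of_multiset (mset \<alpha>)))
      * prod_list (map (\<lambda>r. g (z + int r) (\<alpha> ! r)) [0..<length \<alpha>]))
    = rising (\<lambda>z. \<Sum>j\<in>S. g z j) z m"
proof -
  have "rising (\<lambda>z. \<Sum>j\<in>S. g z j) z m = (\<Sum>w\<in>words S m. prod_list (map (\<lambda>r. g (z + int r) (w ! r)) [0..<length w]))"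
    by (simp add: rising_conv_prod_list prod_list_sum words_def)
  also have "\<dots> = (\<Sum>\<alpha>\<in>sorted_words S m. of_nat (card (permutations_of_multiset (mset \<alpha>)))
      * prod_list (map (\<lambda>r. g (z + int r) (\<alpha> ! r)) [0..<length \<alpha>]))"
    by (intro sum_words_invariant assms(1) prod_list_mset_invariant[of S g] assms(2))
  finally show ?thesis ..
qed

lemma sorted_filter_append:
  "sorted \<alpha> \<Longrightarrow> filter (\<lambda>i. i \<le> n) \<alpha> @ filter (\<lambda>i. n < i) \<alpha> = (\<alpha> :: nat list)"
proof (induction \<alpha>)
  case (Cons i \<alpha>)
  show ?case
  proof (cases "i \<le> n")
    case False
    then have "filter (\<lambda>i. i \<le> n) \<alpha> = []"
      using Cons.prems by (auto simp: filter_empty_conv)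
    then show ?thesis
      using Cons False by simp
  qed (use Cons in auto)
qed simp

lemma sum_sorted_words_split:
  "(\<Sum>\<alpha>\<in>sorted_words {1..2 * n} k. h \<alpha>)
    = (\<Sum>p\<le>k. \<Sum>\<alpha>\<in>sorted_words {1..n} p. \<Sum>\<beta>\<in>sorted_words {n + 1..2 * n} (k - p). h (\<alpha> @ \<beta>))"
proof -
  have filter: "filter (\<lambda>i. i \<le> n) \<alpha> = \<alpha>" "filter (\<lambda>i. n < i) \<alpha> = []" if "set \<alpha> \<subseteq> {1..n}" for \<alpha>
    using that by (auto simp: filter_id_conv filter_empty_conv)
  have filter': "filter (\<lambda>i. i \<le> n) \<beta> = []" "filter (\<lambda>i. n < i) \<beta> = \<beta>" if "set \<beta> \<subseteq> {n + 1..2 * n}" for \<beta>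
    using that by (auto simp: filter_id_conv filter_empty_conv)
  have len: "length (filter (\<lambda>i. i \<le> n) \<alpha>) + length (filter (\<lambda>i. n < i) \<alpha>) = length \<alpha>" for \<alpha>
    using sum_length_filter_compl[of "\<lambda>i. i \<le> n" \<alpha>] by (simp add: not_le)
  have "(\<Sum>p\<le>k. \<Sum>\<alpha>\<in>sorted_words {1..n} p. \<Sum>\<beta>\<in>sorted_words {n + 1..2 * n} (k - p). h (\<alpha> @ \<beta>))
      = (\<Sum>(p, \<alpha>, \<beta>)\<in>(SIGMA p:{..k}. sorted_words {1..n} p \<times> sorted_words {n + 1..2 * n} (k - p)). h (\<alpha> @ \<beta>))"
    unfolding sum.cartesian_product by (rule sum.Sigma) (simp_all add: finite_sorted_words)
  also have "\<dots> = (\<Sum>\<alpha>\<in>sorted_words {1..2 * n} k. h \<alpha>)"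
  proof (rule sum.reindex_bij_witness[where i = "\<lambda>\<alpha>. (length (filter (\<lambda>i. i \<le> n) \<alpha>), filter (\<lambda>i. i \<le> n) \<alpha>, filter (\<lambda>i. n < i) \<alpha>)"
        and j = "\<lambda>(p, \<alpha>, \<beta>). \<alpha> @ \<beta>"])
    fix x assume "x \<in> (SIGMA p:{..k}. sorted_words {1..n} p \<times> sorted_words {n + 1..2 * n} (k - p))"
    then obtain p \<alpha> \<beta> where x: "x = (p, \<alpha>, \<beta>)" "p \<le> k" "length \<alpha> = p" "length \<beta> = k - p" "sorted \<alpha>" "sorted \<beta>"
      and s: "set \<alpha> \<subseteq> {1..n}" "set \<beta> \<subseteq> {n + 1..2 * n}"
      by (auto simp: sorted_words_def words_def)
    have "i \<le> j" if "i \<in> set \<alpha>" "j \<in> set \<beta>" for i j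
    proof -
      have "i \<le> n" "n + 1 \<le> j"
        using that s by auto
      then show ?thesis by simp
    qed
    moreover have "set \<alpha> \<subseteq> {1..2 * n}" "set \<beta> \<subseteq> {1..2 * n}"
      using s by (auto elim!: order_trans)
    ultimately show "(case x of (p, \<alpha>, \<beta>) \<Rightarrow> \<alpha> @ \<beta>) \<in> sorted_words {1..2 * n} k"
      using x by (simp add: sorted_words_def words_def sorted_append)
    show "(\<lambda>\<alpha>. (length (filter (\<lambda>i. i \<le> n) \<alpha>), filter (\<lambda>i. i \<le> n) \<alpha>, filter (\<lambda>i. n < i) \<alpha>))
        (case x of (p, \<alpha>, \<beta>) \<Rightarrow> \<alpha> @ \<beta>) = x"
      using x filter[OF s(1)] filter'[OF s(2)] by simp
  next
    fix \<alpha> assume "\<alpha> \<in> sorted_words {1..2 * n} k"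
    then have \<alpha>: "sorted \<alpha>" "length \<alpha> = k" "set \<alpha> \<subseteq> {1..2 * n}"
      by (auto simp: sorted_words_def words_def)
    then show "(length (filter (\<lambda>i. i \<le> n) \<alpha>), filter (\<lambda>i. i \<le> n) \<alpha>, filter (\<lambda>i. n < i) \<alpha>)
        \<in> (SIGMA p:{..k}. sorted_words {1..n} p \<times> sorted_words {n + 1..2 * n} (k - p))"
      using len[of \<alpha>] by (auto simp: sorted_words_def words_def sorted_filter[of id, simplified])
  qed (auto simp: sorted_words_def sorted_filter_append)
  finally show ?thesis ..
qed

lemma multi_fact_append:
  assumes "set \<alpha> \<inter> set \<beta> = {}"
  shows "multi_fact (\<alpha> @ \<beta>) = multi_fact \<alpha> * multi_fact \<beta>"
proof -
  have "multi_fact (\<alpha> @ \<beta>) = (\<Prod>i\<in>set \<alpha>. fact (count_list (\<alpha> @ \<beta>) i)) * (\<Prod>i\<in>set \<beta>. fact (count_list (\<alpha> @ \<beta>) i))"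
    unfolding multi_fact_def set_append by (rule prod.union_disjoint) (use assms in auto)
  also have "(\<Prod>i\<in>set \<alpha>. fact (count_list (\<alpha> @ \<beta>) i)) = multi_fact \<alpha>"
    unfolding multi_fact_def using assms by (intro prod.cong) (auto simp: count_list_0_iff disjoint_iff)
  also have "(\<Prod>i\<in>set \<beta>. fact (count_list (\<alpha> @ \<beta>) i)) = multi_fact \<beta>"
  proof -
    have "count_list \<alpha> i = 0" if "i \<in> set \<beta>" for i
      using assms that by (auto simp: count_list_0_iff)
    then show ?thesis
      unfolding multi_fact_def by (intro prod.cong) simp_all
  qed
  finally show ?thesis .
qed

lemma prod_list_nth_append:
  fixes f :: "nat \<Rightarrow> nat \<Rightarrow> 'a::ring_1"
  shows "prod_list (map (\<lambda>r. f r ((\<alpha> @ \<beta>) ! r)) [0..<length (\<alpha> @ \<beta>)])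
    = prod_list (map (\<lambda>r. f r (\<alpha> ! r)) [0..<length \<alpha>]) * prod_list (map (\<lambda>r. f (length \<alpha> + r) (\<beta> ! r)) [0..<length \<beta>])"
proof -
  have "[0..<length (\<alpha> @ \<beta>)] = [0..<length \<alpha>] @ map (\<lambda>r. r + length \<alpha>) [0..<length \<beta>]"
    by (simp add: upt_add_eq_append[of 0 "length \<alpha>" "length \<beta>", simplified] map_add_upt add.commute)
  then have "prod_list (map (\<lambda>r. f r ((\<alpha> @ \<beta>) ! r)) [0..<length (\<alpha> @ \<beta>)])
      = prod_list (map (\<lambda>r. f r ((\<alpha> @ \<beta>) ! r)) [0..<length \<alpha>])
        * prod_list (map (\<lambda>r. f (r + length \<alpha>) ((\<alpha> @ \<beta>) ! (r + length \<alpha>))) [0..<length \<beta>])"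
    by (simp only: map_append prod_list.append map_map o_def)
  also have "\<dots> = prod_list (map (\<lambda>r. f r (\<alpha> ! r)) [0..<length \<alpha>])
      * prod_list (map (\<lambda>r. f (length \<alpha> + r) (\<beta> ! r)) [0..<length \<beta>])"
    by (intro arg_cong2[of _ _ _ _ "(*)"] arg_cong[of _ _ prod_list] map_cong) (simp_all add: nth_append add.commute)
  finally show ?thesis .
qed

lemma inverse_multi_fact:
  "1 / of_nat (multi_fact \<alpha>) = of_nat (card (permutations_of_multiset (mset \<alpha>))) / (fact (length \<alpha>) :: complex)"
proof -
  have "(of_nat (card (permutations_of_multiset (mset \<alpha>))) * of_nat (multi_fact \<alpha>) :: complex) = fact (length \<alpha>)"
    unfolding of_nat_mult[symmetric] card_permutations_of_multiset_mset by simp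
  then show ?thesis
    using multi_fact_nonzero[of \<alpha>] by (simp add: field_simps)
qed

section \<open>Column and symmetrized permanents of the shifted generators\<close>

context sp_generators
begin

context
  fixes c :: complex
begin

interpretation sc: symplectic_calculus "{1..n}" var_e "\<lambda>i. var_e (r i)" var_f "\<lambda>i. var_f (r i)" "etac c" "\<lambda>i. etac c (r i)"
    diff_f "\<lambda>i. diff_f (r i)" "pairing :: _ \<Rightarrow> 'u"
  by (rule symplectic_calculus)

definition "factor z j = var_f j * shifted (etac c j) (var_e j) z"

lemma sum_factor_low: "(\<Sum>j\<in>{1..n}. factor z j) = shifted sc.A sc.s z"
  by (simp add: factor_def shifted_def sc.A_def sc.s_def distrib_left sum.distrib sum_distrib_left
      of_int_left_commute[of "var_f _"] centralD[OF central_var_f, of "var_e _"] del: One_nat_def)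

lemma sum_factor_high: "(\<Sum>j\<in>{n + 1..2 * n}. factor z j) = shifted sc.B sc.t z"
proof -
  have "(\<Sum>j\<in>{n + 1..2 * n}. factor z j) = (\<Sum>j\<in>{1..n}. factor z (r j))"
    by (rule sum.reindex_bij_witness[of _ r r]) (auto simp: refl_index_def)
  then show ?thesis
    by (simp add: factor_def shifted_def sc.B_def sc.t_def distrib_left sum.distrib sum_distrib_left
        of_int_left_commute[of "var_f _"] centralD[OF central_var_f, of "var_e _"] del: One_nat_def)
qed

text \<open>Excluding the mirror image removes Theta from the commutator; two indices of the same
  half satisfy this condition.\<close>

lemma factor_swap:
  assumes "i \<in> {1..2 * n}" "j \<in> {1..2 * n}" "j \<noteq> r i"
  shows "factor z i * factor (z + 1) j = factor z j * factor (z + 1) i"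
proof -
  have "shifted (etac c i) (var_e i) z * shifted (etac c j) (var_e j) (z + 1)
      = shifted (etac c j) (var_e j) z * shifted (etac c i) (var_e i) (z + 1) + 0"
    using etac_commutator[of i j c] assms by (intro shifted_swap central_var_e) simp
  then show ?thesis
    by (simp add: factor_def mult.assoc central_left_commute[OF central_var_f, of "shifted _ _ _"]
        central_left_commute[OF central_var_f, of "var_f _"])
qed

text \<open>The factor of column q in D_k: the column position gives the argument q, and the ones in
  F tilde lower it by 1 for j > n.\<close>

definition "ordered_factor q j = factor (int q - (if j \<le> n then 0 else 1)) j"

text \<open>A sorted word is a lower word followed by an upper one, and the inverse of its factorial
  is (k choose p) / k! times the numbers of their rearrangements. Summation inside each half then
  builds \<open>sc.rA\<close> and \<open>sc.rB\<close>.\<close>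

lemma sum_ordered_factor:
  "(\<Sum>\<alpha>\<in>sorted_words {1..2 * n} k. (1 / of_nat (multi_fact \<alpha>)) *\<^sub>C
      pairing (prod_list (map (\<lambda>q. ordered_factor q (\<alpha> ! q)) [0..<k])))
    = (1 / fact k) *\<^sub>C pairing (sc.ordered_sum k 0 - of_nat k * (sc.t * sc.ordered_sum (k - 1) 0))"
proof -
  define P where "P z \<alpha> = prod_list (map (\<lambda>q. factor (z + int q) (\<alpha> ! q)) [0..<length \<alpha>])" for z \<alpha>
  define m where "m \<alpha> = card (permutations_of_multiset (mset \<alpha>))" for \<alpha> :: "nat list"
  have summand: "(1 / of_nat (multi_fact (\<alpha> @ \<beta>))) *\<^sub>C pairing (prod_list (map (\<lambda>q. ordered_factor q ((\<alpha> @ \<beta>) ! q)) [0..<k]))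
      = (of_nat (k choose p) / fact k) *\<^sub>C pairing ((of_nat (m \<alpha>) * P 0 \<alpha>) * (of_nat (m \<beta>) * P (int p - 1) \<beta>))"
    if p: "p \<le> k" and "\<alpha> \<in> sorted_words {1..n} p" "\<beta> \<in> sorted_words {n + 1..2 * n} (k - p)" for p \<alpha> \<beta>
  proof -
    have len: "length \<alpha> = p" "length \<beta> = k - p" and sets: "set \<alpha> \<subseteq> {1..n}" "set \<beta> \<subseteq> {n + 1..2 * n}"
      using that by (auto simp: sorted_words_def words_def)
    have "\<alpha> ! q \<le> n" if "q < p" for q
      using sets(1) len(1) that nth_mem[of q \<alpha>] by (auto simp del: nth_mem)
    moreover have "\<not> \<beta> ! q \<le> n" if "q < k - p" for q
    proof -
      have "\<beta> ! q \<in> {n + 1..2 * n}"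
        using subsetD[OF sets(2) nth_mem[of q \<beta>]] len(2) that by simp
      then show ?thesis by simp
    qed
    ultimately have "prod_list (map (\<lambda>q. ordered_factor q ((\<alpha> @ \<beta>) ! q)) [0..<length (\<alpha> @ \<beta>)]) = P 0 \<alpha> * P (int p - 1) \<beta>"
      unfolding prod_list_nth_append P_def
      by (intro arg_cong2[of _ _ _ _ "(*)"] arg_cong[of _ _ prod_list] map_cong)
        (simp_all add: len ordered_factor_def algebra_simps)
    then have 1: "prod_list (map (\<lambda>q. ordered_factor q ((\<alpha> @ \<beta>) ! q)) [0..<k]) = P 0 \<alpha> * P (int p - 1) \<beta>"
      using len p by simp
    have "set \<alpha> \<inter> set \<beta> = {}"
      using sets by fastforce
    then have "1 / of_nat (multi_fact (\<alpha> @ \<beta>)) = 1 / of_nat (multi_fact \<alpha>) * (1 / of_nat (multi_fact \<beta>) :: complex)"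
      by (simp add: multi_fact_append)
    also have "\<dots> = of_nat (k choose p) / fact k * (of_nat (m \<alpha>) * of_nat (m \<beta>))"
      unfolding inverse_multi_fact by (simp add: binomial_fact[OF p] m_def len)
    finally have 2: "1 / of_nat (multi_fact (\<alpha> @ \<beta>)) = of_nat (k choose p) / fact k * (of_nat (m \<alpha>) * of_nat (m \<beta>) :: complex)" .
    have "pairing ((of_nat (m \<alpha>) * P 0 \<alpha>) * (of_nat (m \<beta>) * P (int p - 1) \<beta>))
        = of_nat (m \<alpha>) * (of_nat (m \<beta>) * pairing (P 0 \<alpha> * P (int p - 1) \<beta>))"
      by (simp add: mult.assoc sc.bra_of_nat of_nat_left_commute[of "P _ _"])
    then show ?thesis
      unfolding 1 2 by (simp add: of_nat_mult_eq_scaleC scaleC_scaleC mult_ac)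
  qed
  have low: "(\<Sum>\<alpha>\<in>sorted_words {1..n} p. of_nat (m \<alpha>) * P z \<alpha>) = sc.rA z p" for p z
  proof -
    have "(\<Sum>\<alpha>\<in>sorted_words {1..n} p. of_nat (m \<alpha>) * P z \<alpha>) = rising (\<lambda>z. \<Sum>j\<in>{1..n}. factor z j) z p"
      unfolding P_def m_def by (rule sum_sorted_words_prod) (auto simp: refl_index_def intro!: factor_swap)
    then show ?thesis by (simp only: sum_factor_low)
  qed
  have high: "(\<Sum>\<alpha>\<in>sorted_words {n + 1..2 * n} p. of_nat (m \<alpha>) * P z \<alpha>) = sc.rB z p" for p z
  proof -
    have "(\<Sum>\<alpha>\<in>sorted_words {n + 1..2 * n} p. of_nat (m \<alpha>) * P z \<alpha>) = rising (\<lambda>z. \<Sum>j\<in>{n + 1..2 * n}. factor z j) z p"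
      unfolding P_def m_def by (rule sum_sorted_words_prod) (auto simp: refl_index_def intro!: factor_swap)
    then show ?thesis by (simp only: sum_factor_high)
  qed
  have scaleC_sum: "a *\<^sub>C sum g S = (\<Sum>i\<in>S. a *\<^sub>C (g i :: 'u))" for a g and S :: "'i set"
    by (rule additive_sum) (rule scaleC_add_right)
  have "(\<Sum>\<alpha>\<in>sorted_words {1..2 * n} k. (1 / of_nat (multi_fact \<alpha>)) *\<^sub>C
      pairing (prod_list (map (\<lambda>q. ordered_factor q (\<alpha> ! q)) [0..<k])))
    = (\<Sum>p\<le>k. \<Sum>\<alpha>\<in>sorted_words {1..n} p. \<Sum>\<beta>\<in>sorted_words {n + 1..2 * n} (k - p).
        (of_nat (k choose p) / fact k) *\<^sub>C pairing ((of_nat (m \<alpha>) * P 0 \<alpha>) * (of_nat (m \<beta>) * P (int p - 1) \<beta>)))"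
    unfolding sum_sorted_words_split by (intro sum.cong refl summand) simp_all
  also have "\<dots> = (\<Sum>p\<le>k. (of_nat (k choose p) / fact k) *\<^sub>C pairing (sc.rA 0 p * sc.rB (int p - 1) (k - p)))"
    unfolding low[symmetric] high[symmetric] sum_product pairing_sum scaleC_sum ..
  also have "\<dots> = (1 / fact k) *\<^sub>C (\<Sum>p\<le>k. of_nat (k choose p) * pairing (sc.rA 0 p * sc.rB (int p - 1) (k - p)))"
    by (simp add: scaleC_sum of_nat_mult_eq_scaleC scaleC_scaleC)
  also have "(\<Sum>p\<le>k. of_nat (k choose p) * pairing (sc.rA 0 p * sc.rB (int p - 1) (k - p)))
      = pairing (sc.ordered_sum k 0 - of_nat k * (sc.t * sc.ordered_sum (k - 1) 0))"
    unfolding sc.ordered_sum_diff pairing_sum sc.bra_of_nat by simp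
  finally show ?thesis .
qed

lemma eta_shift_entry:
  assumes "j \<in> {1..2 * n}"
  shows "eta (2 * n) (shift_entry F (c + d)) j = etac c j + const (d *\<^sub>C 1) * var_e j"
  using assms
  by (simp add: etac_def eta_def shift_entry_def const_simps distrib_left sum.distrib scaleC_add_left
      if_distrib[of const] if_distrib[of "(*) _"] var_e_commute[of "const _"] cong: if_cong)

lemma sum_var_f_eta:
  "(\<Sum>j\<in>{1..2 * n}. var_f j * eta (2 * n) (shift_entry F (c + d)) j)
    = (sc.A + sc.B) + const (d *\<^sub>C 1) * (sc.s + sc.t)"
proof -
  have f: "const w * (var_f j * z) = var_f j * (const w * z)" for w j and z :: "'u ef_poly"
    by (rule central_left_commute) (rule central_var_f)
  have "(\<Sum>j\<in>{1..2 * n}. var_f j * eta (2 * n) (shift_entry F (c + d)) j)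
      = (\<Sum>j\<in>{1..2 * n}. var_f j * etac c j + const (d *\<^sub>C 1) * (var_e j * var_f j))"
    by (intro sum.cong refl)
      (simp only: eta_shift_entry, simp add: distrib_left f centralD[OF central_var_f, of "var_e _"])
  also have "\<dots> = (\<Sum>j\<in>{1..n}. (var_f j * etac c j + const (d *\<^sub>C 1) * (var_e j * var_f j))
      + (var_f (r j) * etac c (r j) + const (d *\<^sub>C 1) * (var_e (r j) * var_f (r j))))"
    by (rule sum_refl_index)
  also have "\<dots> = (sc.A + sc.B) + const (d *\<^sub>C 1) * (sc.s + sc.t)"
    by (simp add: sum.distrib sum_distrib_left distrib_left sc.A_def sc.B_def sc.s_def sc.t_def
        del: One_nat_def)
  finally show ?thesis .
qed

lemma const_of_int: "const ((of_int m) *\<^sub>C (1 :: 'u)) = of_int m"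
proof -
  have "of_int m *\<^sub>C (1 :: 'u) = of_int m"
  proof (cases m rule: int_cases2)
    case (nonneg l)
    then show ?thesis
      using of_nat_mult_eq_scaleC[of l "1 :: 'u"] by simp
  next
    case (nonpos l)
    have "(- of_nat l) *\<^sub>C (1 :: 'u) + of_nat l *\<^sub>C 1 = 0"
      using scaleC_add_left[of "- of_nat l" "of_nat l" "1 :: 'u"] of_nat_mult_eq_scaleC[of 0 "1 :: 'u"] by simp
    then have "(- of_nat l) *\<^sub>C (1 :: 'u) = - of_nat l"
      using of_nat_mult_eq_scaleC[of l "1 :: 'u"] by (simp add: eq_neg_iff_add_eq_0)
    then show ?thesis
      using nonpos(1) by simp
  qed
  then show ?thesis
    using const_of_int_mult[of m "1 :: 'u"] by (simp add: const_simps)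
qed

text \<open>The parameters of D'_k decrease along the positions; as the factors commute, the order
  can be reversed.\<close>

lemma prod_list_Xi_reversed: "prod_list (map (\<lambda>q. sc.Xi (int m - 1 - int q)) [0..<m]) = sc.rX 0 m"
proof (induction m)
  case (Suc m)
  have "prod_list (map (\<lambda>q. sc.Xi (int (Suc m) - 1 - int q)) [0..<Suc m])
      = sc.Xi (int m) * prod_list (map (\<lambda>q. sc.Xi (int m - 1 - int q)) [0..<m])"
    by (simp add: prod_list_upt_Suc del: upt_Suc) (simp add: algebra_simps)
  also have "\<dots> = sc.rX 0 m * sc.Xi (int m)"
    unfolding Suc.IH by (rule rising_commute[symmetric]) (rule sc.Xi_Xi)
  finally show ?case
    by (simp add: rising_Suc_right del: rising.simps(2))
qed simp

lemma pairing_symmetric_product: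
  assumes k: "0 < k" and c: "c = u + 1 - of_nat k / 2"
    and as: "as = map (\<lambda>q. of_nat k / 2 - 1 - of_nat q) [0..<k - 1] @ [0]"
  shows "2 * pairing (prod_list (map (\<lambda>q. \<Sum>j\<in>{1..2 * n}. var_f j
      * eta (2 * n) (shift_entry (shift_entry F u) (as ! q)) j) [0..<k]))
    = 2 * pairing (sc.rX 0 k) - of_nat k * pairing ((sc.s + sc.t) * sc.rX 0 (k - 1))"
proof -
  obtain l where l: "k = Suc l"
    using k by (cases k) auto
  define X where "X d = (sc.A + sc.B) + const (d *\<^sub>C 1) * (sc.s + sc.t)" for d
  have shift: "shift_entry (shift_entry F u) a = shift_entry F (c + (u + a - c))" for a
    by (auto simp: shift_entry_def fun_eq_iff scaleC_add_left[symmetric] add.assoc)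
  have X_of_int: "X (of_int m) = sc.Xi m" for m
    unfolding X_def const_of_int sc.Xi_def shifted_def ..
  have "prod_list (map (\<lambda>q. \<Sum>j\<in>{1..2 * n}. var_f j * eta (2 * n) (shift_entry (shift_entry F u) (as ! q)) j) [0..<k])
      = prod_list (map (\<lambda>q. X (u + as ! q - c)) [0..<k])"
    unfolding shift sum_var_f_eta X_def ..
  also have "\<dots> = prod_list (map (\<lambda>q. X (u + as ! q - c)) [0..<l]) * X (of_nat k / 2 - 1)"
    by (simp add: l as c nth_append algebra_simps)
  also have "map (\<lambda>q. X (u + as ! q - c)) [0..<l] = map (\<lambda>q. sc.Xi (int l - 1 - int q)) [0..<l]"
  proof (rule map_cong)
    fix q assume "q \<in> set [0..<l]"
    \<comment> \<open>Since c = u + 1 - k/2, the parameter k/2 - 1 - q corresponds to the argument k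
      - 2 - q, where k - 1 = l.\<close>
    then have "u + as ! q - c = of_int (int l - 1 - int q)"
      by (simp add: as l c nth_append algebra_simps add_divide_distrib)
    then show "X (u + as ! q - c) = sc.Xi (int l - 1 - int q)"
      using X_of_int by metis
  qed simp
  finally have prod: "prod_list (map (\<lambda>q. \<Sum>j\<in>{1..2 * n}. var_f j
      * eta (2 * n) (shift_entry (shift_entry F u) (as ! q)) j) [0..<k]) = sc.rX 0 l * X (of_nat k / 2 - 1)"
    unfolding prod_list_Xi_reversed .
  \<comment> \<open>The final parameter 0 leads to the argument k/2 - 1, which lies k/2 below l;
    doubling keeps the coefficients integral.\<close>
  have "2 * X (of_nat k / 2 - 1) = 2 * sc.Xi (int l) - of_nat k * (sc.s + sc.t)"
  proof -
    have "2 * const ((of_nat k / 2 - 1) *\<^sub>C (1 :: 'u)) = const ((of_int (int k - 2)) *\<^sub>C 1)"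
      by (simp add: mult_2 flip: const_simps(1) scaleC_add_left)
    then have "2 * X (of_nat k / 2 - 1) = 2 * (sc.A + sc.B) + of_int (int k - 2) * (sc.s + sc.t)"
      unfolding X_def const_of_int distrib_left[of 2] by (simp only: mult.assoc[symmetric])
    also have "\<dots> = 2 * sc.Xi (int l) - of_nat k * (sc.s + sc.t)"
      by (simp add: sc.Xi_def shifted_def l algebra_simps mult_2 del: One_nat_def)
    finally show ?thesis .
  qed
  moreover have "2 * (sc.rX 0 l * X (of_nat k / 2 - 1)) = sc.rX 0 l * (2 * X (of_nat k / 2 - 1))"
    by (simp only: mult_2 distrib_left)
  ultimately have "2 * (sc.rX 0 l * X (of_nat k / 2 - 1)) = sc.rX 0 l * (2 * sc.Xi (int l) - of_nat k * (sc.s + sc.t))"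
    by (simp only:)
  also have "\<dots> = 2 * sc.rX 0 k - of_nat k * ((sc.s + sc.t) * sc.rX 0 (k - 1))"
    by (simp only: l rising_Suc_right right_diff_distrib of_nat_left_commute[of "sc.rX 0 l"] diff_Suc_1
        centralD[OF sc.central_st, of "sc.rX 0 l"]) (simp add: mult_2 distrib_left)
  finally have "pairing (2 * (sc.rX 0 l * X (of_nat k / 2 - 1)))
      = pairing (2 * sc.rX 0 k - of_nat k * ((sc.s + sc.t) * sc.rX 0 (k - 1)))"
    by (simp only:)
  moreover have "pairing (2 * z) = 2 * pairing z" for z :: "'u ef_poly"
    by (simp only: mult_2 pairing_add)
  ultimately show ?thesis
    unfolding prod by (simp only: sc.bra_diff sc.bra_of_nat)
qed

theorem column_sum_eq_symmetrized_permanent: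
  assumes k: "0 < k" and c: "c = u + 1 - of_nat k / 2"
    and as: "as = map (\<lambda>q. of_nat k / 2 - 1 - of_nat q) [0..<k - 1] @ [0]"
    and Z: "\<And>q i j. j \<in> {1..2 * n} \<Longrightarrow> Z q i j = shift_entry F (c + of_int (int q - (if j \<le> n then 0 else 1))) i j"
  shows "(\<Sum>\<alpha>\<in>multi_indices (2 * n) k. (1 / of_nat (multi_fact \<alpha>)) *\<^sub>C
      column_permanent k (\<lambda>p q. Z q (\<alpha> ! p) (\<alpha> ! q)))
    = symmetrized_permanent (2 * n) (shift_entry F u) as"
proof -
  have eta_Z: "eta (2 * n) (Z q) j = shifted (etac c j) (var_e j) (int q - (if j \<le> n then 0 else 1))"
    if "j \<in> {1..2 * n}" for q j
  proof -
    have "eta (2 * n) (Z q) j = eta (2 * n) (shift_entry F (c + of_int (int q - (if j \<le> n then 0 else 1)))) j"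
      by (simp only: eta_def Z[OF that])
    then show ?thesis
      unfolding eta_shift_entry[OF that] const_of_int shifted_def .
  qed
  have "column_permanent k (\<lambda>p q. Z q (\<alpha> ! p) (\<alpha> ! q)) = pairing (prod_list (map (\<lambda>q. ordered_factor q (\<alpha> ! q)) [0..<k]))"
    if "\<alpha> \<in> sorted_words {1..2 * n} k" for \<alpha>
  proof -
    have \<alpha>: "set \<alpha> \<subseteq> {1..2 * n}" "length \<alpha> = k"
      using that by (auto simp: sorted_words_def words_def)
    have "\<alpha> ! q \<in> {1..2 * n}" if "q < k" for q
      using subsetD[OF \<alpha>(1) nth_mem] \<alpha>(2) that by blast
    then have "word_prod (2 * n) Z \<alpha> = prod_list (map (\<lambda>q. ordered_factor q (\<alpha> ! q)) [0..<k])"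
      unfolding word_prod_def \<alpha>(2) ordered_factor_def factor_def
      by (intro arg_cong[of _ _ prod_list] map_cong refl arg_cong2[of _ _ _ _ "(*)"])
        (simp add: eta_Z del: atLeastAtMost_iff)
    then show ?thesis
      by (simp only: column_permanent_eq_pairing[OF \<alpha>])
  qed
  then have "(\<Sum>\<alpha>\<in>multi_indices (2 * n) k. (1 / of_nat (multi_fact \<alpha>)) *\<^sub>C
      column_permanent k (\<lambda>p q. Z q (\<alpha> ! p) (\<alpha> ! q)))
      = (1 / fact k) *\<^sub>C pairing (sc.ordered_sum k 0 - of_nat k * (sc.t * sc.ordered_sum (k - 1) 0))"
    by (simp only: multi_indices_eq sum_ordered_factor[symmetric] cong: sum.cong)
  also have "pairing (sc.ordered_sum k 0 - of_nat k * (sc.t * sc.ordered_sum (k - 1) 0))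
      = pairing (prod_list (map (\<lambda>q. \<Sum>j\<in>{1..2 * n}. var_f j
          * eta (2 * n) (shift_entry (shift_entry F u) (as ! q)) j) [0..<k]))"
  proof (rule of_nat_mult_cancel[of 2])
    show "of_nat 2 * pairing (sc.ordered_sum k 0 - of_nat k * (sc.t * sc.ordered_sum (k - 1) 0))
        = of_nat 2 * pairing (prod_list (map (\<lambda>q. \<Sum>j\<in>{1..2 * n}. var_f j
          * eta (2 * n) (shift_entry (shift_entry F u) (as ! q)) j) [0..<k]))"
      unfolding of_nat_numeral by (rule trans[OF sc.bra_ordered_sum pairing_symmetric_product[OF k c as, symmetric]])
  qed simp
  also have "(1 / fact k) *\<^sub>C \<dots> = symmetrized_permanent (2 * n) (shift_entry F u) as"
  proof -
    have "length as = k"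
      using k as by simp
    then show ?thesis
      unfolding symmetrized_permanent_def Let_def
      by (simp only: symmetric_sum_eq_pairing[of "\<lambda>q. shift_entry (shift_entry F u) (as ! q)", symmetric])
  qed
  finally show ?thesis .
qed

end

end

theorem theoremB:
  fixes k :: nat and u :: complex
  assumes "0 < k"
  shows "(D_column k u :: 'n::finite sp uea) = D_symmetrized k u"
proof -
  let ?n = "CARD('n)"
  \<comment> \<open>This is u - (k/2 - 1), the scalar added on the diagonal in column 0 before the
    correction by F tilde.\<close>
  define c where "c = u + 1 - of_nat k / 2"
  define Z :: "nat \<Rightarrow> nat \<Rightarrow> nat \<Rightarrow> 'n sp uea" where
    "Z q i j = F_tilde i j + (if i = j then u *\<^sub>C 1 else 0)
      - (if i = j then (of_nat k / 2 - 1 - of_nat q) *\<^sub>C 1 else 0)" for q i j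
  interpret sp_generators ?n "F_uea :: nat \<Rightarrow> nat \<Rightarrow> 'n sp uea"
    by (rule sp_generators_F_uea)
  have minus: "- (a *\<^sub>C (1 :: 'n sp uea)) = (- a) *\<^sub>C 1" for a
  proof (rule minus_unique)
    show "a *\<^sub>C (1 :: 'n sp uea) + (- a) *\<^sub>C 1 = 0"
      using scaleC_add_left[of a "- a" "1 :: 'n sp uea"] of_bool_scaleC[of False "1 :: 'n sp uea"] by simp
  qed
  \<comment> \<open>In column q the diagonal shift is u - (k/2 - 1 - q) = c + q, lowered by 1
    through F tilde when j > n.\<close>
  have "Z q i j = shift_entry F_uea (c + of_int (int q - (if j \<le> ?n then 0 else 1))) i j" for q i j
  proof -
    have "u *\<^sub>C (1 :: 'n sp uea) - (of_nat k / 2 - 1 - of_nat q) *\<^sub>C 1 = (c + of_nat q) *\<^sub>C 1"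
      unfolding diff_conv_add_uminus[of "u *\<^sub>C 1"] minus scaleC_add_left[symmetric]
      by (simp add: c_def algebra_simps)
    moreover have "(c + of_nat q) *\<^sub>C (1 :: 'n sp uea) - 1 = (c + of_nat q - 1) *\<^sub>C 1"
      using scaleC_add_left[of "c + of_nat q - 1" 1 "1 :: 'n sp uea"] by (simp add: scaleC_one)
    ultimately show ?thesis
      by (auto simp: Z_def F_tilde_def shift_entry_def algebra_simps)
  qed
  then have "(\<Sum>\<alpha>\<in>multi_indices (2 * ?n) k. (1 / of_nat (multi_fact \<alpha>)) *\<^sub>C
      column_permanent k (\<lambda>p q. Z q (\<alpha> ! p) (\<alpha> ! q))) = (D_symmetrized k u :: 'n sp uea)"
    unfolding D_symmetrized_def by (intro column_sum_eq_symmetrized_permanent[OF assms c_def refl])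
  then show ?thesis
    by (simp only: D_column_def Z_def)
qed

end
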